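(* Let $T\ge 2$, let $\mu_1,\dots,\mu_T\in\mathcal P(\mathbb R)$ have finite first moments, and let $f\in C_{\rm lin}(\mathbb R^T)$. Assume $\mathcal M_{\rm hom}(\mu_1,\dots,\mu_T)\neq\emptyset$ and that Assumption (A) holds, with measures $\theta^{s,t}$ as in (A). Then the supremum of $\mathbb E^{\mathbb Q}[f(S)]$ over $\mathbb Q\in\mathcal M_{\rm hom}(\mu_1,\dots,\mu_T)$ is attained, and $$\max_{\mathbb Q\in\mathcal M_{\rm hom}(\mu_1,\dots,\mu_T)}\mathbb E^{\mathbb Q}[f(S)]=\inf\Big\{\sum_{t=1}^T\int_{\mathbb R}h_t\,d\mu_t\Big\},$$ where the infimum is taken over all $h_t\in C_{\rm lin}(\mathbb R)$ ($t=1,\dots,T$), $\vartheta_t\in C_b(\mathbb R^t)$ ($t=1,\dots,T-1$) and $g_{s,t,\tau}\in C_b(\mathbb R^2)$ ($(s,t,\tau)\in\Delta$) such that for all $x=(x_1,\dots,x_T)\in\mathbb R^T$ $$f(x)\le\sum_{t=1}^T h_t(x_t)+\sum_{t=1}^{T-1}\vartheta_t(x_1,\dots,x_t)(x_{t+1}-x_t)+\sum_{(s,t,\tau)\in\Delta}\Big(g_{s,t,\tau}(x_s,x_{s+\tau})\frac{d\theta^{s,t}}{d\mu_s}(x_s)-g_{s,t,\tau}(x_t,x_{t+\tau})\frac{d\theta^{s,t}}{d\mu_t}(x_t)\Big).$$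
   Context: $S=(S_1,\dots,S_T)$ is the canonical process on $\mathbb R^T$ (with Borel $\sigma$-algebra), $S_t(\omega)=\omega_t$. $\mathcal P(\mathbb R^d)$ denotes Borel probability measures. $C_{\rm lin}(\mathbb R^d)$ is the set of continuous $f:\mathbb R^d\to\mathbb R$ with $|f(x)|/(1+|x|)$ bounded; $C_b(\mathbb R^d)$ the bounded continuous functions. For $\mathbb Q\in\mathcal P(\mathbb R^T)$ and a sub-tuple $I=(t_1,\dots,t_k)$ of $(1,\dots,T)$, $\mathbb Q_I$ is the law of $(S_{t_1},\dots,S_{t_k})$ under $\mathbb Q$, and $\mathbb Q_t:=\mathbb Q_{(t)}$. $\Pi(\mu_1,\dots,\mu_T)$ is the set of $\mathbb Q$ with $\mathbb Q_t=\mu_t$ for all $t$; $\mathcal M(\mu_1,\dots,\mu_T)$ is the set of $\mathbb Q\in\Pi(\mu_1,\dots,\mu_T)$ with $\mathbb E^{\mathbb Q}[S_{t+1}\mid S_1,\dots,S_t]=S_t$ for $t=1,\dots,T-1$. Let $\Delta=\{(s,t,\tau)\in\{1,\dots,T\}^3: s<t,\ t+\tau\le T\}$. For $\mu,\nu\in\mathcal P(\mathbb R)$, an event holds "$\mu\wedge\nu$-a.s." if it holds almost surely with respect to $\mu^{\nu,\rm abs}$, the part of $\mu$ absolutely continuous w.r.t. $\nu$ in the Lebesgue decomposition $\mu=\mu^{\nu,\rm abs}+\mu^{\nu,\rm sing}$. For $\mathbb Q\in\mathcal P(\mathbb R^T)$ and $1\le s<s+\tau\le T$, let $K_{s,s+\tau}:\mathbb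 R\to\mathcal P(\mathbb R)$ be a stochastic kernel with $\mathbb Q_{(s,s+\tau)}=\mathbb Q_s\otimes K_{s,s+\tau}$. $\mathbb Q$ is called homogeneous if $K_{s,s+\tau}=K_{t,t+\tau}$ holds $\mathbb Q_s\wedge\mathbb Q_t$-a.s. for all $(s,t,\tau)\in\Delta$. $\mathcal P_{\rm hom}(\mathbb R^T)$ is the set of homogeneous measures, $\mathcal M_{\rm hom}(\mu_1,\dots,\mu_T):=\mathcal M(\mu_1,\dots,\mu_T)\cap\mathcal P_{\rm hom}(\mathbb R^T)$. Assumption (A): for all $(s,t)\in\{1,\dots,T\}^2$ there is a finite Borel measure $\theta^{s,t}$ on $\mathbb R$, equivalent to $\mu_t^{\mu_s,\rm abs}$, such that $\frac{d\theta^{s,t}}{d\mu_t}$ and $\frac{d\theta^{s,t}}{d\mu_s}$ have continuous bounded versions (these versions are used above). *)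

theory Defs
  imports "HOL-Probability.Probability"
begin

definition lebesgue_decomposition ::
  "'a measure \<Rightarrow> 'a measure \<Rightarrow> 'a measure \<Rightarrow> 'a measure \<Rightarrow> bool" where
  "lebesgue_decomposition \<mu> \<nu> \<mu>a \<mu>s \<longleftrightarrow>
     sets \<mu>a = sets \<mu> \<and> sets \<mu>s = sets \<mu> \<and>
     (\<forall>A\<in>sets \<mu>. emeasure \<mu> A = emeasure \<mu>a A + emeasure \<mu>s A) \<and>
     absolutely_continuous \<nu> \<mu>a \<and>
     (\<exists>N\<in>sets \<mu>. emeasure \<nu> N = 0 \<and> emeasure \<mu>s (space \<mu> - N) = 0)"

text \<open>The part of mu absolutely continuous w.r.t. nu (unique for finite measures).\<close>
definition abs_part :: "'a measure \<Rightarrow> 'a measure \<Rightarrow> 'a measure" where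
  "abs_part \<mu> \<nu> = (THE \<mu>a. \<exists>\<mu>s. lebesgue_decomposition \<mu> \<nu> \<mu>a \<mu>s)"

abbreviation RT :: "nat \<Rightarrow> (nat \<Rightarrow> real) measure" where
  "RT T \<equiv> PiM {1..T} (\<lambda>_. (borel :: real measure))"

abbreviation RT_space :: "nat \<Rightarrow> (nat \<Rightarrow> real) set" where
  "RT_space T \<equiv> PiE {1..T} (\<lambda>_. (UNIV :: real set))"

definition marg :: "(nat \<Rightarrow> real) measure \<Rightarrow> nat \<Rightarrow> real measure" where
  "marg Q t = distr Q borel (\<lambda>\<omega>. \<omega> t)"

definition marg2 :: "(nat \<Rightarrow> real) measure \<Rightarrow> nat \<Rightarrow> nat \<Rightarrow> (real \<times> real) measure" where
  "marg2 Q s u = distr Q (borel \<Otimes>\<^sub>M borel) (\<lambda>\<omega>. (\<omega> s, \<omega> u))"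

definition filt :: "(nat \<Rightarrow> real) measure \<Rightarrow> nat \<Rightarrow> (nat \<Rightarrow> real) measure" where
  "filt Q t = vimage_algebra (space Q) (\<lambda>\<omega>. restrict \<omega> {1..t}) (PiM {1..t} (\<lambda>_. (borel :: real measure)))"

definition is_martingale_measure :: "nat \<Rightarrow> (nat \<Rightarrow> real) measure \<Rightarrow> bool" where
  "is_martingale_measure T Q \<longleftrightarrow>
     (\<forall>t\<in>{1..<T}. integrable Q (\<lambda>\<omega>. \<omega> (Suc t)) \<and>
        (AE \<omega> in Q. real_cond_exp Q (filt Q t) (\<lambda>\<omega>. \<omega> (Suc t)) \<omega> = \<omega> t))"

definition is_kernel_for :: "(nat \<Rightarrow> real) measure \<Rightarrow> nat \<Rightarrow> nat \<Rightarrow> (real \<Rightarrow> real measure) \<Rightarrow> bool" where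
  "is_kernel_for Q s u K \<longleftrightarrow>
     K \<in> borel \<rightarrow>\<^sub>M prob_algebra borel \<and>
     marg2 Q s u = marg Q s \<bind> (\<lambda>x. distr (K x) (borel \<Otimes>\<^sub>M borel) (\<lambda>y. (x, y)))"

definition Delta :: "nat \<Rightarrow> (nat \<times> nat \<times> nat) set" where
  "Delta T = {(s, t, \<tau>). 1 \<le> s \<and> s < t \<and> 1 \<le> \<tau> \<and> t + \<tau> \<le> T}"

definition homogeneous :: "nat \<Rightarrow> (nat \<Rightarrow> real) measure \<Rightarrow> bool" where
  "homogeneous T Q \<longleftrightarrow>
     (\<forall>(s, t, \<tau>)\<in>Delta T. \<forall>K1 K2.
        is_kernel_for Q s (s + \<tau>) K1 \<longrightarrow> is_kernel_for Q t (t + \<tau>) K2 \<longrightarrow>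
        (AE x in abs_part (marg Q s) (marg Q t). K1 x = K2 x))"

definition Mhom :: "nat \<Rightarrow> (nat \<Rightarrow> real measure) \<Rightarrow> (nat \<Rightarrow> real) measure set" where
  "Mhom T \<mu> = {Q. sets Q = sets (RT T) \<and> prob_space Q \<and>
                  (\<forall>t\<in>{1..T}. marg Q t = \<mu> t) \<and>
                  is_martingale_measure T Q \<and> homogeneous T Q}"

definition Clin_R :: "(real \<Rightarrow> real) \<Rightarrow> bool" where
  "Clin_R h \<longleftrightarrow> continuous_on UNIV h \<and> (\<exists>C. \<forall>x. \<bar>h x\<bar> \<le> C * (1 + \<bar>x\<bar>))"

definition Clin_RT :: "nat \<Rightarrow> ((nat \<Rightarrow> real) \<Rightarrow> real) \<Rightarrow> bool" where
  "Clin_RT T f \<longleftrightarrow> continuous_on (RT_space T) f \<and>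
     (\<exists>C. \<forall>x\<in>RT_space T. \<bar>f x\<bar> \<le> C * (1 + (\<Sum>t=1..T. \<bar>x t\<bar>)))"

definition Cb_Rt :: "nat \<Rightarrow> ((nat \<Rightarrow> real) \<Rightarrow> real) \<Rightarrow> bool" where
  "Cb_Rt t v \<longleftrightarrow> continuous_on (RT_space t) v \<and> bounded (v ` RT_space t)"

definition Cb_R2 :: "(real \<Rightarrow> real \<Rightarrow> real) \<Rightarrow> bool" where
  "Cb_R2 g \<longleftrightarrow> continuous_on UNIV (\<lambda>(x, y). g x y) \<and> bounded (range (\<lambda>(x, y). g x y))"

text \<open>rs s t and rt s t are the chosen continuous bounded versions of
  d theta^{s,t}/d mu_s and d theta^{s,t}/d mu_t.\<close>
definition dual_feasible ::
  "nat \<Rightarrow> ((nat \<Rightarrow> real) \<Rightarrow> real) \<Rightarrow> (nat \<Rightarrow> nat \<Rightarrow> real \<Rightarrow> real) \<Rightarrow> (nat \<Rightarrow> nat \<Rightarrow> real \<Rightarrow> real) \<Rightarrow>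
   ((nat \<Rightarrow> real \<Rightarrow> real) \<times> (nat \<Rightarrow> (nat \<Rightarrow> real) \<Rightarrow> real) \<times> (nat \<Rightarrow> nat \<Rightarrow> nat \<Rightarrow> real \<Rightarrow> real \<Rightarrow> real)) set"
  where
  "dual_feasible T f rs rt = {(h, v, g).
     (\<forall>t\<in>{1..T}. Clin_R (h t)) \<and>
     (\<forall>t\<in>{1..<T}. Cb_Rt t (v t)) \<and>
     (\<forall>(s, t, \<tau>)\<in>Delta T. Cb_R2 (g s t \<tau>)) \<and>
     (\<forall>x\<in>RT_space T.
        f x \<le> (\<Sum>t=1..T. h t (x t))
              + (\<Sum>t=1..<T. v t (restrict x {1..t}) * (x (Suc t) - x t))
              + (\<Sum>(s, t, \<tau>)\<in>Delta T.
                   g s t \<tau> (x s) (x (s + \<tau>)) * rs s t (x s)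
                 - g s t \<tau> (x t) (x (t + \<tau>)) * rt s t (x t)))}"

end

theory Submission
  imports Defs
begin

text \<open>
  The dual value, as a function of the payoff divided by the weight \<open>1 + \<bar>x\<^sub>1\<bar> + \<dots> + \<bar>x\<^sub>T\<bar>\<close>, is a
  finite sublinear functional on the bounded continuous functions; finiteness is weak duality for any
  element of \<open>Mhom\<close>. Hahn-Banach gives a linear functional below it which agrees with it at the payoff
  \<open>f\<close>. Since the marginals have finite first moments, this functional is continuous along decreasing
  sequences, hence is integration against a measure by the Daniell-Riesz theorem. Hedges form a linear
  space, so domination by the dual value forces the functional to price each of them at its cost: the
  \<open>h\<close> give the marginals, the \<open>\<vartheta>\<close> the martingale property and the \<open>g\<close> homogeneity.

  For the last point and for weak duality, homogeneity is reformulated without kernels: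
  \<open>K\<^sub>s = K\<^sub>t\<close> holds \<open>\<theta>\<^sup>s\<^sup>t\<close>-a.s. iff \<open>\<theta>\<^sup>s\<^sup>t \<otimes> K\<^sub>s = \<theta>\<^sup>s\<^sup>t \<otimes> K\<^sub>t\<close>, and \<open>\<theta>\<^sup>s\<^sup>t \<otimes> K\<^sub>s\<close> is the two-dimensional
  marginal with density \<open>d\<theta>\<^sup>s\<^sup>t/d\<mu>\<^sub>s\<close>. Kernels have to exist for this (otherwise homogeneity would be
  void), so the disintegration theorem on the plane is needed.
\<close>

section \<open>The Hahn-Banach theorem\<close>

text \<open>Dividing by the weight turns payoffs of linear growth into bounded continuous functions,
  and the measure found for these is later multiplied by the reciprocal weight. Since the functional
  is tight at the payoff, the measure that represents it is a primal element whose value is the dual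
  value; attainment thus comes from the dual side. Positivity holds because the zero hedge dominates
  every nonpositive payoff. The obstacle is that a positive functional on bounded continuous
  functions over a noncompact space need not be countably additive; static hedges that pay only in
  the tails, at a cost tending to zero, rule this out. Homogeneity, a condition on kernels, becomes
  linear in the measure once the marginals are fixed, because \<open>\<theta>\<close> and its
  densities are then given data. Continuity and boundedness of these densities keep the
  \<open>g\<close>-hedges inside the space on which the functional acts.\<close>

definition sublinear :: "('a::real_vector \<Rightarrow> real) \<Rightarrow> bool" where
  "sublinear q \<longleftrightarrow> (\<forall>x y. q (x + y) \<le> q x + q y) \<and> (\<forall>c x. 0 < c \<longrightarrow> q (c *\<^sub>R x) = c * q x)"

lemma sublinearD:
  assumes "sublinear q"
  shows sublinear_add: "q (x + y) \<le> q x + q y"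
    and sublinear_scale: "0 < c \<Longrightarrow> q (c *\<^sub>R x) = c * q x"
    and sublinear_zero: "q 0 = 0"
    and sublinear_minus: "- q (- x) \<le> q x"
proof -
  show add: "q (x + y) \<le> q x + q y" for x y
    using assms by (auto simp: sublinear_def)
  show scale: "0 < c \<Longrightarrow> q (c *\<^sub>R x) = c * q x" for c x
    using assms by (auto simp: sublinear_def)
  show zero: "q 0 = 0"
    using scale[of 2 0] by simp
  show "- q (- x) \<le> q x"
    using add[of x "- x"] zero by simp
qed

text \<open>\<open>tilt q y\<close> is a sublinear functional below \<open>q\<close> that is linear along \<open>y\<close>; a minimal sublinear functional is therefore linear.\<close>

definition tilt :: "('a::real_vector \<Rightarrow> real) \<Rightarrow> 'a \<Rightarrow> 'a \<Rightarrow> real" where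
  "tilt q y x = (INF t\<in>{0..}. q (x + t *\<^sub>R y) - t * q y)"

text \<open>Writing \<open>t *\<^sub>R y\<close> as \<open>(x + t *\<^sub>R y) + (- x)\<close> gives
  a lower bound that does not depend on \<open>t\<close>, so the infimum defining
  \<open>tilt\<close> is finite.\<close>

lemma sublinear_tilt_lower:
  assumes "sublinear q" "0 \<le> t"
  shows "- q (- x) \<le> q (x + t *\<^sub>R y) - t * q y"
proof -
  have "t * q y = q (t *\<^sub>R y)"
    using assms sublinear_scale[OF assms(1), of t y] sublinear_zero[OF assms(1)]
    by (cases "t = 0") auto
  also have "\<dots> = q ((x + t *\<^sub>R y) + (- x))"
    by simp
  also have "\<dots> \<le> q (x + t *\<^sub>R y) + q (- x)"
    by (rule sublinear_add[OF assms(1)])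
  finally show ?thesis by simp
qed

lemma tilt_le:
  assumes "sublinear q" "0 \<le> t"
  shows "tilt q y x \<le> q (x + t *\<^sub>R y) - t * q y"
  unfolding tilt_def using assms
  by (intro cINF_lower bdd_belowI2[where m = "- q (- x)"] sublinear_tilt_lower) auto

text \<open>Subadditivity comes from adding the two parameters, homogeneity from rescaling the
  parameter by \<open>c\<close>.\<close>

lemma sublinear_tilt:
  assumes q: "sublinear q"
  shows "sublinear (tilt q y)"
  unfolding sublinear_def
proof (intro conjI allI impI)
  fix u v :: 'a
  have *: "tilt q y (u + v) \<le> (q (u + a *\<^sub>R y) - a * q y) + (q (v + b *\<^sub>R y) - b * q y)"
    if "0 \<le> a" "0 \<le> b" for a b
    using tilt_le[OF q, of "a + b" y "u + v"] sublinear_add[OF q, of "u + a *\<^sub>R y" "v + b *\<^sub>R y"] that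
    by (simp add: algebra_simps)
  then have "tilt q y (u + v) - (q (u + a *\<^sub>R y) - a * q y) \<le> tilt q y v" if "0 \<le> a" for a
    unfolding tilt_def[of q y v] using *[OF that] by (intro cINF_greatest) (auto simp: algebra_simps)
  then have "tilt q y (u + v) - tilt q y v \<le> tilt q y u"
    unfolding tilt_def[of q y u] by (intro cINF_greatest) (auto simp: algebra_simps)
  then show "tilt q y (u + v) \<le> tilt q y u + tilt q y v"
    by simp
next
  \<comment> \<open>This inequality already yields equality: it is used again with the factor
    \<open>1 / c\<close> at the point \<open>c *\<^sub>R u\<close>.\<close>
  have le: "tilt q y (c *\<^sub>R u) \<le> c * tilt q y u" if c: "0 < c" for c and u :: 'a
  proof -
    have "tilt q y (c *\<^sub>R u) / c \<le> q (u + t *\<^sub>R y) - t * q y" if "0 \<le> t" for t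
    proof -
      have "tilt q y (c *\<^sub>R u) \<le> q (c *\<^sub>R (u + t *\<^sub>R y)) - (c * t) * q y"
        using tilt_le[OF q, of "c * t" y "c *\<^sub>R u"] c that by (simp add: algebra_simps)
      also have "\<dots> = c * (q (u + t *\<^sub>R y) - t * q y)"
        unfolding sublinear_scale[OF q c] by (simp add: algebra_simps)
      finally show ?thesis
        using c by (simp add: field_simps)
    qed
    then have "tilt q y (c *\<^sub>R u) / c \<le> tilt q y u"
      unfolding tilt_def[of q y u] by (intro cINF_greatest) auto
    then show ?thesis
      using c by (simp add: field_simps)
  qed
  fix c :: real and u :: 'a
  assume c: "0 < c"
  have "tilt q y ((1 / c) *\<^sub>R (c *\<^sub>R u)) \<le> (1 / c) * tilt q y (c *\<^sub>R u)"
    using c by (intro le) auto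
  then have "c * tilt q y u \<le> tilt q y (c *\<^sub>R u)"
    using c by (simp add: field_simps)
  with le[OF c, of u] show "tilt q y (c *\<^sub>R u) = c * tilt q y u"
    by simp
qed

lemma tilt_le_self: "sublinear q \<Longrightarrow> tilt q y x \<le> q x"
  using tilt_le[of q 0 y x] by simp

text \<open>The parameter \<open>t = 1\<close> gives the bound. For a minimal functional it forces
  oddness; for the tilt of \<open>p\<close> it forces tightness at \<open>y\<close>.\<close>

lemma tilt_minus_le: "sublinear q \<Longrightarrow> tilt q y (- y) \<le> - q y"
  using tilt_le[of q 1 y "- y"] sublinear_zero[of q] by simp

text \<open>Zorn's lemma for the sublinear functionals below \<open>p\<close>, ordered downwards.
  The pointwise infimum of a chain is finite because every member is bounded below by
  \<open>- p (- x)\<close>.\<close>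

lemma ex_minimal_sublinear:
  fixes p :: "'a::real_vector \<Rightarrow> real"
  assumes p: "sublinear p"
  obtains m where "sublinear m" "\<And>x. m x \<le> p x"
    "\<And>q x. \<lbrakk>sublinear q; \<And>x. q x \<le> m x\<rbrakk> \<Longrightarrow> q x = m x"
proof -
  define S where "S = {q. sublinear q \<and> (\<forall>x. q x \<le> p x)}"
  define r where "r = (\<lambda>a b. \<forall>x. (b :: 'a \<Rightarrow> real) x \<le> a x)"
  have "\<exists>m\<in>S. \<forall>q\<in>S. r m q \<longrightarrow> q = m"
  proof (rule predicate_Zorn)
    show "partial_order_on S (relation_of r S)"
      unfolding partial_order_on_def preorder_on_def refl_on_def trans_def antisym_def
        relation_of_def r_def
      by (auto intro: order_trans) (intro ext, metis order_antisym)
  next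
    fix C assume C: "C \<in> Chains (relation_of r S)"
    show "\<exists>u\<in>S. \<forall>a\<in>C. r a u"
    proof (cases "C = {}")
      case True
      then show ?thesis using p by (auto simp: S_def)
    next
      case False
      have CS: "a \<in> S" if "a \<in> C" for a
        using C that by (auto simp: Chains_def relation_of_def)
      have tot: "(\<forall>x. b x \<le> a x) \<or> (\<forall>x. a x \<le> b x)" if "a \<in> C" "b \<in> C" for a b
        using C that by (auto simp: Chains_def relation_of_def r_def)
      have low: "- p (- x) \<le> a x" if "a \<in> C" for a x
      proof -
        have "sublinear a" "a (- x) \<le> p (- x)"
          using CS[OF that] by (auto simp: S_def)
        then show ?thesis
          using sublinear_minus[of a x] by simp
      qed
      define u where "u = (\<lambda>x. INF a\<in>C. a x)"
      have u_le: "u x \<le> a x" if "a \<in> C" for a x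
        unfolding u_def using that low by (intro cINF_lower bdd_belowI2[where m = "- p (- x)"]) auto
      have u_ge: "c \<le> u x" if "\<And>a. a \<in> C \<Longrightarrow> c \<le> a x" for c x
        unfolding u_def using that False by (intro cINF_greatest) auto
      have "sublinear u"
        unfolding sublinear_def
      proof (intro conjI allI impI)
        fix x y
        \<comment> \<open>A pointwise infimum of sublinear functionals need not be subadditive. In a
          chain, the smaller of the two members supplies the estimate for the mixed sum.\<close>
        have *: "u (x + y) \<le> a x + b y" if ab: "a \<in> C" "b \<in> C" for a b
          using tot[OF ab]
        proof
          assume "\<forall>x. b x \<le> a x"
          moreover have "b (x + y) \<le> b x + b y"
            using CS[OF ab(2)] by (auto simp: S_def intro: sublinear_add)
          ultimately show ?thesis
            using u_le[OF ab(2), of "x + y"] by (smt (verit))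
        next
          assume "\<forall>x. a x \<le> b x"
          moreover have "a (x + y) \<le> a x + a y"
            using CS[OF ab(1)] by (auto simp: S_def intro: sublinear_add)
          ultimately show ?thesis
            using u_le[OF ab(1), of "x + y"] by (smt (verit))
        qed
        have "u (x + y) - a x \<le> u y" if "a \<in> C" for a
          using *[OF that] by (intro u_ge) (simp add: algebra_simps)
        then have "u (x + y) - u y \<le> u x"
          by (intro u_ge) (simp add: algebra_simps)
        then show "u (x + y) \<le> u x + u y" by simp
      next
        fix c :: real and x assume c: "0 < c"
        have sc: "a (c *\<^sub>R x) = c * a x" if "a \<in> C" for a
          using CS[OF that] c by (auto simp: S_def intro: sublinear_scale)
        have "u (c *\<^sub>R x) / c \<le> u x"
          using c u_le[of _ "c *\<^sub>R x"] sc by (intro u_ge) (simp add: field_simps)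
        moreover have "c * u x \<le> a (c *\<^sub>R x)" if "a \<in> C" for a
          unfolding sc[OF that] using c u_le[OF that, of x] by simp
        then have "c * u x \<le> u (c *\<^sub>R x)"
          by (rule u_ge)
        ultimately show "u (c *\<^sub>R x) = c * u x"
          using c by (simp add: field_simps)
      qed
      moreover have "u x \<le> p x" for x
      proof -
        obtain a where "a \<in> C" using False by auto
        then show ?thesis using u_le[of a x] CS[of a] by (auto simp: S_def intro: order_trans)
      qed
      ultimately show ?thesis
        using u_le by (auto simp: S_def r_def)
    qed
  qed
  then obtain m where m: "m \<in> S" and min: "\<And>q. q \<in> S \<Longrightarrow> r m q \<Longrightarrow> q = m"
    by blast
  show thesis
  proof (rule that[of m])
    show "sublinear m" "\<And>x. m x \<le> p x"
      using m by (auto simp: S_def)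
    fix q x assume "sublinear q" "\<And>x. q x \<le> m x"
    moreover from this have "q \<in> S"
      using m unfolding S_def by (auto intro: order_trans)
    ultimately show "q x = m x"
      using min[of q] by (auto simp: r_def)
  qed
qed

text \<open>The minimal functional \<open>m\<close> is taken below \<open>tilt p y\<close> rather
  than below \<open>p\<close>, so that \<open>m (- y)\<close> is at most \<open>- p y\<close>.
  Minimality makes \<open>m\<close> odd: \<open>tilt m x\<close> lies below \<open>m\<close>, hence
  equals it, and its value at \<open>- x\<close> is at most \<open>- m x\<close>. An odd sublinear
  functional is linear.\<close>

theorem hahn_banach_tight:
  fixes p :: "'a::real_vector \<Rightarrow> real"
  assumes p: "sublinear p"
  obtains L where "linear L" "\<And>x. L x \<le> p x" "L y = p y"
proof -
  obtain m where m: "sublinear m" and mp: "\<And>x. m x \<le> tilt p y x"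
    and min: "\<And>q x. \<lbrakk>sublinear q; \<And>x. q x \<le> m x\<rbrakk> \<Longrightarrow> q x = m x"
    using ex_minimal_sublinear[OF sublinear_tilt[OF p, of y]] by metis
  have odd: "m (- x) = - m x" for x
  proof -
    have "tilt m x (- x) = m (- x)"
      by (rule min[OF sublinear_tilt[OF m] tilt_le_self[OF m]])
    then show ?thesis
      using tilt_minus_le[OF m, of x] sublinear_minus[OF m, of x] by simp
  qed
  have add: "m (x + z) = m x + m z" for x z
    using sublinear_add[OF m, of x z] sublinear_add[OF m, of "- x" "- z"] odd[of "x + z"] odd[of x] odd[of z]
    by simp
  have "m (c *\<^sub>R x) = c * m x" for c x
  proof (cases c "0::real" rule: linorder_cases)
    case less
    then show ?thesis
      using sublinear_scale[OF m, of "- c" x] odd[of "c *\<^sub>R x"] by simp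
  qed (use sublinear_scale[OF m] sublinear_zero[OF m] in auto)
  with add have "linear m"
    by (intro linearI) auto
  moreover have mp': "m x \<le> p x" for x
    using mp[of x] tilt_le_self[OF p, of y x] by simp
  moreover have "m y = p y"
    using mp[of "- y"] tilt_minus_le[OF p, of y] odd[of y] mp'[of y] by simp
  ultimately show thesis by (rule that)
qed

section \<open>Bounded continuous functions and Daniell functionals\<close>

definition Cb :: "('a::topological_space \<Rightarrow> real) \<Rightarrow> bool" where
  "Cb f \<longleftrightarrow> continuous_on UNIV f \<and> (\<exists>B. \<forall>x. \<bar>f x\<bar> \<le> B)"

lemma Cb_intros [intro!]:
  shows Cb_const: "Cb (\<lambda>x. c)"
    and Cb_add: "Cb f \<Longrightarrow> Cb g \<Longrightarrow> Cb (\<lambda>x. f x + g x)"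
    and Cb_diff: "Cb f \<Longrightarrow> Cb g \<Longrightarrow> Cb (\<lambda>x. f x - g x)"
    and Cb_mult: "Cb f \<Longrightarrow> Cb g \<Longrightarrow> Cb (\<lambda>x. f x * g x)"
    and Cb_min: "Cb f \<Longrightarrow> Cb g \<Longrightarrow> Cb (\<lambda>x. min (f x) (g x))"
    and Cb_max: "Cb f \<Longrightarrow> Cb g \<Longrightarrow> Cb (\<lambda>x. max (f x) (g x))"
proof -
  show "Cb (\<lambda>x. c)"
    unfolding Cb_def by (auto intro!: exI[of _ "\<bar>c\<bar>"])
next
  assume "Cb f" "Cb g"
  then obtain A B where c: "continuous_on UNIV f" "continuous_on UNIV g"
    and A: "\<And>x. \<bar>f x\<bar> \<le> A" and B: "\<And>x. \<bar>g x\<bar> \<le> B"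
    unfolding Cb_def by blast
  have *: "\<bar>f x + g x\<bar> \<le> A + B" "\<bar>f x - g x\<bar> \<le> A + B" "\<bar>f x * g x\<bar> \<le> A * B"
    "\<bar>min (f x) (g x)\<bar> \<le> A + B" "\<bar>max (f x) (g x)\<bar> \<le> A + B" for x
    using A[of x] B[of x] by (auto simp: abs_mult intro!: mult_mono)
  show "Cb (\<lambda>x. f x + g x)" "Cb (\<lambda>x. f x - g x)" "Cb (\<lambda>x. f x * g x)"
    "Cb (\<lambda>x. min (f x) (g x))" "Cb (\<lambda>x. max (f x) (g x))"
    using * unfolding Cb_def by (blast intro!: continuous_intros c)+
qed

lemma Cb_sum [intro!]: "(\<And>i. i \<in> I \<Longrightarrow> Cb (f i)) \<Longrightarrow> Cb (\<lambda>x. \<Sum>i\<in>I. f i x)"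
  by (induction I rule: infinite_finite_induct) auto

lemma Cb_borel_measurable: "Cb f \<Longrightarrow> f \<in> borel_measurable borel"
  unfolding Cb_def by (auto intro: borel_measurable_continuous_onI)

lemma Cb_integrable:
  assumes "finite_measure M" "sets M = sets borel" "Cb f"
  shows "integrable M f"
proof -
  obtain B where "\<And>x. \<bar>f x\<bar> \<le> B"
    using assms by (auto simp: Cb_def)
  then show ?thesis
    using Cb_borel_measurable[OF assms(3)] assms
    by (intro finite_measure.integrable_const_bound[where B = B]) (auto simp: measurable_cong_sets[of M borel])
qed

text \<open>A ramp that increases with \<open>n\<close> to the indicator of an open
  \<open>U\<close>. The whole space is a separate case because \<open>infdist\<close> to the empty
  set is 0.\<close>

definition bump :: "'a::metric_space set \<Rightarrow> nat \<Rightarrow> 'a \<Rightarrow> real" where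
  "bump U n x = (if U = UNIV then 1 else min 1 (real n * infdist x (- U)))"

lemma Cb_bump: "Cb (bump U n)"
  unfolding Cb_def
proof
  show "continuous_on UNIV (bump U n)"
    by (cases "U = UNIV") (auto simp: bump_def[abs_def] intro!: continuous_intros)
  have "\<bar>bump U n x\<bar> \<le> 1" for x
    using infdist_nonneg[of x "- U"] by (auto simp: bump_def abs_le_iff min_def intro: order_trans[of _ 0])
  then show "\<exists>B. \<forall>x. \<bar>bump U n x\<bar> \<le> B" by blast
qed

lemma bump_nonneg: "0 \<le> bump U n x"
  by (auto simp: bump_def infdist_nonneg)

lemma bump_le_indicator: "bump U n x \<le> indicator U x"
  by (auto simp: bump_def indicator_def)

lemma bump_mono: "m \<le> n \<Longrightarrow> bump U m x \<le> bump U n x"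
  using mult_right_mono[of "real m" "real n" "infdist x (- U)"]
  by (auto simp: bump_def infdist_nonneg)

lemma bump_tendsto:
  assumes "open U"
  shows "(\<lambda>n. bump U n x) \<longlonglongrightarrow> indicator U x"
proof (cases "x \<in> U \<and> U \<noteq> UNIV")
  case True
  then have d: "0 < infdist x (- U)"
    using assms in_closed_iff_infdist_zero[of "- U" x] infdist_nonneg[of x "- U"]
    by (auto simp: closed_Compl less_le)
  obtain N where N: "1 < real N * infdist x (- U)"
    using ex_less_of_nat_mult[OF d, of 1] by auto
  have "bump U n x = 1" if "n \<ge> N" for n
  proof -
    have "real N * infdist x (- U) \<le> real n * infdist x (- U)"
      using that d by (intro mult_right_mono) auto
    with N True show ?thesis by (auto simp: bump_def)
  qed
  then have "eventually (\<lambda>n. bump U n x = 1) sequentially"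
    by (auto simp: eventually_sequentially)
  with True show ?thesis by (simp add: tendsto_eventually)
next
  case False
  then have "bump U n x = indicator U x" for n
    by (auto simp: bump_def)
  then show ?thesis by simp
qed

text \<open>The open sets form an intersection-stable generator of the Borel sets, and the mass of
  an open set is the limit of the integrals of its bumps.\<close>

lemma finite_measure_eqI_Cb:
  fixes M N :: "'a::metric_space measure"
  assumes fin: "finite_measure M" "finite_measure N"
    and sets: "sets M = sets borel" "sets N = sets borel"
    and eq: "\<And>f. Cb f \<Longrightarrow> (\<integral>x. f x \<partial>M) = (\<integral>x. f x \<partial>N)"
  shows "M = N"
proof (rule measure_eqI_generator_eq[where E = "{U. open U}" and \<Omega> = UNIV and A = "\<lambda>_. UNIV"])
  interpret M: finite_measure M by fact
  interpret N: finite_measure N by fact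
  have lim: "(\<lambda>n. \<integral>x. bump U n x \<partial>K) \<longlonglongrightarrow> measure K U"
    if "open U" "finite_measure K" "sets K = sets borel" for U and K :: "'a measure"
  proof -
    interpret K: finite_measure K by fact
    have [measurable]: "U \<in> sets K" "bump U n \<in> borel_measurable K" for n
      using that Cb_borel_measurable[OF Cb_bump] by (auto simp: measurable_cong_sets[of K borel])
    have "(\<lambda>n. \<integral>x. bump U n x \<partial>K) \<longlonglongrightarrow> (\<integral>x. indicator U x \<partial>K)"
    proof (rule integral_dominated_convergence[where w = "\<lambda>_. 1"])
      show "AE x in K. norm (bump U n x) \<le> 1" for n
        using bump_nonneg[of U n] bump_le_indicator[of U n]
        by (intro AE_I2) (auto intro: order_trans[OF _ indicator_le_1])
    qed (use bump_tendsto[OF that(1)] in auto)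
    also have "(\<integral>x. indicator U x \<partial>K) = measure K U"
      by simp
    finally show ?thesis .
  qed
  show "emeasure M U = emeasure N U" if "U \<in> {U. open U}" for U
  proof -
    have "measure M U = measure N U"
      using that lim[of U M] lim[of U N] eq[OF Cb_bump] fin sets by (auto intro: LIMSEQ_unique)
    then show ?thesis
      by (simp add: M.emeasure_eq_measure N.emeasure_eq_measure)
  qed
qed (use sets in \<open>auto simp: Int_stable_def borel_def finite_measure.emeasure_finite[OF fin(1)]\<close>)

section \<open>The Daniell-Riesz theorem on a metric space\<close>

locale daniell_functional =
  fixes L :: "('a::metric_space \<Rightarrow> real) \<Rightarrow> real"
  assumes add: "Cb f \<Longrightarrow> Cb g \<Longrightarrow> L (\<lambda>x. f x + g x) = L f + L g"
    and scale: "Cb f \<Longrightarrow> L (\<lambda>x. c * f x) = c * L f"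
    and nonneg: "Cb f \<Longrightarrow> (\<And>x. 0 \<le> f x) \<Longrightarrow> 0 \<le> L f"
    and tendsto_zero: "(\<And>n. Cb (F n)) \<Longrightarrow> (\<And>n x. 0 \<le> F n x) \<Longrightarrow> (\<And>n x. F (Suc n) x \<le> F n x)
      \<Longrightarrow> (\<And>x. (\<lambda>n. F n x) \<longlonglongrightarrow> 0) \<Longrightarrow> (\<lambda>n. L (F n)) \<longlonglongrightarrow> 0"
begin

lemma diff: "Cb f \<Longrightarrow> Cb g \<Longrightarrow> L (\<lambda>x. f x - g x) = L f - L g"
  using add[OF Cb_diff, of f g g] by simp

lemma mono: "Cb f \<Longrightarrow> Cb g \<Longrightarrow> (\<And>x. f x \<le> g x) \<Longrightarrow> L f \<le> L g"
  using nonneg[of "\<lambda>x. g x - f x"] diff[of g f] by auto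

lemma sum: "finite I \<Longrightarrow> (\<And>i. i \<in> I \<Longrightarrow> Cb (f i)) \<Longrightarrow> L (\<lambda>x. \<Sum>i\<in>I. f i x) = (\<Sum>i\<in>I. L (f i))"
proof (induction I rule: finite_induct)
  case empty
  show ?case using scale[of "\<lambda>_. 0" 0] by auto
next
  case (insert i I)
  then show ?case using add[of "f i" "\<lambda>x. \<Sum>i\<in>I. f i x"] by auto
qed

lemma const: "L (\<lambda>x. c) = c * L (\<lambda>x. 1)"
  using scale[of "\<lambda>x. 1" c] by auto

text \<open>No \<open>g n\<close> has to dominate \<open>f\<close>. The positive part of
  \<open>f - g n\<close> decreases to zero pointwise, and by the Daniell condition
  \<open>tendsto_zero\<close> its value under \<open>L\<close> tends to zero.\<close>

lemma le_of_increasing_limit: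
  assumes f: "Cb f" and g: "\<And>n. Cb (g n)" and incr: "\<And>n x. g n x \<le> g (Suc n) x"
    and lim: "\<And>x. (\<lambda>n. max 0 (f x - g n x)) \<longlonglongrightarrow> 0"
    and le: "\<And>n. L (g n) \<le> c"
  shows "L f \<le> c"
proof -
  have C: "Cb (\<lambda>x. max 0 (f x - g n x))" for n
    using f g by auto
  have "(\<lambda>n. L (\<lambda>x. max 0 (f x - g n x))) \<longlonglongrightarrow> 0"
  proof (intro tendsto_zero C lim)
    show "max 0 (f x - g (Suc n) x) \<le> max 0 (f x - g n x)" for n x
      using incr[of n x] by simp
  qed simp
  then have "(\<lambda>n. c + L (\<lambda>x. max 0 (f x - g n x))) \<longlonglongrightarrow> c + 0"
    by (intro tendsto_intros)
  moreover have "L f \<le> c + L (\<lambda>x. max 0 (f x - g n x))" for n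
  proof -
    have "L f \<le> L (\<lambda>x. g n x + max 0 (f x - g n x))"
      by (intro mono f Cb_add C g) auto
    also have "\<dots> = L (g n) + L (\<lambda>x. max 0 (f x - g n x))"
      by (intro add C g)
    finally show ?thesis using le[of n] by simp
  qed
  ultimately show ?thesis
    by (intro LIMSEQ_le_const[where X = "\<lambda>n. c + L (\<lambda>x. max 0 (f x - g n x))"]) auto
qed

text \<open>The test functions of the Riesz construction: an open set is measured from inside by the
  values of \<open>L\<close> on them (\<open>open_content\<close>), an arbitrary set from outside by
  open sets (\<open>outer\<close>).\<close>

definition below :: "'a set \<Rightarrow> ('a \<Rightarrow> real) set" where
  "below U = {f. Cb f \<and> (\<forall>x. 0 \<le> f x \<and> f x \<le> indicator U x)}"

lemma belowD:
  assumes "f \<in> below U"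
  shows "Cb f" "0 \<le> f x" "f x \<le> 1" "x \<notin> U \<Longrightarrow> f x = 0"
proof -
  have "Cb f" "0 \<le> f x \<and> f x \<le> indicator U x"
    using assms by (auto simp: below_def)
  then show "Cb f" "0 \<le> f x" "f x \<le> 1" "x \<notin> U \<Longrightarrow> f x = 0"
    by (cases "x \<in> U"; auto)+
qed

definition open_content :: "'a set \<Rightarrow> ennreal" where
  "open_content U = (SUP f\<in>below U. ennreal (L f))"

definition outer :: "'a set \<Rightarrow> ennreal" where
  "outer A = (INF U\<in>{U. open U \<and> A \<subseteq> U}. open_content U)"

lemma le_open_content: "f \<in> below U \<Longrightarrow> ennreal (L f) \<le> open_content U"
  unfolding open_content_def by (rule SUP_upper)

lemma open_content_mono: "U \<subseteq> V \<Longrightarrow> open_content U \<le> open_content V"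
  unfolding open_content_def
proof (rule SUP_subset_mono)
  assume "U \<subseteq> V"
  then have "(indicator U x :: real) \<le> indicator V x" for x
    by (auto simp: indicator_def)
  then show "below U \<subseteq> below V"
    unfolding below_def by (blast intro: order_trans)
qed simp

lemma open_content_finite: "open_content U \<le> ennreal (L (\<lambda>x. 1))"
  unfolding open_content_def
  by (intro SUP_least ennreal_leI mono) (auto dest: belowD)

lemma outer_open: "open U \<Longrightarrow> outer U = open_content U"
  unfolding outer_def by (rule antisym) (auto intro!: INF_lower INF_greatest open_content_mono)

lemma outer_le: "open U \<Longrightarrow> A \<subseteq> U \<Longrightarrow> outer A \<le> open_content U"
  unfolding outer_def by (intro INF_lower) auto

lemma outer_mono: "A \<subseteq> B \<Longrightarrow> outer A \<le> outer B"
  unfolding outer_def by (intro INF_superset_mono) auto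

lemma outer_finite: "outer A \<noteq> \<infinity>"
  using outer_le[of UNIV A] open_content_finite[of UNIV] by (auto simp: top_unique)

lemma bump_below: "bump U n \<in> below U"
  by (auto simp: below_def Cb_bump bump_nonneg bump_le_indicator)

text \<open>A function below the union is at most 1 and vanishes outside it, while at each point of
  the union some bump tends to 1; so sums of bumps absorb the function in the limit. The Daniell
  condition enters here, as countable subadditivity.\<close>

lemma open_content_UN:
  fixes U :: "nat \<Rightarrow> 'a set"
  assumes "\<And>i. open (U i)"
  shows "open_content (\<Union>i. U i) \<le> (\<Sum>i. open_content (U i))"
proof (cases "(\<Sum>i. open_content (U i)) = \<infinity>")
  case False
  then obtain c where c: "0 \<le> c" "(\<Sum>i. open_content (U i)) = ennreal c"
    by (cases "\<Sum>i. open_content (U i)") auto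
  have "L f \<le> c" if f: "f \<in> below (\<Union>i. U i)" for f
  \<comment> \<open>The index \<open>n\<close> counts the sets and sharpens each bump at the same
    time, so one increasing sequence performs both limits.\<close>
  proof (rule le_of_increasing_limit[where g = "\<lambda>n x. \<Sum>i<n. bump (U i) n x"])
    show "Cb f" using f by (rule belowD)
    show "Cb (\<lambda>x. \<Sum>i<n. bump (U i) n x)" for n
      by (intro Cb_sum Cb_bump)
    show "(\<Sum>i<n. bump (U i) n x) \<le> (\<Sum>i<Suc n. bump (U i) (Suc n) x)" for n x
    proof -
      have "(\<Sum>i<n. bump (U i) n x) \<le> (\<Sum>i<n. bump (U i) (Suc n) x)"
        by (intro sum_mono bump_mono) auto
      then show ?thesis
        using bump_nonneg[of "U n" "Suc n" x] by simp
    qed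
    show "(\<lambda>n. max 0 (f x - (\<Sum>i<n. bump (U i) n x))) \<longlonglongrightarrow> 0" for x
    proof (cases "x \<in> (\<Union>i. U i)")
      case True
      then obtain j where j: "x \<in> U j" by auto
      have "(\<lambda>n. 1 - bump (U j) n x) \<longlonglongrightarrow> 1 - 1"
        using bump_tendsto[OF assms, of j x] j by (intro tendsto_intros) simp
      then have lim: "(\<lambda>n. 1 - bump (U j) n x) \<longlonglongrightarrow> 0"
        by simp
      have le: "max 0 (f x - (\<Sum>i<n. bump (U i) n x)) \<le> 1 - bump (U j) n x" if "n \<ge> Suc j" for n
      proof -
        have "bump (U j) n x \<le> (\<Sum>i<n. bump (U i) n x)"
          using that by (intro member_le_sum) (auto simp: bump_nonneg)
        moreover have "bump (U j) n x \<le> 1"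
          using bump_le_indicator[of "U j" n x] j by simp
        ultimately show ?thesis
          using belowD(3)[OF f, of x] by simp
      qed
      show ?thesis
        by (rule tendsto_sandwich[OF _ eventually_sequentiallyI[OF le] tendsto_const lim]) simp_all
    next
      case False
      then have "f x = 0" using f by (auto dest: belowD(4))
      then have "max 0 (f x - (\<Sum>i<n. bump (U i) n x)) = 0" for n
        using sum_nonneg[of "{..<n}" "\<lambda>i. bump (U i) n x"] bump_nonneg[of _ n x]
        by (simp add: max_def)
      then show ?thesis by simp
    qed
    show "L (\<lambda>x. \<Sum>i<n. bump (U i) n x) \<le> c" for n
    proof -
      have "ennreal (L (\<lambda>x. \<Sum>i<n. bump (U i) n x)) = (\<Sum>i<n. ennreal (L (bump (U i) n)))"
        by (subst sum) (auto simp: Cb_bump sum_ennreal nonneg bump_nonneg)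
      also have "\<dots> \<le> (\<Sum>i<n. open_content (U i))"
        by (intro sum_mono le_open_content bump_below)
      also have "\<dots> \<le> ennreal c"
        unfolding c(2)[symmetric] by (intro sum_le_suminf) auto
      finally show ?thesis using c(1) by (simp add: ennreal_le_iff)
    qed
  qed
  then show ?thesis
    unfolding c(2) by (subst open_content_def) (intro SUP_least ennreal_leI)
qed simp

lemma outer_UN:
  fixes A :: "nat \<Rightarrow> 'a set"
  shows "outer (\<Union>i. A i) \<le> (\<Sum>i. outer (A i))"
proof (rule ennreal_le_epsilon)
  fix e :: real assume e: "0 < e"
  have "\<exists>U. open U \<and> A n \<subseteq> U \<and> open_content U \<le> outer (A n) + ennreal (e * (1/2)^Suc n)" for n
    using INF_approx_ennreal[of "e * (1/2)^Suc n" "outer (A n)" open_content "{U. open U \<and> A n \<subseteq> U}"]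
      outer_finite[of "A n"] e
    by (auto simp: outer_def intro: less_imp_le)
  then obtain U where U: "\<And>n. open (U n)" "\<And>n. A n \<subseteq> U n"
    "\<And>n. open_content (U n) \<le> outer (A n) + ennreal (e * (1/2)^Suc n)"
    by metis
  have "outer (\<Union>i. A i) \<le> open_content (\<Union>i. U i)"
    using U by (intro outer_le) blast+
  also have "\<dots> \<le> (\<Sum>i. open_content (U i))"
    by (rule open_content_UN) (rule U)
  also have "\<dots> \<le> (\<Sum>i. outer (A i) + ennreal (e * (1/2)^Suc i))"
    by (intro suminf_le U) auto
  also have "\<dots> = (\<Sum>i. outer (A i)) + (\<Sum>i. ennreal (e * (1/2)^Suc i))"
    by (intro suminf_add[symmetric]) auto
  also have "(\<Sum>i. ennreal (e * (1/2)^Suc i)) = ennreal e"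
    using sums_mult[OF power_half_series, of e] e by (intro suminf_ennreal_eq) auto
  finally show "outer (\<Union>i. A i) \<le> (\<Sum>i. outer (A i)) + ennreal e" .
qed

lemma outer_measure_space_outer: "outer_measure_space (Pow UNIV) outer"
proof -
  have "below {} = {\<lambda>x. 0}"
    by (auto simp: below_def intro: order_antisym)
  moreover have "L (\<lambda>x. 0) = 0"
    using const[of 0] by simp
  ultimately have "outer {} = 0"
    by (simp add: outer_open open_content_def)
  then show ?thesis
    by (auto simp: outer_measure_space_def positive_def increasing_def countably_subadditive_def
        intro: outer_mono outer_UN)
qed

text \<open>This is the Caratheodory condition for \<open>U\<close>. A function \<open>f\<close>
  below \<open>V \<inter> U\<close> is lowered by \<open>d\<close>; where it was smaller than
  \<open>d\<close> there is then room for any \<open>g\<close> below the open set \<open>W\<close>,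
  which contains \<open>A - U\<close>. The sum of the two stays below the indicator of
  \<open>V\<close>.\<close>

lemma lambda_system_open:
  assumes U: "open U"
  shows "U \<in> lambda_system UNIV (Pow UNIV) outer"
proof -
  have *: "outer (A \<inter> U) + outer (A - U) \<le> open_content V" if V: "open V" "A \<subseteq> V" for A V
  proof -
    have "ennreal (L f) + outer (A - U) \<le> open_content V" if f: "f \<in> below (V \<inter> U)" for f
    proof (rule ennreal_le_epsilon)
      fix e :: real assume e: "0 < e"
      \<comment> \<open>Lowering by \<open>d\<close> costs at most
        \<open>d * L (\<lambda>x. 1)\<close>, hence at most \<open>e\<close>; the summand 1 covers
        the case \<open>L (\<lambda>x. 1) = 0\<close>.\<close>
      define d where "d = e / (1 + L (\<lambda>x. 1))"
      have L1: "0 \<le> L (\<lambda>x. 1)" by (intro nonneg) auto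
      then have d: "0 < d" "d * L (\<lambda>x. 1) \<le> e"
        using e by (auto simp: d_def field_simps)
      define f' where "f' = (\<lambda>x. max 0 (f x - d))"
      have f': "Cb f'" "\<And>x. 0 \<le> f' x"
        using belowD(1)[OF f] by (auto simp: f'_def)
      define W where "W = V \<inter> {x. f x < d}"
      have "open W"
        unfolding W_def using belowD(1)[OF f] V
        by (intro open_Int open_Collect_less) (auto simp: Cb_def)
      moreover have "A - U \<subseteq> W"
        using V belowD(4)[OF f] d by (auto simp: W_def)
      ultimately have W: "outer (A - U) \<le> open_content W"
        by (rule outer_le)
      have Lf: "ennreal (L f) \<le> ennreal (L f') + ennreal e"
      proof -
        have "L f \<le> L (\<lambda>x. f' x + d)"
          using belowD(1)[OF f] f' by (intro mono) (auto simp: f'_def)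
        also have "\<dots> \<le> L f' + e"
          using d f' by (subst add) (auto simp: const[of d])
        finally show ?thesis
          using e nonneg[OF f'] by (simp add: ennreal_plus[symmetric] del: ennreal_plus)
      qed
      have "ennreal (L f') + ennreal (L g) \<le> open_content V" if g: "g \<in> below W" for g
      proof -
        have "(\<lambda>x. f' x + g x) \<in> below V"
        proof -
          have "0 \<le> f' x + g x \<and> f' x + g x \<le> indicator V x" for x
          proof (cases "f x < d")
            case True
            then show ?thesis
              using belowD(2,3,4)[OF g, of x] by (auto simp: f'_def W_def indicator_def)
          next
            case False
            then have "g x = 0" "x \<in> V"
              using belowD(4)[OF g, of x] belowD(4)[OF f, of x] d by (auto simp: W_def)
            then show ?thesis
              using False belowD(3)[OF f, of x] d by (auto simp: f'_def)
          qed
          then show ?thesis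
            using f' belowD(1)[OF g] by (auto simp: below_def)
        qed
        from le_open_content[OF this] show ?thesis
          using f' belowD[OF g] by (simp add: add nonneg flip: ennreal_plus)
      qed
      then have "ennreal (L f') + open_content W \<le> open_content V"
        unfolding open_content_def[of W] using bump_below[of W 0]
        by (subst ennreal_SUP_add_right) (blast intro: SUP_least)+
      then have "(ennreal (L f') + open_content W) + ennreal e \<le> open_content V + ennreal e"
        by (rule add_right_mono)
      moreover have "ennreal (L f) + outer (A - U) \<le> (ennreal (L f') + open_content W) + ennreal e"
        using add_mono[OF Lf W] by (simp add: ac_simps)
      ultimately show "ennreal (L f) + outer (A - U) \<le> open_content V + ennreal e"
        by (rule order_trans[rotated])
    qed
    then have "open_content (V \<inter> U) + outer (A - U) \<le> open_content V"
      unfolding open_content_def[of "V \<inter> U"] using bump_below[of "V \<inter> U" 0]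
      by (subst ennreal_SUP_add_left[symmetric]) (blast intro: SUP_least)+
    moreover have "outer (A \<inter> U) \<le> open_content (V \<inter> U)"
      using V U by (intro outer_le) auto
    ultimately show ?thesis
      by (meson add_right_mono order_trans)
  qed
  have "outer (U \<inter> A) + outer ((UNIV - U) \<inter> A) = outer A" for A
  proof (rule antisym)
    have "outer (A \<inter> U) + outer (A - U) \<le> outer A"
      unfolding outer_def[of A] by (intro INF_greatest) (use * in auto)
    then show "outer (U \<inter> A) + outer ((UNIV - U) \<inter> A) \<le> outer A"
      by (simp add: Int_commute Diff_eq)
    have "outer A \<le> outer (\<Union>i. binaryset (U \<inter> A) ((UNIV - U) \<inter> A) i)"
      by (intro outer_mono) (auto simp: UN_binaryset_eq)
    also have "\<dots> \<le> (\<Sum>i. outer (binaryset (U \<inter> A) ((UNIV - U) \<inter> A) i))"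
      by (rule outer_UN)
    also have "\<dots> = outer (U \<inter> A) + outer ((UNIV - U) \<inter> A)"
      using outer_measure_space_outer
      by (intro suminf_binaryset_eq) (auto simp: outer_measure_space_def positive_def)
    finally show "outer A \<le> outer (U \<inter> A) + outer ((UNIV - U) \<inter> A)" .
  qed
  then show ?thesis
    by (auto simp: lambda_system_def)
qed

definition representing_measure :: "'a measure" where
  "representing_measure = measure_of UNIV (sets borel) outer"

lemma sets_representing_measure [measurable_cong, simp]: "sets representing_measure = sets borel"
  and space_representing_measure [simp]: "space representing_measure = UNIV"
  using sets.sigma_sets_eq[of "borel :: 'a measure"]
  by (simp_all add: representing_measure_def)

text \<open>The outer measure is a measure on the sets that satisfy Caratheodory's condition. These
  form a sigma-algebra that contains the open sets, hence all Borel sets.\<close>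

lemma emeasure_representing_measure:
  assumes "A \<in> sets borel"
  shows "emeasure representing_measure A = outer A"
proof -
  interpret S: sigma_algebra UNIV "Pow UNIV :: 'a set set"
    by (rule sigma_algebra_Pow)
  have ms: "measure_space UNIV (lambda_system UNIV (Pow UNIV) outer) outer"
    by (rule S.caratheodory_lemma[OF outer_measure_space_outer])
  then interpret LS: sigma_algebra UNIV "lambda_system UNIV (Pow UNIV) outer"
    by (simp add: measure_space_def)
  have "sets borel \<subseteq> lambda_system UNIV (Pow UNIV) outer"
    unfolding borel_def using lambda_system_open LS.sigma_sets_subset[of "Collect open"]
    by (subst sets_measure_of) auto
  moreover have "sigma_algebra UNIV (sets (borel :: 'a measure))"
    using sets.sigma_algebra_axioms[of "borel :: 'a measure"] by simp
  ultimately have "measure_space UNIV (sets borel) outer"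
    using ms unfolding measure_space_def positive_def countably_additive_def
    by (blast dest: subset_trans)
  then show ?thesis
    unfolding representing_measure_def using assms sets.sigma_sets_eq[of "borel :: 'a measure"]
    by (intro emeasure_measure_of_sigma) (auto simp: measure_space_def)
qed

lemma emeasure_representing_measure_UNIV: "emeasure representing_measure UNIV = ennreal (L (\<lambda>x. 1))"
proof -
  have "(\<lambda>x. 1) \<in> below UNIV" by (auto simp: below_def)
  then show ?thesis
    using open_content_finite[of UNIV] le_open_content[of "\<lambda>x. 1" UNIV]
    by (simp add: emeasure_representing_measure outer_open)
qed

lemma finite_measure_representing_measure: "finite_measure representing_measure"
  by (intro finite_measureI) (simp add: emeasure_representing_measure_UNIV)

text \<open>Layer cake: \<open>f\<close> is cut into \<open>n\<close> slices of height \<open>1/n\<close>, and each slice is compared with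
  the indicators of the neighbouring superlevel sets.\<close>

lemma L_le_integral:
  assumes f: "Cb f" "\<And>x. 0 \<le> f x" "\<And>x. f x \<le> 1"
  shows "L f \<le> (\<integral>x. f x \<partial>representing_measure)"
proof -
  let ?M = representing_measure
  interpret M: finite_measure ?M by (rule finite_measure_representing_measure)
  have L1: "measure ?M UNIV = L (\<lambda>x. 1)"
    using emeasure_representing_measure_UNIV nonneg[of "\<lambda>x. 1", OF Cb_const]
    by (simp add: measure_def)
  have *: "L f \<le> (\<integral>x. f x \<partial>?M) + L (\<lambda>x. 1) / real n" if n: "n > 0" for n :: nat
  proof -
    define U where "U k = {x. real k / n < f x}" for k
    have U: "open (U k)" for k
      unfolding U_def using f(1) by (intro open_Collect_less) (auto simp: Cb_def)
    \<comment> \<open>The \<open>k\<close>-th slice of \<open>n * f\<close>, truncated to the unit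
      interval: it lies under the indicator of \<open>U k\<close> and over that of
      \<open>U (Suc k)\<close>.\<close>
    define g where "g k x = max 0 (min (n * f x - real k) 1)" for k x
    have g: "Cb (g k)" for k
      unfolding g_def[abs_def] using f(1) by (intro Cb_max Cb_min Cb_diff Cb_mult Cb_const)
    have gsum: "(\<Sum>k<m. g k x) = min (n * f x) m" for m x
    proof (induction m)
      case 0 show ?case using f(2)[of x] by simp
    next
      case (Suc m) then show ?case by (auto simp: g_def)
    qed
    have gn: "n * f x = (\<Sum>k<n. g k x)" for x
      using gsum[of x n] f(3)[of x] n by (simp add: min_def)
    have gL: "L (g k) \<le> measure ?M (U k)" for k
    proof -
      have "g k \<in> below (U k)"
        using g n by (auto simp: below_def g_def U_def indicator_def field_simps)
      from le_open_content[OF this] have "ennreal (L (g k)) \<le> emeasure ?M (U k)"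
        using U by (simp add: emeasure_representing_measure outer_open)
      then show ?thesis
        by (simp add: M.emeasure_eq_measure ennreal_le_iff)
    qed
    have gI: "measure ?M (U (Suc k)) \<le> (\<integral>x. g k x \<partial>?M)" for k
    proof -
      have "(\<integral>x. indicator (U (Suc k)) x \<partial>?M) \<le> (\<integral>x. g k x \<partial>?M)"
      proof (rule integral_mono)
        show "integrable ?M (g k)"
          using g by (intro Cb_integrable M.finite_measure_axioms) auto
        show "integrable ?M (indicator (U (Suc k)) :: _ \<Rightarrow> real)"
          using U by (auto simp: M.emeasure_finite less_top[symmetric])
        show "indicator (U (Suc k)) x \<le> g k x" for x
          using n by (auto simp: indicator_def U_def g_def field_simps)
      qed
      then show ?thesis by simp
    qed
    have "n * L f = L (\<lambda>x. \<Sum>k<n. g k x)"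
      using scale[OF f(1), of n] by (simp add: gn)
    also have "\<dots> = (\<Sum>k<n. L (g k))"
      by (intro sum g) auto
    also have "\<dots> \<le> (\<Sum>k<n. measure ?M (U k))"
      by (intro sum_mono gL)
    \<comment> \<open>The extra term permits the index shift. Passing from \<open>U k\<close> to
      \<open>U (Suc k)\<close> then costs only the mass of \<open>U 0\<close>, at most
      \<open>L (\<lambda>x. 1)\<close>, which becomes negligible after division by
      \<open>n\<close>.\<close>
    also have "\<dots> \<le> (\<Sum>k<Suc n. measure ?M (U k))"
      by simp
    also have "\<dots> = measure ?M (U 0) + (\<Sum>k<n. measure ?M (U (Suc k)))"
      by (subst sum.lessThan_Suc_shift) simp
    also have "\<dots> \<le> L (\<lambda>x. 1) + (\<Sum>k<n. \<integral>x. g k x \<partial>?M)"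
      using M.bounded_measure[of "U 0"] L1 by (intro add_mono sum_mono gI) auto
    also have "(\<Sum>k<n. \<integral>x. g k x \<partial>?M) = (\<integral>x. n * f x \<partial>?M)"
      unfolding gn by (intro Bochner_Integration.integral_sum[symmetric] Cb_integrable M.finite_measure_axioms g) auto
    finally show ?thesis
      using n by (simp add: field_simps)
  qed
  have "(\<lambda>n. (\<integral>x. f x \<partial>?M) + L (\<lambda>x. 1) / real n) \<longlonglongrightarrow> (\<integral>x. f x \<partial>?M) + 0"
    by (intro tendsto_intros lim_const_over_n)
  then show ?thesis
    using * by (intro LIMSEQ_le_const[where X = "\<lambda>n. (\<integral>x. f x \<partial>?M) + L (\<lambda>x. 1) / real n"]) (auto intro!: exI[of _ 1])
qed

text \<open>The opposite inequality is the known one for \<open>1 - g\<close>, since both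
  functionals give the constant 1 the same value. A general \<open>f\<close> is moved into the unit
  interval by an affine map.\<close>

theorem integral_representing_measure:
  assumes f: "Cb f"
  shows "(\<integral>x. f x \<partial>representing_measure) = L f"
proof -
  let ?M = representing_measure
  interpret M: finite_measure ?M by (rule finite_measure_representing_measure)
  have L1: "measure ?M UNIV = L (\<lambda>x. 1)"
    using emeasure_representing_measure_UNIV nonneg[of "\<lambda>x. 1", OF Cb_const]
    by (simp add: measure_def)
  have int: "integrable ?M g" if "Cb g" for g
    using that by (intro Cb_integrable M.finite_measure_axioms) auto
  have unit: "(\<integral>x. g x \<partial>?M) = L g" if g: "Cb g" "\<And>x. 0 \<le> g x" "\<And>x. g x \<le> 1" for g
  proof (rule antisym)
    have "L (\<lambda>x. 1 - g x) \<le> (\<integral>x. 1 - g x \<partial>?M)"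
      using g by (intro L_le_integral) auto
    then show "(\<integral>x. g x \<partial>?M) \<le> L g"
      using g int[OF g(1)] by (simp add: diff Cb_const L1)
  qed (use L_le_integral g in auto)
  obtain B where B: "\<And>x. \<bar>f x\<bar> \<le> B"
    using f by (auto simp: Cb_def)
  \<comment> \<open>With this factor \<open>c * f\<close> is at most 1/2 in modulus, so
    \<open>c * f + 1 / 2\<close> has values between 0 and 1; the added 1 keeps the denominator
    positive.\<close>
  define c where "c = 1 / (2 * (\<bar>B\<bar> + 1))"
  have c: "0 < c" by (simp add: c_def)
  have bound: "\<bar>c * f x\<bar> \<le> 1 / 2" for x
  proof -
    have "\<bar>f x\<bar> \<le> \<bar>B\<bar> + 1" using B[of x] by simp
    then show ?thesis by (simp add: c_def abs_mult field_simps)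
  qed
  have "(\<integral>x. c * f x + 1 / 2 \<partial>?M) = L (\<lambda>x. c * f x + 1 / 2)"
  proof (intro unit)
    show "0 \<le> c * f x + 1 / 2" "c * f x + 1 / 2 \<le> 1" for x
      using bound[of x] by (auto simp: abs_le_iff)
  qed (use f in auto)
  moreover have "L (\<lambda>x. c * f x + 1 / 2) = c * L f + L (\<lambda>x. 1) / 2"
    using f by (subst add) (auto simp: scale const[of "1/2"])
  moreover have "(\<integral>x. c * f x + 1 / 2 \<partial>?M) = c * (\<integral>x. f x \<partial>?M) + L (\<lambda>x. 1) / 2"
    using int[OF f] by (simp add: L1)
  ultimately show ?thesis
    using c by simp
qed

end

section \<open>Lebesgue decomposition\<close>

text \<open>Exhaustion: some \<open>\<nu>\<close>-null set \<open>M\<close> has the largest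
  \<open>\<mu>\<close>-mass. A \<open>\<nu>\<close>-null set disjoint from \<open>M\<close> carries
  no \<open>\<mu>\<close>-mass, as otherwise it could be added to \<open>M\<close>. The two parts
  are the restrictions of \<open>\<mu>\<close> to the complement of \<open>M\<close> and to
  \<open>M\<close>.\<close>

lemma lebesgue_decomposition_exists:
  assumes fin: "finite_measure \<mu>" and sets: "sets \<nu> = sets \<mu>"
  shows "\<exists>\<mu>a \<mu>s. lebesgue_decomposition \<mu> \<nu> \<mu>a \<mu>s"
proof -
  interpret finite_measure \<mu> by fact
  have sp: "space \<nu> = space \<mu>"
    by (rule sets_eq_imp_space_eq[OF sets])
  define NS where "NS = {N \<in> sets \<mu>. emeasure \<nu> N = 0}"
  have "{} \<in> NS" by (auto simp: NS_def)
  then obtain c :: "nat \<Rightarrow> ennreal" where c: "range c \<subseteq> emeasure \<mu> ` NS"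
    "(SUP N\<in>NS. emeasure \<mu> N) = (SUP n. c n)"
    using ennreal_SUP_countable_SUP[of NS "emeasure \<mu>"] by auto
  then have "\<exists>N\<in>NS. c n = emeasure \<mu> N" for n
    by auto
  then obtain N where N: "\<And>n. N n \<in> NS" "\<And>n. c n = emeasure \<mu> (N n)"
    by metis
  \<comment> \<open>A countable union of null sets is null, so the supremum, approached along
    \<open>N n\<close>, is attained by this union.\<close>
  define M where "M = (\<Union>n. N n)"
  have "M \<in> null_sets \<nu>"
    unfolding M_def using N(1) sets by (intro null_sets_UN) (auto simp: NS_def)
  then have M: "M \<in> sets \<mu>" "emeasure \<nu> M = 0"
    using sets by (auto simp: null_sets_def)
  have max: "emeasure \<mu> A \<le> emeasure \<mu> M" if "A \<in> NS" for A
  proof -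
    have "emeasure \<mu> A \<le> (SUP n. c n)"
      unfolding c(2)[symmetric] using that by (rule SUP_upper)
    also have "\<dots> \<le> emeasure \<mu> M"
      unfolding N(2) using M by (intro SUP_least emeasure_mono) (auto simp: M_def)
    finally show ?thesis .
  qed
  have null: "emeasure \<mu> (A - M) = 0" if A: "A \<in> null_sets \<nu>" for A
  proof -
    have A': "A \<in> sets \<mu>" using A sets by auto
    have "M \<union> A \<in> null_sets \<nu>"
      using A M sets by (intro null_sets.Un) (auto simp: null_sets_def)
    then have "emeasure \<mu> (M \<union> A) \<le> emeasure \<mu> M"
      using A' M by (intro max) (auto simp: NS_def)
    moreover have "emeasure \<mu> (M \<union> A) = emeasure \<mu> M + emeasure \<mu> (A - M)"
      using plus_emeasure[of M \<mu> "A - M"] A' M by (auto simp: Un_Diff_cancel)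
    ultimately show ?thesis
      using ennreal_add_left_cancel_le[of "emeasure \<mu> M" "emeasure \<mu> (A - M)" 0] by simp
  qed
  let ?a = "density \<mu> (indicator (space \<mu> - M))" and ?s = "density \<mu> (indicator M)"
  have em: "emeasure ?a A = emeasure \<mu> (A - M)" "emeasure ?s A = emeasure \<mu> (A \<inter> M)"
    if A: "A \<in> sets \<mu>" for A
  proof -
    have "A \<subseteq> space \<mu>" using A by (rule sets.sets_into_space)
    then have "(space \<mu> - M) \<inter> A = A - M" by auto
    then show "emeasure ?a A = emeasure \<mu> (A - M)" "emeasure ?s A = emeasure \<mu> (A \<inter> M)"
      using A M by (simp_all add: emeasure_density_const emeasure_density Int_commute
          flip: indicator_inter_arith)
  qed
  have "lebesgue_decomposition \<mu> \<nu> ?a ?s"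
    unfolding lebesgue_decomposition_def
  proof (intro conjI ballI bexI[of _ M])
    fix A assume A: "A \<in> sets \<mu>"
    have "emeasure \<mu> A = emeasure \<mu> ((A - M) \<union> (A \<inter> M))"
      by (simp add: Un_Diff_Int)
    also have "\<dots> = emeasure \<mu> (A - M) + emeasure \<mu> (A \<inter> M)"
      using A M by (intro plus_emeasure[symmetric]) auto
    finally show "emeasure \<mu> A = emeasure ?a A + emeasure ?s A"
      using em[OF A] by simp
  next
    show "absolutely_continuous \<nu> ?a"
      using null sets em(1) by (auto simp: absolutely_continuous_def null_sets_def)
    show "emeasure ?s (space \<mu> - M) = 0"
      using M em(2)[of "space \<mu> - M"] by (auto simp: Diff_Int_distrib2)
  qed (use M in auto)
  then show ?thesis by blast
qed

text \<open>Let \<open>M\<close> be the union of the two \<open>\<nu>\<close>-null sets carrying the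
  singular parts. Off \<open>M\<close> both singular parts vanish, on \<open>M\<close> both
  absolutely continuous parts do, so each of the latter gives \<open>A\<close> the mass
  \<open>emeasure \<mu> (A - M)\<close>.\<close>

lemma lebesgue_decomposition_unique:
  assumes a: "lebesgue_decomposition \<mu> \<nu> a s" and a': "lebesgue_decomposition \<mu> \<nu> a' s'"
    and sets: "sets \<nu> = sets \<mu>"
  shows "a = a'"
proof -
  obtain N where N: "N \<in> sets \<mu>" "emeasure \<nu> N = 0" "emeasure s (space \<mu> - N) = 0"
    using a by (auto simp: lebesgue_decomposition_def)
  obtain N' where N': "N' \<in> sets \<mu>" "emeasure \<nu> N' = 0" "emeasure s' (space \<mu> - N') = 0"
    using a' by (auto simp: lebesgue_decomposition_def)
  define M where "M = N \<union> N'"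
  have "N \<in> null_sets \<nu>" "N' \<in> null_sets \<nu>"
    using N N' sets by (auto simp: null_sets_def)
  then have M: "M \<in> null_sets \<nu>"
    by (auto simp: M_def)
  have key: "emeasure b A = emeasure \<mu> (A - M)"
    if b: "lebesgue_decomposition \<mu> \<nu> b r" and A: "A \<in> sets \<mu>"
      and R: "R \<in> sets \<mu>" "R \<subseteq> M" "emeasure r (space \<mu> - R) = 0" for b r A R
  proof -
    have sb: "sets b = sets \<mu>" "sets r = sets \<mu>" and ac: "null_sets \<nu> \<subseteq> null_sets b"
      and add: "emeasure \<mu> (A - M) = emeasure b (A - M) + emeasure r (A - M)"
      using b A M sets by (auto simp: lebesgue_decomposition_def absolutely_continuous_def)
    have "emeasure r (A - M) \<le> emeasure r (space \<mu> - R)"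
      using R sb sets.sets_into_space[OF A] by (intro emeasure_mono) auto
    then have "emeasure r (A - M) = 0" using R by simp
    moreover have "emeasure b (A - M) = emeasure b A"
      using ac M sb A by (intro emeasure_Diff_null_set) auto
    ultimately show ?thesis using add by simp
  qed
  show ?thesis
  proof (rule measure_eqI)
    show "sets a = sets a'" using a a' by (auto simp: lebesgue_decomposition_def)
    fix A assume "A \<in> sets a"
    then have "A \<in> sets \<mu>" using a by (auto simp: lebesgue_decomposition_def)
    then show "emeasure a A = emeasure a' A"
      using key[OF a _ N(1) _ N(3)] key[OF a' _ N'(1) _ N'(3)] by (auto simp: M_def)
  qed
qed

lemma abs_part_decomposition:
  assumes "finite_measure \<mu>" "sets \<nu> = sets \<mu>"
  shows "\<exists>\<mu>s. lebesgue_decomposition \<mu> \<nu> (abs_part \<mu> \<nu>) \<mu>s"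
proof -
  obtain a where a: "\<exists>s. lebesgue_decomposition \<mu> \<nu> a s"
    using lebesgue_decomposition_exists[OF assms] by blast
  have "\<exists>s. lebesgue_decomposition \<mu> \<nu> (THE a. \<exists>s. lebesgue_decomposition \<mu> \<nu> a s) s"
    by (rule theI2[of _ a]) (use a lebesgue_decomposition_unique assms(2) in blast)+
  then show ?thesis by (simp add: abs_part_def)
qed

lemma
  assumes "finite_measure \<mu>" "sets \<nu> = sets \<mu>"
  shows sets_abs_part: "sets (abs_part \<mu> \<nu>) = sets \<mu>"
    and absolutely_continuous_abs_part: "absolutely_continuous \<nu> (abs_part \<mu> \<nu>)"
    and emeasure_abs_part_le: "A \<in> sets \<mu> \<Longrightarrow> emeasure (abs_part \<mu> \<nu>) A \<le> emeasure \<mu> A"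
  using abs_part_decomposition[OF assms] by (auto simp: lebesgue_decomposition_def)

lemma absolutely_continuous_abs_part_self:
  assumes "finite_measure \<mu>" "sets \<nu> = sets \<mu>"
  shows "absolutely_continuous \<mu> (abs_part \<mu> \<nu>)"
proof -
  have "A \<in> null_sets (abs_part \<mu> \<nu>)" if "A \<in> null_sets \<mu>" for A
  proof -
    have "A \<in> sets \<mu>" "emeasure \<mu> A = 0" using that by auto
    then show ?thesis
      using emeasure_abs_part_le[OF assms, of A] sets_abs_part[OF assms] by (auto simp: null_sets_def)
  qed
  then show ?thesis by (auto simp: absolutely_continuous_def)
qed

text \<open>Used in both orders, this makes the two mutual absolutely continuous parts equivalent.
  Homogeneity refers to the part of the earlier marginal with respect to the later one, whereas
  \<open>\<theta> s t\<close> is compared with the part of the later with respect to the earlier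
  one. In the proof the \<open>\<mu>\<close>-null set \<open>N\<close> carries the singular part of
  \<open>\<nu>\<close>, so that \<open>A - N\<close> is \<open>\<nu>\<close>-null.\<close>

lemma absolutely_continuous_abs_part_swap:
  assumes fin: "finite_measure \<mu>" "finite_measure \<nu>" and sets: "sets \<nu> = sets \<mu>"
  shows "absolutely_continuous (abs_part \<nu> \<mu>) (abs_part \<mu> \<nu>)"
  unfolding absolutely_continuous_def
proof
  fix A assume A: "A \<in> null_sets (abs_part \<nu> \<mu>)"
  let ?a = "abs_part \<mu> \<nu>"
  note b = sets_abs_part[OF fin(1) sets] sets_abs_part[OF fin(2) sets[symmetric]]
  obtain s N where N: "N \<in> sets \<nu>" "emeasure \<mu> N = 0" "emeasure s (space \<nu> - N) = 0" "sets s = sets \<nu>"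
    and dec: "\<And>A. A \<in> sets \<nu> \<Longrightarrow> emeasure \<nu> A = emeasure (abs_part \<nu> \<mu>) A + emeasure s A"
    using abs_part_decomposition[OF fin(2) sets[symmetric]] by (auto simp: lebesgue_decomposition_def)
  have A': "A \<in> sets \<nu>" using A b by auto
  have "emeasure (abs_part \<nu> \<mu>) (A - N) \<le> emeasure (abs_part \<nu> \<mu>) A"
    using A by (intro emeasure_mono) auto
  moreover have "emeasure s (A - N) \<le> emeasure s (space \<nu> - N)"
    using N sets.sets_into_space[OF A'] by (intro emeasure_mono) auto
  ultimately have "emeasure \<nu> (A - N) = 0"
    using A A' N dec[of "A - N"] by auto
  then have "A - N \<in> null_sets \<nu>" using A' N by auto
  then have "A - N \<in> null_sets ?a"
    using absolutely_continuous_abs_part[OF fin(1) sets] by (auto simp: absolutely_continuous_def)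
  moreover have "N \<in> null_sets ?a"
    using absolutely_continuous_abs_part_self[OF fin(1) sets] N sets
    by (auto simp: absolutely_continuous_def null_sets_def)
  ultimately have "(A - N) \<union> N \<in> null_sets ?a" by (rule null_sets.Un)
  then show "A \<in> null_sets ?a"
    using A' b sets by (auto intro: null_sets_subset)
qed

section \<open>Disintegration on the plane\<close>

text \<open>One test set decides: where \<open>v < u\<close>, the positive difference
  \<open>u - v\<close> has a nonpositive integral, so this set is null.\<close>

lemma AE_le_of_set_integral_le:
  fixes u v :: "'a \<Rightarrow> real"
  assumes u: "integrable M u" and v: "integrable M v"
    and le: "\<And>A. A \<in> sets M \<Longrightarrow> (\<integral>x. indicator A x * u x \<partial>M) \<le> (\<integral>x. indicator A x * v x \<partial>M)"
  shows "AE x in M. u x \<le> v x"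
proof -
  have [measurable]: "u \<in> borel_measurable M" "v \<in> borel_measurable M"
    using u v by auto
  define A where "A = {x \<in> space M. v x < u x}"
  have A[measurable]: "A \<in> sets M" by (simp add: A_def)
  have i: "integrable M (\<lambda>x. indicator A x * u x)" "integrable M (\<lambda>x. indicator A x * v x)"
    using integrable_mult_indicator[OF A u] integrable_mult_indicator[OF A v] by auto
  have nn: "0 \<le> indicator A x * u x - indicator A x * v x" for x
    by (auto simp: indicator_def A_def)
  have "(\<integral>x. indicator A x * u x - indicator A x * v x \<partial>M) \<le> 0"
    using le[OF A] i by simp
  moreover have "0 \<le> (\<integral>x. indicator A x * u x - indicator A x * v x \<partial>M)"
    using nn by (intro integral_nonneg_AE) auto
  ultimately have "AE x in M. indicator A x * u x - indicator A x * v x = 0"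
    using i nn by (subst integral_nonneg_eq_0_iff_AE[symmetric]) auto
  then show ?thesis
    by (rule AE_mp) (auto simp: A_def indicator_def split: if_splits intro!: AE_I2)
qed

locale real_coupling = prob_space P for P :: "(real \<times> real) measure" +
  assumes sets_P [measurable_cong, simp]: "sets P = sets (borel \<Otimes>\<^sub>M borel)"
begin

section \<open>Conditional distribution functions of the second coordinate given the first\<close>

definition first :: "real measure" where "first = distr P borel fst"

lemma sets_first [measurable_cong, simp]: "sets first = sets borel"
  and space_first [simp]: "space first = UNIV"
  by (simp_all add: first_def)

lemma prob_space_first: "prob_space first"
  unfolding first_def by (rule prob_space_distr) measurable

lemma space_P [simp]: "space P = UNIV"
  using sets_eq_imp_space_eq[OF sets_P] by (simp add: space_pair_measure)

lemma measure_first: "A \<in> sets borel \<Longrightarrow> measure first A = measure P (A \<times> UNIV)"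
  unfolding first_def by (subst measure_distr) (auto intro!: arg_cong[where f = "measure P"])

text \<open>The function is a Radon-Nikodym derivative of
  \<open>A \<mapsto> P (A \<times> {..q})\<close> with respect to the first marginal. It is at most
  1 almost everywhere, and truncation makes the bound hold at every point.\<close>

lemma ex_conditional_cdf:
  "\<exists>f. f \<in> borel_measurable borel \<and> (\<forall>x. 0 \<le> f x \<and> f x \<le> 1) \<and>
     (\<forall>A\<in>sets borel. measure P (A \<times> {..q}) = (\<integral>x. indicator A x * f x \<partial>first))"
proof -
  interpret F: prob_space first by (rule prob_space_first)
  define N where "N = distr (density P (indicator (UNIV \<times> {..q}))) borel fst"
  have emN: "emeasure N A = emeasure P (A \<times> {..q})" if [measurable]: "A \<in> sets borel" for A
  proof -
    have "fst -` A \<inter> UNIV = A \<times> (UNIV :: real set)" by auto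
    moreover have "(UNIV \<times> {..q}) \<inter> (A \<times> UNIV) = A \<times> {..q}" by auto
    ultimately show ?thesis
      unfolding N_def by (subst emeasure_distr) (simp_all add: emeasure_density_const emeasure_density flip: indicator_inter_arith)
  qed
  have "space N = UNIV" by (simp add: N_def)
  then have N: "finite_measure N" "sets N = sets first"
    by (intro finite_measureI) (simp_all add: emN, simp add: N_def)
  have le: "emeasure N A \<le> emeasure first A" if [measurable]: "A \<in> sets borel" for A
  proof -
    have "emeasure first A = emeasure P (A \<times> UNIV)"
      unfolding first_def by (subst emeasure_distr) (auto intro!: arg_cong[where f = "emeasure P"])
    then show ?thesis
      unfolding emN[OF that] using emeasure_mono[of "A \<times> {..q}" "A \<times> UNIV" P] by auto
  qed
  have ac: "absolutely_continuous first N"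
    unfolding absolutely_continuous_def
  proof
    fix A assume "A \<in> null_sets first"
    then have "A \<in> sets borel" "emeasure first A = 0" by auto
    then show "A \<in> null_sets N"
      using le[of A] N(2) by (simp add: null_sets_def)
  qed
  obtain D where D: "D \<in> borel_measurable first" "AE x in first. RN_deriv first N x = ennreal (D x)"
    "\<And>x. 0 \<le> D x"
    using F.real_RN_deriv[OF N(1) ac N(2)] by blast
  note [measurable] = D(1)
  have "density first (\<lambda>x. ennreal (D x)) = density first (RN_deriv first N)"
  proof (intro density_cong)
    show "AE x in first. ennreal (D x) = RN_deriv first N x"
      using D(2) by eventually_elim simp
  qed auto
  also have "\<dots> = N"
    by (rule F.density_RN_deriv[OF ac N(2)])
  finally have dens: "density first (\<lambda>x. ennreal (D x)) = N" .
  have enn: "(\<integral>\<^sup>+x. ennreal (indicator A x * D x) \<partial>first) = ennreal (measure P (A \<times> {..q}))"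
    if [measurable]: "A \<in> sets borel" for A
  proof -
    have "(\<integral>\<^sup>+x. ennreal (indicator A x * D x) \<partial>first) = emeasure (density first (\<lambda>x. ennreal (D x))) A"
      by (subst emeasure_density) (auto intro!: nn_integral_cong simp: indicator_def)
    also have "\<dots> = ennreal (measure P (A \<times> {..q}))"
      unfolding dens emN[OF that] by (simp add: emeasure_eq_measure)
    finally show ?thesis .
  qed
  have int: "(\<integral>x. indicator A x * D x \<partial>first) = measure P (A \<times> {..q})" if [measurable]: "A \<in> sets borel" for A
    using enn[OF that] D(3) by (intro integral_eq_nn_integral[THEN trans]) auto
  have Dint: "integrable first D"
    using enn[of UNIV] D(3) by (intro integrableI_nonneg) auto
  have "AE x in first. D x \<le> 1"
  proof (rule AE_le_of_set_integral_le)
    fix A assume "A \<in> sets first"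
    then have A[measurable]: "A \<in> sets borel" by simp
    have "measure P (A \<times> {..q}) \<le> measure P (A \<times> UNIV)"
      by (intro finite_measure_mono) auto
    then show "(\<integral>x. indicator A x * D x \<partial>first) \<le> (\<integral>x. indicator A x * 1 \<partial>first)"
      using int[OF A] measure_first[OF A] by simp
  qed (use Dint in auto)
  then have ae: "AE x in first. min 1 (D x) = D x"
    by (rule AE_mp) (auto intro!: AE_I2)
  have "(\<integral>x. indicator A x * min 1 (D x) \<partial>first) = measure P (A \<times> {..q})" if [measurable]: "A \<in> sets borel" for A
    unfolding int[OF that, symmetric] by (rule integral_cong_AE) (use ae in auto)
  then show ?thesis
    using D(1,3) by (intro exI[of _ "\<lambda>x. min 1 (D x)"]) auto
qed

text \<open>A version is chosen for each level \<open>q\<close> separately, so monotonicity in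
  \<open>q\<close> holds only almost everywhere, with a null set that depends on the pair of
  levels.\<close>

definition ccdf :: "real \<Rightarrow> real \<Rightarrow> real" where
  "ccdf q = (SOME f. f \<in> borel_measurable borel \<and> (\<forall>x. 0 \<le> f x \<and> f x \<le> 1) \<and>
     (\<forall>A\<in>sets borel. measure P (A \<times> {..q}) = (\<integral>x. indicator A x * f x \<partial>first)))"

lemma ccdf:
  shows ccdf_measurable [measurable]: "ccdf q \<in> borel_measurable borel"
    and ccdf_nonneg: "0 \<le> ccdf q x" and ccdf_le_1: "ccdf q x \<le> 1"
    and integral_ccdf: "A \<in> sets borel \<Longrightarrow> (\<integral>x. indicator A x * ccdf q x \<partial>first) = measure P (A \<times> {..q})"
proof -
  have "ccdf q \<in> borel_measurable borel \<and> (\<forall>x. 0 \<le> ccdf q x \<and> ccdf q x \<le> 1) \<and>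
     (\<forall>A\<in>sets borel. measure P (A \<times> {..q}) = (\<integral>x. indicator A x * ccdf q x \<partial>first))"
    unfolding ccdf_def by (rule someI_ex[OF ex_conditional_cdf])
  then show "ccdf q \<in> borel_measurable borel" "0 \<le> ccdf q x" "ccdf q x \<le> 1"
    "A \<in> sets borel \<Longrightarrow> (\<integral>x. indicator A x * ccdf q x \<partial>first) = measure P (A \<times> {..q})"
    by simp_all
qed

lemma integrable_unit_interval:
  "u \<in> borel_measurable borel \<Longrightarrow> (\<And>x. 0 \<le> u x) \<Longrightarrow> (\<And>x. u x \<le> 1) \<Longrightarrow> integrable first u"
  for u :: "real \<Rightarrow> real"
  using prob_space.finite_measure[OF prob_space_first]
  by (intro finite_measure.integrable_const_bound[where B = 1]) auto

text \<open>The infimum over larger rationals is monotone and right-continuous at \<^emph>\<open>every\<close> point,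
  so that exceptional null sets only enter through the limits at infinity.\<close>

definition rcdf :: "real \<Rightarrow> real \<Rightarrow> real" where
  "rcdf x r = (INF q\<in>{q\<in>\<rat>. r < q}. ccdf q x)"

lemma rcdf_nonempty: "{q\<in>\<rat>. (r::real) < q} \<noteq> {}"
  using Rats_dense_in_real[of r "r + 1"] by auto

lemma rcdf_bdd: "bdd_below ((\<lambda>q. ccdf q x) ` A)"
  using ccdf_nonneg by (intro bdd_belowI2[where m = 0]) auto

lemma rcdf_le: "q \<in> \<rat> \<Longrightarrow> r < q \<Longrightarrow> rcdf x r \<le> ccdf q x"
  unfolding rcdf_def by (intro cINF_lower rcdf_bdd) auto

lemma rcdf_nonneg: "0 \<le> rcdf x r"
  unfolding rcdf_def by (intro cINF_greatest rcdf_nonempty ccdf_nonneg)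

lemma rcdf_le_1: "rcdf x r \<le> 1"
  using rcdf_nonempty[of r] rcdf_le[of _ r x] ccdf_le_1 by (blast intro: order_trans)

lemma rcdf_mono: "r \<le> s \<Longrightarrow> rcdf x r \<le> rcdf x s"
  unfolding rcdf_def by (intro cINF_superset_mono rcdf_nonempty rcdf_bdd) auto

lemma rcdf_right_continuous: "continuous (at_right r) (rcdf x)"
  unfolding continuous_within
proof (rule order_tendstoI)
  fix a assume "a < rcdf x r"
  then show "eventually (\<lambda>y. a < rcdf x y) (at_right r)"
    using rcdf_mono[of r _ x] by (auto simp: eventually_at_right_field intro!: exI[of _ "r + 1"] intro: less_le_trans)
next
  fix a assume "rcdf x r < a"
  then obtain q where q: "q \<in> \<rat>" "r < q" "ccdf q x < a"
    unfolding rcdf_def using cINF_less_iff[OF rcdf_nonempty rcdf_bdd] by blast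
  then have "rcdf x y < a" if "y < q" for y
    using rcdf_le[of q y x] that by simp
  then show "eventually (\<lambda>y. rcdf x y < a) (at_right r)"
    using q(2) by (auto simp: eventually_at_right_field intro!: exI[of _ q])
qed

lemma rcdf_measurable [measurable]: "(\<lambda>x. rcdf x r) \<in> borel_measurable borel"
  unfolding rcdf_def using countable_rat rcdf_bdd
  by (intro borel_measurable_cINF) (auto intro: countable_subset)

lemma ccdf_mono_AE: "r \<le> q \<Longrightarrow> AE x in first. ccdf r x \<le> ccdf q x"
proof (rule AE_le_of_set_integral_le)
  assume "r \<le> q"
  fix A assume "A \<in> sets first"
  then have [measurable]: "A \<in> sets borel" by simp
  show "(\<integral>x. indicator A x * ccdf r x \<partial>first) \<le> (\<integral>x. indicator A x * ccdf q x \<partial>first)"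
    using \<open>r \<le> q\<close> by (simp add: integral_ccdf) (intro finite_measure_mono, auto)
qed (auto intro!: integrable_unit_interval ccdf_nonneg ccdf_le_1)

text \<open>The upper bound is found after integration over a Borel set, by letting rational levels
  decrease to \<open>r\<close> and using continuity of \<open>P\<close> from above. The lower bound
  is almost sure monotonicity at the countably many rational levels above \<open>r\<close>.\<close>

lemma rcdf_eq_ccdf_AE: "AE x in first. rcdf x r = ccdf r x"
proof -
  have "AE x in first. rcdf x r \<le> ccdf r x"
  proof (rule AE_le_of_set_integral_le)
    fix A assume "A \<in> sets first"
    then have A[measurable]: "A \<in> sets borel" by simp
    have le: "(\<integral>x. indicator A x * rcdf x r \<partial>first) \<le> measure P (A \<times> {..r + 1 / Suc n})" for n
    proof -
      obtain q where q: "q \<in> \<rat>" "r < q" "q < r + 1 / Suc n"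
        using Rats_dense_in_real[of r "r + 1 / Suc n"] by auto
      have "(\<integral>x. indicator A x * rcdf x r \<partial>first) \<le> (\<integral>x. indicator A x * ccdf q x \<partial>first)"
        using rcdf_nonneg rcdf_le_1 ccdf_nonneg ccdf_le_1 rcdf_le[OF q(1,2)]
        by (intro integral_mono integrable_unit_interval) (auto simp: indicator_def)
      also have "\<dots> = measure P (A \<times> {..q})"
        by (rule integral_ccdf[OF A])
      also have "\<dots> \<le> measure P (A \<times> {..r + 1 / Suc n})"
        using q by (intro finite_measure_mono) auto
      finally show ?thesis .
    qed
    have "(\<lambda>n. measure P (A \<times> {..r + 1 / Suc n})) \<longlonglongrightarrow> measure P (\<Inter>n. A \<times> {..r + 1 / Suc n})"
    proof (rule finite_Lim_measure_decseq)
      show "decseq (\<lambda>n. A \<times> {..r + 1 / Suc n})"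
        by (auto simp: decseq_def intro: order_trans divide_left_mono)
          (smt (verit) divide_left_mono mult_pos_pos of_nat_0_le_iff of_nat_le_iff)
    qed auto
    also have "(\<Inter>n. A \<times> {..r + 1 / Suc n}) = A \<times> {..r}"
    proof -
      have "y \<le> r" if "\<And>n. y \<le> r + 1 / Suc n" for y
      proof (rule ccontr)
        assume "\<not> y \<le> r"
        then obtain n where "1 / Suc n < y - r"
          using reals_Archimedean[of "y - r"] by (auto simp: inverse_eq_divide)
        then show False using that[of n] by simp
      qed
      then show ?thesis by (auto intro: order_trans)
    qed
    finally have "(\<integral>x. indicator A x * rcdf x r \<partial>first) \<le> measure P (A \<times> {..r})"
      by (rule LIMSEQ_le_const) (use le in auto)
    then show "(\<integral>x. indicator A x * rcdf x r \<partial>first) \<le> (\<integral>x. indicator A x * ccdf r x \<partial>first)"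
      by (simp add: integral_ccdf)
  qed (auto intro!: integrable_unit_interval ccdf_nonneg ccdf_le_1 rcdf_nonneg rcdf_le_1)
  moreover have "AE x in first. \<forall>q\<in>{q\<in>\<rat>. r < q}. ccdf r x \<le> ccdf q x"
    using countable_rat by (intro AE_ball_countable[THEN iffD2] ballI ccdf_mono_AE) (auto intro: countable_subset)
  ultimately show ?thesis
  proof eventually_elim
    case (elim x)
    then have "ccdf r x \<le> rcdf x r"
      unfolding rcdf_def by (intro cINF_greatest rcdf_nonempty) auto
    with elim show ?case by simp
  qed
qed

lemma integral_rcdf:
  assumes [measurable]: "A \<in> sets borel"
  shows "(\<integral>x. indicator A x * rcdf x r \<partial>first) = measure P (A \<times> {..r})"
  unfolding integral_ccdf[OF assms, symmetric]
  by (rule integral_cong_AE) (use rcdf_eq_ccdf_AE[of r] in auto)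

text \<open>The points \<open>x\<close> at which \<open>rcdf x\<close> has the limits 0 and 1 at the
  two ends. By monotonicity integer arguments suffice, so countably many conditions describe the set
  and it is Borel.\<close>

definition good :: "real set" where
  "good = {x. (\<forall>k::nat. \<exists>n::nat. rcdf x (- real n) < 1 / Suc k) \<and>
              (\<forall>k::nat. \<exists>n::nat. 1 - 1 / Suc k < rcdf x (real n))}"

lemma good_measurable [measurable]: "good \<in> sets borel"
proof -
  have "{x \<in> space borel. (\<forall>k::nat. \<exists>n::nat. rcdf x (- real n) < 1 / Suc k) \<and>
              (\<forall>k::nat. \<exists>n::nat. 1 - 1 / Suc k < rcdf x (real n))} \<in> sets borel"
    by measurable
  then show ?thesis by (simp add: good_def)
qed

lemma measure_half_plane_bot: "(\<lambda>n. measure P (UNIV \<times> {..- real n})) \<longlonglongrightarrow> 0"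
proof -
  have "(\<lambda>n. measure P (UNIV \<times> {..- real n})) \<longlonglongrightarrow> measure P (\<Inter>n. UNIV \<times> {..- real n})"
    by (rule finite_Lim_measure_decseq) (auto simp: decseq_def)
  also have "(\<Inter>n. UNIV \<times> {..- real n}) = ({} :: (real \<times> real) set)"
  proof -
    have "\<exists>n. - real n < y" for y :: real
      using reals_Archimedean2[of "- y"] by (auto intro: exI simp: minus_less_iff)
    then have "\<exists>n. \<not> y \<le> - real n" for y :: real
      by (simp add: not_le)
    then show ?thesis by fastforce
  qed
  finally show ?thesis by simp
qed

lemma measure_half_plane_top: "(\<lambda>n. measure P (UNIV \<times> {..real n})) \<longlonglongrightarrow> 1"
proof -
  have "(\<lambda>n. measure P (UNIV \<times> {..real n})) \<longlonglongrightarrow> measure P (\<Union>n. UNIV \<times> {..real n})"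
    by (rule finite_Lim_measure_incseq) (auto simp: incseq_def)
  also have "(\<Union>n. UNIV \<times> {..real n}) = (UNIV :: (real \<times> real) set)"
    using real_arch_simple by auto
  finally show ?thesis using prob_space by simp
qed

lemma good_AE: "AE x in first. x \<in> good"
proof -
  interpret F: prob_space first by (rule prob_space_first)
  have "AE x in first. \<exists>n::nat. rcdf x (- real n) < 1 / Suc k" for k
  proof -
    define B where "B = {x\<in>space borel. \<forall>n::nat. 1 / Suc k \<le> rcdf x (- real n)}"
    have B[measurable]: "B \<in> sets borel" unfolding B_def by measurable
    \<comment> \<open>Markov's inequality: \<open>rcdf\<close> is at least \<open>1 / Suc k\<close>
      on the bad set \<open>B\<close>, and its integral is the mass of a half plane that shrinks to
      the empty set.\<close>
    have "1 / Suc k * measure first B \<le> measure P (UNIV \<times> {..- real n})" for n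
    proof -
      have "1 / Suc k * measure first B = (\<integral>x. 1 / Suc k * indicator B x \<partial>first)"
        by simp
      also have "\<dots> \<le> (\<integral>x. rcdf x (- real n) \<partial>first)"
        using rcdf_nonneg rcdf_le_1
        by (intro integral_mono integrable_unit_interval) (auto simp: B_def indicator_def)
      also have "\<dots> = measure P (UNIV \<times> {..- real n})"
        using integral_rcdf[of UNIV "- real n"] by simp
      finally show ?thesis .
    qed
    then have "1 / Suc k * measure first B \<le> 0"
      by (intro LIMSEQ_le_const[OF measure_half_plane_bot]) auto
    then have "measure first B = 0"
      using measure_nonneg[of first B] by (auto simp: divide_le_0_iff)
    then have "B \<in> null_sets first"
      by (auto simp: F.emeasure_eq_measure)
    then show ?thesis
      by (rule AE_I') (auto simp: B_def not_less)
  qed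
  moreover have "AE x in first. \<exists>n::nat. 1 - 1 / Suc k < rcdf x (real n)" for k
  proof -
    define B where "B = {x\<in>space borel. \<forall>n::nat. rcdf x (real n) \<le> 1 - 1 / Suc k}"
    have B[measurable]: "B \<in> sets borel" unfolding B_def by measurable
    have "measure P (UNIV \<times> {..real n}) \<le> 1 - 1 / Suc k * measure first B" for n
    proof -
      have "measure P (UNIV \<times> {..real n}) = (\<integral>x. rcdf x (real n) \<partial>first)"
        using integral_rcdf[of UNIV "real n"] by simp
      also have "\<dots> \<le> (\<integral>x. 1 - 1 / Suc k * indicator B x \<partial>first)"
        using rcdf_nonneg rcdf_le_1
        by (intro integral_mono integrable_unit_interval) (auto simp: B_def indicator_def)
      also have "\<dots> = 1 - 1 / Suc k * measure first B"
      proof -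
        have "integrable first (\<lambda>x. 1 / Suc k * indicator B x)"
          by (rule integrable_unit_interval) (auto simp: indicator_def)
        then show ?thesis
          using F.prob_space by (subst Bochner_Integration.integral_diff) auto
      qed
      finally show ?thesis .
    qed
    then have "1 \<le> 1 - 1 / Suc k * measure first B"
      by (intro LIMSEQ_le_const2[OF measure_half_plane_top]) auto
    then have "measure first B = 0"
      using measure_nonneg[of first B] by (auto simp: divide_le_0_iff)
    then have "B \<in> null_sets first"
      by (auto simp: F.emeasure_eq_measure)
    then show ?thesis
      by (rule AE_I') (auto simp: B_def not_less)
  qed
  ultimately have "AE x in first. (\<forall>k::nat. \<exists>n::nat. rcdf x (- real n) < 1 / Suc k) \<and>
              (\<forall>k::nat. \<exists>n::nat. 1 - 1 / Suc k < rcdf x (real n))"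
    by (simp add: AE_all_countable)
  then show ?thesis by (simp add: good_def)
qed

text \<open>Outside the good set, that is on a null set, any fixed probability measure will do; the
  Dirac measure at 0 keeps \<open>kernel\<close> measurable and probability-valued
  everywhere.\<close>

definition kernel :: "real \<Rightarrow> real measure" where
  "kernel x = (if x \<in> good then interval_measure (rcdf x) else return borel 0)"

lemma good_limits:
  assumes "x \<in> good"
  shows "(rcdf x \<longlongrightarrow> 0) at_bot" "(rcdf x \<longlongrightarrow> 1) at_top"
proof -
  show "(rcdf x \<longlongrightarrow> 0) at_bot"
  proof (rule order_tendstoI)
    fix a :: real assume "0 < a"
    then obtain k where k: "1 / Suc k < a"
      using reals_Archimedean[of a] by (auto simp: inverse_eq_divide)
    obtain n where n: "rcdf x (- real n) < 1 / Suc k"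
      using assms by (auto simp: good_def)
    have "rcdf x y < a" if "y \<le> - real n" for y
      using rcdf_mono[OF that, of x] n k by simp
    then show "eventually (\<lambda>y. rcdf x y < a) at_bot"
      by (auto simp: eventually_at_bot_linorder)
  qed (auto intro!: always_eventually less_le_trans[OF _ rcdf_nonneg])
  show "(rcdf x \<longlongrightarrow> 1) at_top"
  proof (rule order_tendstoI)
    fix a :: real assume "a < 1"
    then obtain k where k: "1 / Suc k < 1 - a"
      using reals_Archimedean[of "1 - a"] by (auto simp: inverse_eq_divide)
    obtain n where n: "1 - 1 / Suc k < rcdf x (real n)"
      using assms by (auto simp: good_def)
    have "a < rcdf x y" if "real n \<le> y" for y
      using rcdf_mono[OF that, of x] n k by simp
    then show "eventually (\<lambda>y. a < rcdf x y) at_top"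
      by (auto simp: eventually_at_top_linorder)
  qed (auto intro!: always_eventually le_less_trans[OF rcdf_le_1])
qed

lemma kernel_props:
  shows prob_space_kernel: "prob_space (kernel x)" and sets_kernel_real: "sets (kernel x) = sets borel"
    and emeasure_kernel_Iic: "x \<in> good \<Longrightarrow> emeasure (kernel x) {..r} = rcdf x r"
proof -
  show "prob_space (kernel x)"
    using real_distribution_interval_measure[OF rcdf_mono rcdf_right_continuous good_limits, of x]
    by (auto simp: kernel_def real_distribution_def prob_space_return)
  show "sets (kernel x) = sets borel"
    by (simp add: kernel_def)
  show "x \<in> good \<Longrightarrow> emeasure (kernel x) {..r} = rcdf x r"
    using emeasure_interval_measure_Iic[OF rcdf_mono rcdf_right_continuous good_limits(1)]
    by (simp add: kernel_def)
qed

lemma measurable_kernel: "kernel \<in> borel \<rightarrow>\<^sub>M prob_algebra borel"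
proof (rule measurable_prob_algebra_generated)
  show "sets (borel :: real measure) = sigma_sets UNIV (range (\<lambda>a. {..a}))"
    by (subst borel_eq_atMost) simp
  show "Int_stable (range (\<lambda>a::real. {..a}))"
    by (auto simp: Int_stable_def)
  fix A :: "real set" assume "A \<in> range (\<lambda>a. {..a})"
  then obtain a where A: "A = {..a}" by auto
  have "emeasure (kernel x) A = (if x \<in> good then ennreal (rcdf x a) else indicator {..a} 0)" for x
    using emeasure_kernel_Iic[of x a] by (auto simp: A kernel_def)
  then show "(\<lambda>x. emeasure (kernel x) A) \<in> borel_measurable borel"
    by simp
qed (auto intro: prob_space_kernel simp: sets_kernel_real)

text \<open>The two measures are compared on the quadrants \<open>{..(a, b)}\<close>, an
  intersection-stable generator of the Borel sets of the plane. There the identity is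
  \<open>integral_rcdf\<close> over the set \<open>{..a}\<close>.\<close>

theorem disintegration: "P = first \<bind> (\<lambda>x. distr (kernel x) (borel \<Otimes>\<^sub>M borel) (\<lambda>y. (x, y)))"
proof -
  interpret F: prob_space first by (rule prob_space_first)
  let ?k = "\<lambda>x. distr (kernel x) (borel \<Otimes>\<^sub>M borel) (\<lambda>y. (x, y))"
  have k: "?k \<in> first \<rightarrow>\<^sub>M subprob_algebra (borel \<Otimes>\<^sub>M borel)"
    using measurable_prob_algebraD[OF measurable_kernel]
    by (intro measurable_distr2[where M = borel]) (auto simp: measurable_cong_sets[OF sets_first refl])
  have sb: "sets (first \<bind> ?k) = sets (borel \<Otimes>\<^sub>M borel)"
    by (rule sets_bind[OF sets_kernel[OF k]]) auto
  show ?thesis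
  proof (rule measure_eqI_generator_eq[where E = "range (\<lambda>a. {..a :: real \<times> real})" and \<Omega> = UNIV
        and A = "\<lambda>n. {..(real n, real n)}"])
    show "Int_stable (range (\<lambda>a. {..a :: real \<times> real}))"
    proof (rule Int_stableI_image)
      fix a b :: "real \<times> real"
      show "\<exists>c\<in>UNIV. {..a} \<inter> {..b} = {..c}"
        by (intro bexI[of _ "(min (fst a) (fst b), min (snd a) (snd b))"]) (auto simp: less_eq_prod_def)
    qed
    show "sets P = sigma_sets UNIV (range (\<lambda>a. {..a :: real \<times> real}))"
      unfolding sets_P borel_prod by (subst borel_eq_atMost) simp
    then show "sets (first \<bind> ?k) = sigma_sets UNIV (range (\<lambda>a. {..a :: real \<times> real}))"
      by (simp add: sb)
    show "(\<Union>n. {..(real n, real n)}) = UNIV"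
    proof -
      have "\<exists>n. fst z \<le> real n \<and> snd z \<le> real n" for z :: "real \<times> real"
        using real_arch_simple[of "max (fst z) (snd z)"] by auto
      then show ?thesis by (auto simp: less_eq_prod_def)
    qed
    fix X assume "X \<in> range (\<lambda>a. {..a :: real \<times> real})"
    then obtain c where c: "X = {..c}" by auto
    obtain a b where "c = (a, b)" by (cases c)
    with c have X: "X = {..a} \<times> {..b}"
      by (auto simp: less_eq_prod_def)
    have [measurable]: "X \<in> sets (borel \<Otimes>\<^sub>M borel)" by (simp add: X)
    have "emeasure (first \<bind> ?k) X = (\<integral>\<^sup>+x. emeasure (?k x) X \<partial>first)"
      by (rule emeasure_bind[OF _ k]) auto
    also have "\<dots> = (\<integral>\<^sup>+x. ennreal (indicator {..a} x * rcdf x b) \<partial>first)"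
    proof (rule nn_integral_cong_AE, use good_AE in eventually_elim)
      case (elim x)
      have "emeasure (?k x) X = emeasure (kernel x) ({y. (x, y) \<in> X})"
        using sets_eq_imp_space_eq[OF sets_kernel_real[of x]]
        by (subst emeasure_distr) (auto simp: vimage_def measurable_cong_sets[OF sets_kernel_real refl])
      also have "{y. (x, y) \<in> X} = (if x \<le> a then {..b} else {})"
        by (auto simp: X)
      finally show ?case
        using emeasure_kernel_Iic[OF elim, of b] by (auto simp: indicator_def)
    qed
    also have "\<dots> = ennreal (\<integral>x. indicator {..a} x * rcdf x b \<partial>first)"
      using rcdf_nonneg rcdf_le_1
      by (intro nn_integral_eq_integral integrable_unit_interval) (auto simp: indicator_def)
    also have "\<dots> = emeasure P X"
      by (simp add: integral_rcdf emeasure_eq_measure X)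
    finally show "emeasure P X = emeasure (first \<bind> ?k) X" ..
  qed (auto simp: emeasure_finite)
qed

end

section \<open>Kernels\<close>

text \<open>The measure \<open>m \<otimes> K\<close>, in the form in which
  \<open>is_kernel_for\<close> says that \<open>K\<close> disintegrates a two-dimensional
  marginal.\<close>

definition kernel_product :: "real measure \<Rightarrow> (real \<Rightarrow> real measure) \<Rightarrow> (real \<times> real) measure" where
  "kernel_product m K = m \<bind> (\<lambda>x. distr (K x) (borel \<Otimes>\<^sub>M borel) (\<lambda>y. (x, y)))"

context
  fixes K :: "real \<Rightarrow> real measure"
  assumes K: "K \<in> borel \<rightarrow>\<^sub>M prob_algebra borel"
begin

lemma kernel_sets: "sets (K x) = sets borel" and kernel_prob_space: "prob_space (K x)"
  using measurable_space[OF K, of x] by (auto simp: space_prob_algebra)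

lemma measurable_kernel_Pair:
  assumes "sets m = sets borel"
  shows "(\<lambda>x. distr (K x) (borel \<Otimes>\<^sub>M borel) (\<lambda>y. (x, y))) \<in> m \<rightarrow>\<^sub>M subprob_algebra (borel \<Otimes>\<^sub>M borel)"
  using measurable_prob_algebraD[OF K]
  by (intro measurable_distr2[where M = borel])
    (auto simp: measurable_cong_sets[OF assms refl] measurable_cong_sets[OF sets_pair_measure_cong[OF assms refl] refl])

lemma sets_kernel_product:
  assumes "sets m = sets borel"
  shows "sets (kernel_product m K) = sets (borel \<Otimes>\<^sub>M borel)"
  unfolding kernel_product_def
  by (rule sets_bind[OF sets_kernel[OF measurable_kernel_Pair[OF assms]]])
    (auto simp: sets_eq_imp_space_eq[OF assms])

lemma nn_integral_kernel_product:
  assumes m: "sets m = sets borel" and f: "f \<in> borel_measurable (borel \<Otimes>\<^sub>M borel)"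
  shows "(\<integral>\<^sup>+z. f z \<partial>kernel_product m K) = (\<integral>\<^sup>+x. \<integral>\<^sup>+y. f (x, y) \<partial>K x \<partial>m)"
  unfolding kernel_product_def nn_integral_bind[OF f measurable_kernel_Pair[OF m]]
  using f by (intro nn_integral_cong nn_integral_distr)
    (auto simp: measurable_cong_sets[OF kernel_sets refl])

lemma emeasure_kernel_product_times:
  assumes m: "sets m = sets borel" and [measurable]: "A \<in> sets borel" "B \<in> sets borel"
  shows "emeasure (kernel_product m K) (A \<times> B) = (\<integral>\<^sup>+x. indicator A x * emeasure (K x) B \<partial>m)"
proof -
  have "emeasure (kernel_product m K) (A \<times> B) = (\<integral>\<^sup>+z. indicator (A \<times> B) z \<partial>kernel_product m K)"
    by (subst nn_integral_indicator) (auto simp: sets_kernel_product[OF m])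
  also have "\<dots> = (\<integral>\<^sup>+x. \<integral>\<^sup>+y. indicator (A \<times> B) (x, y) \<partial>K x \<partial>m)"
    by (rule nn_integral_kernel_product[OF m]) measurable
  also have "\<dots> = (\<integral>\<^sup>+x. indicator A x * emeasure (K x) B \<partial>m)"
    by (intro nn_integral_cong) (simp add: indicator_times nn_integral_cmult kernel_sets measurable_cong_sets[OF kernel_sets refl])
  finally show ?thesis .
qed

text \<open>The density depends on the first coordinate only, so it passes through the inner
  integral to the base measure.\<close>

lemma density_kernel_product:
  assumes m: "sets m = sets borel" and [measurable]: "r \<in> borel_measurable borel"
  shows "density (kernel_product m K) (\<lambda>z. r (fst z)) = kernel_product (density m r) K"
proof (rule measure_eqI)
  note s = sets_kernel_product[OF m]
  show "sets (density (kernel_product m K) (\<lambda>z. r (fst z))) = sets (kernel_product (density m r) K)"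
    using m by (simp add: s sets_kernel_product)
  fix A assume "A \<in> sets (density (kernel_product m K) (\<lambda>z. r (fst z)))"
  then have A[measurable]: "A \<in> sets (borel \<Otimes>\<^sub>M borel)" by (simp add: s)
  have [measurable]: "(\<lambda>x. \<integral>\<^sup>+y. indicator A (x, y) \<partial>K x) \<in> borel_measurable borel"
    using measurable_prob_algebraD[OF K] by (intro nn_integral_measurable_subprob_algebra2[where N = borel]) auto
  have "emeasure (density (kernel_product m K) (\<lambda>z. r (fst z))) A
      = (\<integral>\<^sup>+z. r (fst z) * indicator A z \<partial>kernel_product m K)"
    by (rule emeasure_density) (auto simp: s measurable_cong_sets[OF s refl])
  also have "\<dots> = (\<integral>\<^sup>+x. \<integral>\<^sup>+y. r x * indicator A (x, y) \<partial>K x \<partial>m)"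
    by (subst nn_integral_kernel_product[OF m]) auto
  also have "\<dots> = (\<integral>\<^sup>+x. r x * (\<integral>\<^sup>+y. indicator A (x, y) \<partial>K x) \<partial>m)"
    by (intro nn_integral_cong nn_integral_cmult) (auto simp: measurable_cong_sets[OF kernel_sets refl])
  also have "\<dots> = (\<integral>\<^sup>+x. \<integral>\<^sup>+y. indicator A (x, y) \<partial>K x \<partial>density m r)"
    by (rule nn_integral_density[symmetric]) (auto simp: measurable_cong_sets[OF m refl])
  also have "\<dots> = (\<integral>\<^sup>+z. indicator A z \<partial>kernel_product (density m r) K)"
    by (subst nn_integral_kernel_product) (auto simp: m)
  also have "\<dots> = emeasure (kernel_product (density m r) K) A"
    by (rule nn_integral_indicator) (auto simp: sets_kernel_product m)
  finally show "emeasure (density (kernel_product m K) (\<lambda>z. r (fst z))) A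
      = emeasure (kernel_product (density m r) K) A" .
qed

end

lemma kernel_product_cong_AE:
  assumes K: "K1 \<in> borel \<rightarrow>\<^sub>M prob_algebra borel" "K2 \<in> borel \<rightarrow>\<^sub>M prob_algebra borel"
    and m: "sets m = sets borel" and eq: "AE x in m. K1 x = K2 x"
  shows "kernel_product m K1 = kernel_product m K2"
proof (rule measure_eqI)
  show "sets (kernel_product m K1) = sets (kernel_product m K2)"
    by (simp add: sets_kernel_product[OF K(1) m] sets_kernel_product[OF K(2) m])
  fix A assume "A \<in> sets (kernel_product m K1)"
  then have [measurable]: "A \<in> sets (borel \<Otimes>\<^sub>M borel)" by (simp add: sets_kernel_product[OF K(1) m])
  have "(\<integral>\<^sup>+z. indicator A z \<partial>kernel_product m K1) = (\<integral>\<^sup>+z. indicator A z \<partial>kernel_product m K2)"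
    unfolding nn_integral_kernel_product[OF K(1) m borel_measurable_indicator[OF \<open>A \<in> sets (borel \<Otimes>\<^sub>M borel)\<close>]]
      nn_integral_kernel_product[OF K(2) m borel_measurable_indicator[OF \<open>A \<in> sets (borel \<Otimes>\<^sub>M borel)\<close>]]
    by (rule nn_integral_cong_AE) (use eq in \<open>eventually_elim, simp\<close>)
  then show "emeasure (kernel_product m K1) A = emeasure (kernel_product m K2) A"
    by (simp add: sets_kernel_product[OF K(1) m] sets_kernel_product[OF K(2) m])
qed

text \<open>Distribution functions that agree at the rationals agree everywhere by monotonicity and
  right-continuity. A countable set of levels is what almost sure statements can be collected
  over.\<close>

lemma real_measure_eqI_rat_Iic:
  fixes M N :: "real measure"
  assumes M: "prob_space M" "sets M = sets borel" and N: "prob_space N" "sets N = sets borel"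
    and eq: "\<And>q. q \<in> \<rat> \<Longrightarrow> measure M {..q} = measure N {..q}"
  shows "M = N"
proof -
  have le: "cdf A r \<le> cdf B r"
    if A: "real_distribution A" and B: "real_distribution B"
      and eq: "\<And>q. q \<in> \<rat> \<Longrightarrow> measure A {..q} = measure B {..q}" for A B r
  proof (rule ccontr)
    interpret A: real_distribution A by fact
    interpret B: real_distribution B by fact
    assume "\<not> cdf A r \<le> cdf B r"
    then have "eventually (\<lambda>y. cdf B y < cdf A r) (at_right r)"
      using B.cdf_is_right_cont[of r] by (intro order_tendstoD(2)[of _ "cdf B r"]) (auto simp: continuous_within)
    then obtain b where b: "r < b" "\<And>y. r < y \<Longrightarrow> y < b \<Longrightarrow> cdf B y < cdf A r"
      by (auto simp: eventually_at_right_field)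
    obtain q where q: "q \<in> \<rat>" "r < q" "q < b"
      using Rats_dense_in_real[OF b(1)] by blast
    then have "cdf A q < cdf A r"
      using b(2)[of q] eq[of q] by (simp add: cdf_def)
    then show False
      using A.cdf_nondecreasing[of r q] q by simp
  qed
  have d: "real_distribution M" "real_distribution N"
    using M N sets_eq_imp_space_eq[OF M(2)] sets_eq_imp_space_eq[OF N(2)]
    by (auto simp: real_distribution_def real_distribution_axioms_def)
  have "cdf M = cdf N"
    using le[OF d(1,2) eq] le[OF d(2,1) eq[symmetric]] by (intro ext antisym)
  then show ?thesis
    by (rule cdf_unique[OF d])
qed

text \<open>For fixed \<open>q\<close> the functions \<open>x \<mapsto> measure (K x) {..q}\<close>
  of the two kernels have equal integrals over every Borel set, hence agree almost everywhere; the
  exceptional sets are then united over rational \<open>q\<close>.\<close>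

lemma kernel_product_eq_AE:
  assumes K: "K1 \<in> borel \<rightarrow>\<^sub>M prob_algebra borel" "K2 \<in> borel \<rightarrow>\<^sub>M prob_algebra borel"
    and m: "sets m = sets borel" "finite_measure m"
    and eq: "kernel_product m K1 = kernel_product m K2"
  shows "AE x in m. K1 x = K2 x"
proof -
  interpret m: finite_measure m by fact
  have meas: "(\<lambda>x. measure (K x) {..q}) \<in> borel_measurable m"
    if "K \<in> borel \<rightarrow>\<^sub>M prob_algebra borel" for K :: "real \<Rightarrow> real measure" and q
    using that measure_measurable_prob_algebra2[of borel "\<lambda>_. {..q}" borel K]
    by (simp add: measurable_cong_sets[OF m(1) refl])
  have int: "integrable m (\<lambda>x. measure (K x) {..q})"
    if "K \<in> borel \<rightarrow>\<^sub>M prob_algebra borel" for K :: "real \<Rightarrow> real measure" and q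
    using prob_space.prob_le_1[OF kernel_prob_space[OF that]] meas[OF that]
    by (intro m.integrable_const_bound[where B = 1]) auto
  have set_int: "ennreal (\<integral>x. indicator A x * measure (K x) {..q} \<partial>m) = emeasure (kernel_product m K) (A \<times> {..q})"
    if K: "K \<in> borel \<rightarrow>\<^sub>M prob_algebra borel" and A[measurable]: "A \<in> sets m" for K q A
  proof -
    have A': "A \<in> sets borel" using A m by simp
    have "emeasure (kernel_product m K) (A \<times> {..q}) = (\<integral>\<^sup>+x. ennreal (indicator A x * measure (K x) {..q}) \<partial>m)"
      by (subst emeasure_kernel_product_times[OF K m(1) A']) (auto intro!: nn_integral_cong
         simp: indicator_def finite_measure.emeasure_eq_measure[OF prob_space.finite_measure[OF kernel_prob_space[OF K]]])
    also have "\<dots> = ennreal (\<integral>x. indicator A x * measure (K x) {..q} \<partial>m)"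
      using integrable_mult_indicator[OF A int[OF K, of q]] by (intro nn_integral_eq_integral) auto
    finally show ?thesis ..
  qed
  have "AE x in m. measure (K1 x) {..q} = measure (K2 x) {..q}" for q
  proof -
    have *: "(\<integral>x. indicator A x * measure (K1 x) {..q} \<partial>m) = (\<integral>x. indicator A x * measure (K2 x) {..q} \<partial>m)"
      if "A \<in> sets m" for A
    proof -
      have "0 \<le> (\<integral>x. indicator A x * measure (K x) {..q} \<partial>m)" for K :: "real \<Rightarrow> real measure"
        by (intro integral_nonneg_AE) auto
      then show ?thesis
        using set_int[OF K(1) that, of q] set_int[OF K(2) that, of q] eq by (metis ennreal_inj)
    qed
    have "AE x in m. measure (K1 x) {..q} \<le> measure (K2 x) {..q}"
      using * by (intro AE_le_of_set_integral_le int K) auto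
    moreover have "AE x in m. measure (K2 x) {..q} \<le> measure (K1 x) {..q}"
      using * by (intro AE_le_of_set_integral_le int K) auto
    ultimately show ?thesis by eventually_elim simp
  qed
  then have "AE x in m. \<forall>q\<in>\<rat>. measure (K1 x) {..q} = measure (K2 x) {..q}"
    by (subst AE_ball_countable[OF countable_rat]) auto
  then show ?thesis
  proof eventually_elim
    case (elim x)
    then show ?case
      by (intro real_measure_eqI_rat_Iic kernel_sets kernel_prob_space K) auto
  qed
qed

text \<open>The forward direction needs only one pair of kernels, supplied by disintegration, while
  the backward direction treats an arbitrary pair. In both, the two densities give the products a
  common base measure \<open>\<theta>\<close>.\<close>

lemma kernels_agree_iff_densities_agree:
  assumes P: "real_coupling P1" "real_coupling P2"
    and r: "r1 \<in> borel_measurable borel" "r2 \<in> borel_measurable borel"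
    and \<theta>: "density (distr P1 borel fst) r1 = \<theta>" "density (distr P2 borel fst) r2 = \<theta>"
    and fin: "finite_measure \<theta>"
  shows "(\<forall>K1 K2. K1 \<in> borel \<rightarrow>\<^sub>M prob_algebra borel \<longrightarrow> P1 = kernel_product (distr P1 borel fst) K1 \<longrightarrow>
            K2 \<in> borel \<rightarrow>\<^sub>M prob_algebra borel \<longrightarrow> P2 = kernel_product (distr P2 borel fst) K2 \<longrightarrow>
            (AE x in \<theta>. K1 x = K2 x)) \<longleftrightarrow>
         density P1 (\<lambda>z. r1 (fst z)) = density P2 (\<lambda>z. r2 (fst z))"
    (is "?L \<longleftrightarrow> ?R")
proof -
  have ex: "\<exists>K. K \<in> borel \<rightarrow>\<^sub>M prob_algebra borel \<and> P = kernel_product (distr P borel fst) K"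
    if "real_coupling P" for P
    using real_coupling.measurable_kernel[OF that] real_coupling.disintegration[OF that]
    by (auto simp: kernel_product_def real_coupling.first_def[OF that])
  have s\<theta>: "sets \<theta> = sets borel" using \<theta>(1) by auto
  have dens: "density P (\<lambda>z. r (fst z)) = kernel_product \<theta> K"
    if "K \<in> borel \<rightarrow>\<^sub>M prob_algebra borel" "P = kernel_product (distr P borel fst) K"
      "r \<in> borel_measurable borel" "density (distr P borel fst) r = \<theta>" for P r K
    using density_kernel_product[OF that(1) _ that(3), of "distr P borel fst"] that(2,4) by simp
  show ?thesis
  proof
    assume L: ?L
    obtain K1 where K1: "K1 \<in> borel \<rightarrow>\<^sub>M prob_algebra borel" "P1 = kernel_product (distr P1 borel fst) K1"
      using ex[OF P(1)] by blast
    obtain K2 where K2: "K2 \<in> borel \<rightarrow>\<^sub>M prob_algebra borel" "P2 = kernel_product (distr P2 borel fst) K2"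
      using ex[OF P(2)] by blast
    have "AE x in \<theta>. K1 x = K2 x"
      using L K1 K2 by blast
    then show ?R
      unfolding dens[OF K1 r(1) \<theta>(1)] dens[OF K2 r(2) \<theta>(2)]
      by (rule kernel_product_cong_AE[OF K1(1) K2(1) s\<theta>])
  next
    assume R: ?R
    show ?L
    proof (intro allI impI)
      fix K1 K2
      assume K1: "K1 \<in> borel \<rightarrow>\<^sub>M prob_algebra borel" "P1 = kernel_product (distr P1 borel fst) K1"
        and K2: "K2 \<in> borel \<rightarrow>\<^sub>M prob_algebra borel" "P2 = kernel_product (distr P2 borel fst) K2"
      show "AE x in \<theta>. K1 x = K2 x"
        using R unfolding dens[OF K1 r(1) \<theta>(1)] dens[OF K2 r(2) \<theta>(2)]
        by (rule kernel_product_eq_AE[OF K1(1) K2(1) s\<theta> fin])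
    qed
  qed
qed

section \<open>Martingale measures\<close>

lemma continuous_on_restrict: "continuous_on UNIV (\<lambda>x::nat \<Rightarrow> real. restrict x A)"
proof (rule continuous_on_coordinatewise_then_product)
  show "continuous_on UNIV (\<lambda>x::nat \<Rightarrow> real. restrict x A i)" for i
    by (cases "i \<in> A") (auto intro: continuous_on_product_coordinates)
qed

lemma restrict_in_RT_space: "restrict x {1..T} \<in> RT_space T"
  by auto

lemma restrict_RT_space: "x \<in> RT_space T \<Longrightarrow> restrict x {1..T} = x"
  by (rule PiE_restrict)

lemma continuous_on_compose_restrict:
  assumes "continuous_on (RT_space T) f"
  shows "continuous_on UNIV (\<lambda>x. f (restrict x {1..T}))"
  by (rule continuous_on_compose2[OF assms continuous_on_restrict]) auto

text \<open>The Borel sets of the function space are generated by all coordinates; those outside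
  \<open>{1..T}\<close> have the constant value \<open>undefined\<close> on the space of
  \<open>RT T\<close>, hence are measurable as well.\<close>

lemma measurable_RT_borel: "(\<lambda>x. x) \<in> RT T \<rightarrow>\<^sub>M (borel :: (nat \<Rightarrow> real) measure)"
proof -
  have "(\<lambda>x. x) \<in> RT T \<rightarrow>\<^sub>M PiM UNIV (\<lambda>i::nat. borel :: real measure)"
  proof (rule measurable_PiM_single')
    show "(\<lambda>x. x i) \<in> RT T \<rightarrow>\<^sub>M borel" for i
    proof (cases "i \<in> {1..T}")
      case False
      then have "x i = undefined" if "x \<in> space (RT T)" for x
        using that by (auto simp: space_PiM PiE_def extensional_def)
      then show ?thesis
        by (subst measurable_cong[where g = "\<lambda>_. undefined"]) auto
    qed measurable
  qed auto
  then show ?thesis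
    by (simp add: measurable_cong_sets[OF refl sets_PiM_equal_borel])
qed

lemma measurable_borel_restrict: "(\<lambda>x::nat \<Rightarrow> real. restrict x {1..t}) \<in> borel \<rightarrow>\<^sub>M RT t"
proof (rule measurable_restrict)
  show "(\<lambda>x::nat \<Rightarrow> real. x i) \<in> borel \<rightarrow>\<^sub>M borel" for i
    by (rule borel_measurable_continuous_onI) (rule continuous_on_product_coordinates)
qed

lemma measurable_RT_restrict: "t \<le> T \<Longrightarrow> (\<lambda>x. restrict x {1..t}) \<in> RT T \<rightarrow>\<^sub>M RT t"
  by (rule measurable_restrict_subset) auto

lemma borel_measurable_RT_continuous:
  assumes "continuous_on (RT_space T) f"
  shows "f \<in> borel_measurable (RT T)"
proof -
  have "(\<lambda>x. f (restrict x {1..T})) \<in> borel_measurable (RT T)"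
    using measurable_comp[OF measurable_RT_borel
        borel_measurable_continuous_onI[OF continuous_on_compose_restrict[OF assms]]]
    by (simp add: comp_def)
  then show ?thesis
    by (subst measurable_cong[where g = "\<lambda>x. f (restrict x {1..T})"])
      (auto simp: space_PiM restrict_RT_space)
qed

lemma Cb_Rt_bound:
  assumes "Cb_Rt t v"
  obtains B where "0 \<le> B" "\<And>x. \<bar>v (restrict x {1..t})\<bar> \<le> B"
proof -
  obtain B where B: "\<And>y. y \<in> v ` RT_space t \<Longrightarrow> norm y \<le> B"
    using assms by (auto simp: Cb_Rt_def bounded_iff)
  have "\<bar>v (restrict x {1..t})\<bar> \<le> \<bar>B\<bar>" for x
    using B[of "v (restrict x {1..t})"] by (auto intro: order_trans)
  then show ?thesis using that[of "\<bar>B\<bar>"] by auto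
qed

lemma Cb_imp_Cb_Rt: "Cb v \<Longrightarrow> Cb_Rt t v"
  by (auto simp: Cb_Rt_def Cb_def bounded_iff intro: continuous_on_subset)

context
  fixes T :: nat and Q :: "(nat \<Rightarrow> real) measure"
  assumes Q: "sets Q = sets (RT T)" "prob_space Q"
begin

lemma space_Q: "space Q = RT_space T"
  using sets_eq_imp_space_eq[OF Q(1)] by (simp add: space_PiM)

lemma measurable_Q: "f \<in> RT T \<rightarrow>\<^sub>M N \<Longrightarrow> f \<in> Q \<rightarrow>\<^sub>M N"
  by (simp add: measurable_cong_sets[OF Q(1) refl])

lemma measurable_coordinate: "t \<in> {1..T} \<Longrightarrow> (\<lambda>\<omega>. \<omega> t) \<in> borel_measurable Q"
  by (intro measurable_Q) measurable

lemma subalgebra_filt: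
  assumes "t \<le> T"
  shows "subalgebra Q (filt Q t)"
proof -
  have "(\<lambda>\<omega>. restrict \<omega> {1..t}) \<in> space Q \<rightarrow> space (RT t)"
    by (auto simp: space_PiM)
  then show ?thesis
    using measurable_sets[OF measurable_Q[OF measurable_RT_restrict[OF assms]]]
    by (auto simp: subalgebra_def filt_def sets_vimage_algebra2)
qed

lemma measurable_filt:
  "v \<in> borel_measurable (RT t) \<Longrightarrow> (\<lambda>\<omega>. v (restrict \<omega> {1..t})) \<in> borel_measurable (filt Q t)"
  unfolding filt_def
  by (rule measurable_compose[OF measurable_vimage_algebra1]) (auto simp: space_PiM)

context
  assumes int: "\<And>t. t \<in> {1..T} \<Longrightarrow> integrable Q (\<lambda>\<omega>. \<omega> t)"
begin

lemma integrable_bounded_mult: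
  assumes "Cb_Rt t v" "t \<le> T" "integrable Q X"
  shows "integrable Q (\<lambda>\<omega>. v (restrict \<omega> {1..t}) * X \<omega>)"
proof -
  obtain B where B: "0 \<le> B" "\<And>x. \<bar>v (restrict x {1..t})\<bar> \<le> B"
    using Cb_Rt_bound[OF assms(1)] by blast
  have m: "(\<lambda>\<omega>. v (restrict \<omega> {1..t})) \<in> borel_measurable Q"
    using assms by (intro measurable_compose[OF measurable_Q[OF measurable_RT_restrict]]
        borel_measurable_RT_continuous) (auto simp: Cb_Rt_def)
  show ?thesis
  proof (rule Bochner_Integration.integrable_bound[where f = "\<lambda>\<omega>. B * X \<omega>"])
    show "AE \<omega> in Q. norm (v (restrict \<omega> {1..t}) * X \<omega>) \<le> norm (B * X \<omega>)"
      using B by (intro AE_I2) (auto simp: abs_mult intro!: mult_right_mono)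
  qed (use m assms(3) in auto)
qed

text \<open>The converse direction compares the finite measures with densities \<open>D\<^sup>+\<close> and \<open>D\<^sup>-\<close>, where
  \<open>D = S\<^sub>t\<^sub>+\<^sub>1 - S\<^sub>t\<close>, pushed forward to the first \<open>t\<close> coordinates.\<close>

lemma martingale_iff:
  "is_martingale_measure T Q \<longleftrightarrow>
     (\<forall>t\<in>{1..<T}. \<forall>v. Cb_Rt t v \<longrightarrow> (\<integral>\<omega>. v (restrict \<omega> {1..t}) * (\<omega> (Suc t) - \<omega> t) \<partial>Q) = 0)"
proof -
  interpret prob_space Q by (rule Q)
  have "(AE \<omega> in Q. real_cond_exp Q (filt Q t) (\<lambda>\<omega>. \<omega> (Suc t)) \<omega> = \<omega> t) \<longleftrightarrow>
     (\<forall>v. Cb_Rt t v \<longrightarrow> (\<integral>\<omega>. v (restrict \<omega> {1..t}) * (\<omega> (Suc t) - \<omega> t) \<partial>Q) = 0)" (is "?L \<longleftrightarrow> ?R")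
    if t: "t \<in> {1..<T}" for t
  proof -
    have tT: "t \<le> T" "t \<in> {1..T}" "Suc t \<in> {1..T}" using t by auto
    interpret sub: finite_measure_subalgebra Q "filt Q t"
      using subalgebra_filt[OF tT(1)] by unfold_locales
    note i = int[OF tT(2)] int[OF tT(3)]
    note m [measurable] = measurable_coordinate[OF tT(2)] measurable_coordinate[OF tT(3)]
    show ?thesis
    proof
      assume L: ?L
      show ?R
      proof (intro allI impI)
        fix v assume v: "Cb_Rt t v"
        have vm: "(\<lambda>\<omega>. v (restrict \<omega> {1..t})) \<in> borel_measurable (filt Q t)"
          using v by (intro measurable_filt borel_measurable_RT_continuous) (auto simp: Cb_Rt_def)
        have vQ[measurable]: "(\<lambda>\<omega>. v (restrict \<omega> {1..t})) \<in> borel_measurable Q"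
          by (rule measurable_from_subalg[OF sub.subalg vm])
        note ii = integrable_bounded_mult[OF v tT(1) i(1)] integrable_bounded_mult[OF v tT(1) i(2)]
        have "(\<integral>\<omega>. v (restrict \<omega> {1..t}) * \<omega> (Suc t) \<partial>Q)
            = (\<integral>\<omega>. v (restrict \<omega> {1..t}) * real_cond_exp Q (filt Q t) (\<lambda>\<omega>. \<omega> (Suc t)) \<omega> \<partial>Q)"
          by (rule sub.real_cond_exp_intg(2)[symmetric, OF ii(2) vm]) measurable
        also have "\<dots> = (\<integral>\<omega>. v (restrict \<omega> {1..t}) * \<omega> t \<partial>Q)"
        proof (rule integral_cong_AE)
          show "AE \<omega> in Q. v (restrict \<omega> {1..t}) * real_cond_exp Q (filt Q t) (\<lambda>\<omega>. \<omega> (Suc t)) \<omega>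
              = v (restrict \<omega> {1..t}) * \<omega> t"
            using L by eventually_elim simp
        qed measurable
        finally show "(\<integral>\<omega>. v (restrict \<omega> {1..t}) * (\<omega> (Suc t) - \<omega> t) \<partial>Q) = 0"
          using ii by (simp add: right_diff_distrib)
      qed
    next
      assume R: ?R
      define D where "D \<omega> = \<omega> (Suc t) - \<omega> t" for \<omega> :: "nat \<Rightarrow> real"
      have D[measurable]: "D \<in> borel_measurable Q" "integrable Q D"
        unfolding D_def[abs_def] using i by auto
      define N where "N s = distr (density Q (\<lambda>\<omega>. ennreal (max 0 (s * D \<omega>)))) borel (\<lambda>\<omega>. restrict \<omega> {1..t})" for s
      have rb[measurable]: "(\<lambda>\<omega>. restrict \<omega> {1..t}) \<in> Q \<rightarrow>\<^sub>M (borel :: (nat \<Rightarrow> real) measure)"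
        using measurable_compose[OF measurable_Q[OF measurable_RT_restrict[OF tT(1)]] measurable_RT_borel] .
      have rb': "(\<lambda>\<omega>. restrict \<omega> {1..t}) \<in> density Q g \<rightarrow>\<^sub>M (borel :: (nat \<Rightarrow> real) measure)" for g
        using rb by (simp add: measurable_cong_sets[OF sets_density refl])
      have iD: "integrable Q (\<lambda>\<omega>. max 0 (s * D \<omega>))" for s
        using D by (intro integrable_max) auto
      have finN: "finite_measure (N s)" for s
      proof -
        have "emeasure (N s) (space (N s)) = (\<integral>\<^sup>+\<omega>. ennreal (max 0 (s * D \<omega>)) \<partial>Q)"
          unfolding N_def by (subst emeasure_distr[OF rb']) (auto simp: emeasure_density intro!: nn_integral_cong)
        also have "\<dots> = ennreal (\<integral>\<omega>. max 0 (s * D \<omega>) \<partial>Q)"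
          by (rule nn_integral_eq_integral[OF iD]) auto
        finally show ?thesis by (intro finite_measureI) simp
      qed
      have intN: "(\<integral>x. \<phi> x \<partial>N s) = (\<integral>\<omega>. max 0 (s * D \<omega>) * \<phi> (restrict \<omega> {1..t}) \<partial>Q)"
        if [measurable]: "\<phi> \<in> borel_measurable borel" for \<phi> s
        unfolding N_def integral_distr[OF rb' that]
        by (subst integral_density[OF measurable_compose[OF rb that]]) auto
      have "N 1 = N (- 1)"
      proof (rule finite_measure_eqI_Cb[OF finN finN])
        show "sets (N 1) = sets borel" "sets (N (- 1)) = sets borel" by (auto simp: N_def)
        fix \<phi> :: "(nat \<Rightarrow> real) \<Rightarrow> real" assume \<phi>: "Cb \<phi>"
        note \<phi>m [measurable] = Cb_borel_measurable[OF \<phi>]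
        have ii: "integrable Q (\<lambda>\<omega>. max 0 (s * D \<omega>) * \<phi> (restrict \<omega> {1..t}))" for s
          using integrable_bounded_mult[OF Cb_imp_Cb_Rt[OF \<phi>] tT(1) iD] by (simp add: mult.commute)
        have "(\<integral>x. \<phi> x \<partial>N 1) - (\<integral>x. \<phi> x \<partial>N (- 1))
            = (\<integral>\<omega>. max 0 (1 * D \<omega>) * \<phi> (restrict \<omega> {1..t}) - max 0 (- 1 * D \<omega>) * \<phi> (restrict \<omega> {1..t}) \<partial>Q)"
          unfolding intN[OF \<phi>m] by (rule Bochner_Integration.integral_diff[symmetric, OF ii ii])
        also have "\<dots> = (\<integral>\<omega>. \<phi> (restrict \<omega> {1..t}) * (\<omega> (Suc t) - \<omega> t) \<partial>Q)"
          by (intro Bochner_Integration.integral_cong) (auto simp: D_def max_def algebra_simps)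
        also have "\<dots> = 0"
          using R Cb_imp_Cb_Rt[OF \<phi>] by auto
        finally show "(\<integral>x. \<phi> x \<partial>N 1) = (\<integral>x. \<phi> x \<partial>N (- 1))" by simp
      qed
      show ?L
      proof (rule sub.real_cond_exp_charact)
        fix A assume "A \<in> sets (filt Q t)"
        then obtain B where B: "B \<in> sets (RT t)" "A = (\<lambda>\<omega>. restrict \<omega> {1..t}) -` B \<inter> space Q"
          unfolding filt_def by (auto simp: sets_vimage_algebra2 space_PiM)
        have A[measurable]: "A \<in> sets Q"
          unfolding B(2) by (rule measurable_sets[OF measurable_Q[OF measurable_RT_restrict[OF tT(1)]] B(1)])
        \<comment> \<open>An event of the past is a preimage under restriction. Replacing
          \<open>B\<close> by a Borel set of the whole function space allows it to be tested against
          \<open>N 1 = N (- 1)\<close>.\<close>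
        define B' where "B' = (\<lambda>x. restrict x {1..t}) -` B"
        have B'[measurable]: "B' \<in> sets borel"
          using measurable_sets[OF measurable_borel_restrict B(1)] by (simp add: B'_def)
        have ind: "indicator B' (restrict \<omega> {1..t}) = (indicator A \<omega> :: real)" if "\<omega> \<in> space Q" for \<omega>
          using that by (auto simp: B'_def B(2) indicator_def)
        have "(\<integral>x. indicator B' x \<partial>N s) = (\<integral>\<omega>. max 0 (s * D \<omega>) * indicator A \<omega> \<partial>Q)" for s
          unfolding intN[OF borel_measurable_indicator[OF B']]
          by (intro Bochner_Integration.integral_cong) (simp_all only: ind)
        with \<open>N 1 = N (- 1)\<close> have "(\<integral>\<omega>. max 0 (1 * D \<omega>) * indicator A \<omega> \<partial>Q) = (\<integral>\<omega>. max 0 (- 1 * D \<omega>) * indicator A \<omega> \<partial>Q)"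
          by metis
        moreover have ii: "integrable Q (\<lambda>\<omega>. max 0 (s * D \<omega>) * indicator A \<omega>)" for s
          using integrable_mult_indicator[OF A iD] by (simp add: mult.commute)
        ultimately have "0 = (\<integral>\<omega>. max 0 (1 * D \<omega>) * indicator A \<omega> - max 0 (- 1 * D \<omega>) * indicator A \<omega> \<partial>Q)"
          using Bochner_Integration.integral_diff[OF ii[of 1] ii[of "- 1"]] by simp
        also have "\<dots> = (\<integral>\<omega>. indicator A \<omega> * \<omega> (Suc t) - indicator A \<omega> * \<omega> t \<partial>Q)"
          by (intro Bochner_Integration.integral_cong) (auto simp: D_def max_def algebra_simps)
        also have "\<dots> = (\<integral>\<omega>. indicator A \<omega> * \<omega> (Suc t) \<partial>Q) - (\<integral>\<omega>. indicator A \<omega> * \<omega> t \<partial>Q)"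
          using integrable_mult_indicator[OF A i(1)] integrable_mult_indicator[OF A i(2)]
          by (intro Bochner_Integration.integral_diff) auto
        finally show "(\<integral>\<omega>\<in>A. \<omega> (Suc t) \<partial>Q) = (\<integral>\<omega>\<in>A. \<omega> t \<partial>Q)"
          by (simp add: set_lebesgue_integral_def)
      next
        have "(\<lambda>\<omega>. (restrict \<omega> {1..t}) t) \<in> borel_measurable (filt Q t)"
          using tT t by (intro measurable_filt) measurable
        then show "(\<lambda>\<omega>. \<omega> t) \<in> borel_measurable (filt Q t)"
          using t by simp
      qed (use i in auto)
    qed
  qed
  then show ?thesis
    using int by (auto simp: is_martingale_measure_def)
qed

end

end

section \<open>Homogeneous measures\<close>

lemma Cb_R2_iff: "Cb_R2 g \<longleftrightarrow> Cb (\<lambda>(x, y). g x y)"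
  by (simp add: Cb_R2_def Cb_def bounded_iff)

context
  fixes T :: nat and Q :: "(nat \<Rightarrow> real) measure"
  assumes Q: "sets Q = sets (RT T)" "prob_space Q"
begin

lemma measurable_two_coordinates:
  assumes "s \<in> {1..T}" "u \<in> {1..T}"
  shows "(\<lambda>\<omega>. (\<omega> s, \<omega> u)) \<in> Q \<rightarrow>\<^sub>M (borel \<Otimes>\<^sub>M borel)"
  using measurable_coordinate[OF Q assms(1)] measurable_coordinate[OF Q assms(2)] by measurable

lemma real_coupling_marg2:
  assumes "s \<in> {1..T}" "u \<in> {1..T}"
  shows "real_coupling (marg2 Q s u)"
  unfolding real_coupling_def real_coupling_axioms_def marg2_def
  using prob_space.prob_space_distr[OF Q(2) measurable_two_coordinates[OF assms]] by simp

lemma distr_fst_marg2: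
  assumes "s \<in> {1..T}" "u \<in> {1..T}"
  shows "distr (marg2 Q s u) borel fst = marg Q s"
  unfolding marg2_def marg_def
  by (subst distr_distr[OF _ measurable_two_coordinates[OF assms]]) (auto simp: comp_def)

lemma integral_density_marg2:
  assumes su: "s \<in> {1..T}" "u \<in> {1..T}" and \<phi>: "Cb \<phi>"
    and r: "r \<in> borel_measurable borel" "AE x in marg Q s. 0 \<le> r x"
  shows "(\<integral>z. \<phi> z \<partial>density (marg2 Q s u) (\<lambda>z. ennreal (r (fst z)))) = (\<integral>\<omega>. \<phi> (\<omega> s, \<omega> u) * r (\<omega> s) \<partial>Q)"
proof -
  note m = measurable_two_coordinates[OF su]
  have \<phi>m[measurable]: "\<phi> \<in> borel_measurable (borel \<Otimes>\<^sub>M borel)"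
    using Cb_borel_measurable[OF \<phi>] by (simp add: borel_prod)
  note [measurable] = r(1)
  have "AE z in marg2 Q s u. 0 \<le> r (fst z)"
    using r(2) unfolding distr_fst_marg2[OF su, symmetric] by (rule AE_distrD[rotated]) (simp add: marg2_def)
  then have "(\<integral>z. \<phi> z \<partial>density (marg2 Q s u) (\<lambda>z. ennreal (r (fst z)))) = (\<integral>z. r (fst z) * \<phi> z \<partial>marg2 Q s u)"
    by (subst integral_density) (auto simp: marg2_def)
  also have "\<dots> = (\<integral>\<omega>. \<phi> (\<omega> s, \<omega> u) * r (\<omega> s) \<partial>Q)"
    unfolding marg2_def by (subst integral_distr[OF m]) (auto simp: mult.commute)
  finally show ?thesis .
qed

lemma finite_density_marg2:
  assumes su: "s \<in> {1..T}" "u \<in> {1..T}" and [measurable]: "r \<in> borel_measurable borel"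
    and fin: "finite_measure (density (marg Q s) r)"
  shows "finite_measure (density (marg2 Q s u) (\<lambda>z. r (fst z)))"
proof (rule finite_measureI)
  have "emeasure (density (marg2 Q s u) (\<lambda>z. r (fst z))) (space (density (marg2 Q s u) (\<lambda>z. r (fst z))))
      = (\<integral>\<^sup>+z. r (fst z) \<partial>marg2 Q s u)"
    by (subst emeasure_density) (auto simp: marg2_def intro!: nn_integral_cong)
  also have "\<dots> = (\<integral>\<^sup>+x. r x \<partial>distr (marg2 Q s u) borel fst)"
    by (rule nn_integral_distr[symmetric]) (auto simp: marg2_def)
  also have "\<dots> = (\<integral>\<^sup>+x. r x \<partial>marg Q s)"
    by (simp only: distr_fst_marg2[OF su])
  also have "\<dots> = emeasure (density (marg Q s) r) (space (density (marg Q s) r))"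
    by (subst emeasure_density) (auto simp: marg_def intro!: nn_integral_cong)
  also have "\<dots> \<noteq> \<infinity>"
    using finite_measure.emeasure_finite[OF fin] by simp
  finally show "emeasure (density (marg2 Q s u) (\<lambda>z. r (fst z))) (space (density (marg2 Q s u) (\<lambda>z. r (fst z)))) \<noteq> \<infinity>" .
qed

end

section \<open>The marginals, the measures \<open>\<theta>\<close> and their continuous
  densities\<close>

locale homogeneous_transport =
  fixes T :: nat and \<mu> :: "nat \<Rightarrow> real measure" and \<theta> :: "nat \<Rightarrow> nat \<Rightarrow> real measure"
    and rs rt :: "nat \<Rightarrow> nat \<Rightarrow> real \<Rightarrow> real"
  assumes T2: "T \<ge> 2"
    and marginals: "\<forall>t\<in>{1..T}. prob_space (\<mu> t) \<and> sets (\<mu> t) = sets borel \<and> integrable (\<mu> t) (\<lambda>x. x)"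
    and assmA: "\<forall>s\<in>{1..T}. \<forall>t\<in>{1..T}.
       finite_measure (\<theta> s t) \<and> sets (\<theta> s t) = sets borel \<and>
       absolutely_continuous (abs_part (\<mu> t) (\<mu> s)) (\<theta> s t) \<and>
       absolutely_continuous (\<theta> s t) (abs_part (\<mu> t) (\<mu> s)) \<and>
       continuous_on UNIV (rt s t) \<and> bounded (range (rt s t)) \<and>
       (AE x in \<mu> t. RN_deriv (\<mu> t) (\<theta> s t) x = ennreal (rt s t x) \<and> 0 \<le> rt s t x) \<and>
       continuous_on UNIV (rs s t) \<and> bounded (range (rs s t)) \<and>
       (AE x in \<mu> s. RN_deriv (\<mu> s) (\<theta> s t) x = ennreal (rs s t x) \<and> 0 \<le> rs s t x)"
begin

lemma marginal:
  assumes "t \<in> {1..T}"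
  shows prob_space_marginal: "prob_space (\<mu> t)" and sets_marginal: "sets (\<mu> t) = sets borel"
    and integrable_marginal: "integrable (\<mu> t) (\<lambda>x. x)" and finite_measure_marginal: "finite_measure (\<mu> t)"
  using marginals assms by (auto simp: prob_space.finite_measure)

context
  fixes s t assumes s: "s \<in> {1..T}" and t: "t \<in> {1..T}"
begin

lemma sets_marginal_eq: "sets (\<mu> s) = sets (\<mu> t)"
  using sets_marginal s t by simp

lemma theta:
  shows finite_measure_theta: "finite_measure (\<theta> s t)" and sets_theta: "sets (\<theta> s t) = sets borel"
    and ac_theta: "absolutely_continuous (abs_part (\<mu> t) (\<mu> s)) (\<theta> s t)"
    and theta_ac: "absolutely_continuous (\<theta> s t) (abs_part (\<mu> t) (\<mu> s))"
    and Cb_rt: "Cb (rt s t)" and Cb_rs: "Cb (rs s t)"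
  using assmA s t by (auto simp: Cb_def bounded_iff)

lemma rt_nonneg: "AE x in \<mu> t. 0 \<le> rt s t x" and rs_nonneg: "AE x in \<mu> s. 0 \<le> rs s t x"
  using assmA s t by auto

text \<open>Absolute continuity of \<open>\<theta> s t\<close> with respect to
  \<open>\<mu> t\<close> passes through the absolutely continuous part of \<open>\<mu> t\<close>;
  Radon-Nikodym then recovers \<open>\<theta> s t\<close> from the chosen version of its
  derivative.\<close>

lemma density_rt: "density (\<mu> t) (\<lambda>x. ennreal (rt s t x)) = \<theta> s t"
proof -
  interpret prob_space "\<mu> t" by (rule prob_space_marginal[OF t])
  have ac: "absolutely_continuous (\<mu> t) (\<theta> s t)"
    using absolutely_continuous_abs_part_self[OF finite_measure_marginal[OF t] sets_marginal_eq] ac_theta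
    by (auto simp: absolutely_continuous_def)
  have "density (\<mu> t) (\<lambda>x. ennreal (rt s t x)) = density (\<mu> t) (RN_deriv (\<mu> t) (\<theta> s t))"
  proof (rule density_cong)
    show "AE x in \<mu> t. ennreal (rt s t x) = RN_deriv (\<mu> t) (\<theta> s t) x"
      using assmA s t by fastforce
    show "(\<lambda>x. ennreal (rt s t x)) \<in> borel_measurable (\<mu> t)"
      using Cb_borel_measurable[OF Cb_rt] by (simp add: measurable_cong_sets[OF sets_marginal[OF t] refl])
  qed auto
  also have "\<dots> = \<theta> s t"
    using sets_theta sets_marginal[OF t] by (intro density_RN_deriv[OF ac]) simp
  finally show ?thesis .
qed

lemma density_rs: "density (\<mu> s) (\<lambda>x. ennreal (rs s t x)) = \<theta> s t"
proof -
  interpret prob_space "\<mu> s" by (rule prob_space_marginal[OF s])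
  have ac: "absolutely_continuous (\<mu> s) (\<theta> s t)"
    using absolutely_continuous_abs_part[OF finite_measure_marginal[OF t] sets_marginal_eq] ac_theta
    by (auto simp: absolutely_continuous_def)
  have "density (\<mu> s) (\<lambda>x. ennreal (rs s t x)) = density (\<mu> s) (RN_deriv (\<mu> s) (\<theta> s t))"
  proof (rule density_cong)
    show "AE x in \<mu> s. ennreal (rs s t x) = RN_deriv (\<mu> s) (\<theta> s t) x"
      using assmA s t by fastforce
    show "(\<lambda>x. ennreal (rs s t x)) \<in> borel_measurable (\<mu> s)"
      using Cb_borel_measurable[OF Cb_rs] by (simp add: measurable_cong_sets[OF sets_marginal[OF s] refl])
  qed auto
  also have "\<dots> = \<theta> s t"
    using sets_theta sets_marginal[OF s] by (intro density_RN_deriv[OF ac]) simp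
  finally show ?thesis .
qed

text \<open>The roles of \<open>s\<close> and \<open>t\<close> are exchanged relative to the
  assumption on \<open>\<theta> s t\<close>, so that the null sets in \<open>homogeneous\<close>
  become those of \<open>\<theta> s t\<close>.\<close>

lemma AE_abs_part_iff_AE_theta: "(AE x in abs_part (\<mu> s) (\<mu> t). P x) \<longleftrightarrow> (AE x in \<theta> s t. P x)"
proof -
  note f = finite_measure_marginal[OF s] finite_measure_marginal[OF t]
  note e = sets_marginal_eq sets_marginal_eq[symmetric]
  have "absolutely_continuous (abs_part (\<mu> s) (\<mu> t)) (\<theta> s t)"
    using absolutely_continuous_abs_part_swap[OF f(2,1) e(1)] ac_theta
    by (auto simp: absolutely_continuous_def)
  moreover have "absolutely_continuous (\<theta> s t) (abs_part (\<mu> s) (\<mu> t))"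
    using absolutely_continuous_abs_part_swap[OF f e(2)] theta_ac
    by (auto simp: absolutely_continuous_def)
  ultimately show ?thesis
    using sets_abs_part[OF f(1) e(2)] sets_theta sets_marginal[OF s]
    by (metis absolutely_continuous_AE)
qed

end

text \<open>The right side consists of equations linear in \<open>Q\<close>, tested by bounded
  continuous functions. Read forwards it makes the \<open>g\<close>-terms of a hedge cancel under
  elements of \<open>Mhom\<close>; read backwards it makes the representing measure
  homogeneous.\<close>

lemma homogeneous_iff:
  assumes Q: "sets Q = sets (RT T)" "prob_space Q" and marg: "\<And>t. t \<in> {1..T} \<Longrightarrow> marg Q t = \<mu> t"
  shows "homogeneous T Q \<longleftrightarrow> (\<forall>(s, t, \<tau>)\<in>Delta T. \<forall>g. Cb_R2 g \<longrightarrow>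
    (\<integral>\<omega>. g (\<omega> s) (\<omega> (s + \<tau>)) * rs s t (\<omega> s) \<partial>Q) = (\<integral>\<omega>. g (\<omega> t) (\<omega> (t + \<tau>)) * rt s t (\<omega> t) \<partial>Q))"
proof -
  have "(\<forall>K1 K2. is_kernel_for Q s (s + \<tau>) K1 \<longrightarrow> is_kernel_for Q t (t + \<tau>) K2 \<longrightarrow>
        (AE x in abs_part (marg Q s) (marg Q t). K1 x = K2 x)) \<longleftrightarrow>
     (\<forall>g. Cb_R2 g \<longrightarrow> (\<integral>\<omega>. g (\<omega> s) (\<omega> (s + \<tau>)) * rs s t (\<omega> s) \<partial>Q) = (\<integral>\<omega>. g (\<omega> t) (\<omega> (t + \<tau>)) * rt s t (\<omega> t) \<partial>Q))"
    (is "?L \<longleftrightarrow> ?R")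
    if "(s, t, \<tau>) \<in> Delta T" for s t \<tau>
  proof -
    have st: "s \<in> {1..T}" "t \<in> {1..T}" "s + \<tau> \<in> {1..T}" "t + \<tau> \<in> {1..T}"
      using that by (auto simp: Delta_def)
    let ?P1 = "marg2 Q s (s + \<tau>)" and ?P2 = "marg2 Q t (t + \<tau>)"
    let ?r1 = "\<lambda>x. ennreal (rs s t x)" and ?r2 = "\<lambda>x. ennreal (rt s t x)"
    let ?D1 = "density ?P1 (\<lambda>z. ?r1 (fst z))" and ?D2 = "density ?P2 (\<lambda>z. ?r2 (fst z))"
    note r[measurable] = Cb_borel_measurable[OF Cb_rs[OF st(1,2)]] Cb_borel_measurable[OF Cb_rt[OF st(1,2)]]
    have dm: "distr ?P1 borel fst = \<mu> s" "distr ?P2 borel fst = \<mu> t"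
      using distr_fst_marg2[OF Q st(1,3)] distr_fst_marg2[OF Q st(2,4)] marg st by auto
    have "?L \<longleftrightarrow> (\<forall>K1 K2. K1 \<in> borel \<rightarrow>\<^sub>M prob_algebra borel \<longrightarrow> ?P1 = kernel_product (distr ?P1 borel fst) K1 \<longrightarrow>
            K2 \<in> borel \<rightarrow>\<^sub>M prob_algebra borel \<longrightarrow> ?P2 = kernel_product (distr ?P2 borel fst) K2 \<longrightarrow>
            (AE x in \<theta> s t. K1 x = K2 x))"
      unfolding is_kernel_for_def marg[OF st(1)] marg[OF st(2)] dm AE_abs_part_iff_AE_theta[OF st(1,2)]
        kernel_product_def by blast
    also have "\<dots> \<longleftrightarrow> ?D1 = ?D2"
      by (rule kernels_agree_iff_densities_agree[OF real_coupling_marg2[OF Q st(1,3)] real_coupling_marg2[OF Q st(2,4)]])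
        (simp_all add: dm density_rs[OF st(1,2)] density_rt[OF st(1,2)] finite_measure_theta[OF st(1,2)])
    also have "\<dots> \<longleftrightarrow> (\<forall>\<phi>. Cb \<phi> \<longrightarrow> (\<integral>z. \<phi> z \<partial>?D1) = (\<integral>z. \<phi> z \<partial>?D2))"
    proof
      assume eq: "\<forall>\<phi>. Cb \<phi> \<longrightarrow> (\<integral>z. \<phi> z \<partial>?D1) = (\<integral>z. \<phi> z \<partial>?D2)"
      show "?D1 = ?D2"
      proof (rule finite_measure_eqI_Cb)
        show "finite_measure ?D1"
          using finite_measure_theta[OF st(1,2)] marg st density_rs[OF st(1,2)]
          by (intro finite_density_marg2[OF Q st(1,3), where r = ?r1]) auto
        show "finite_measure ?D2"
          using finite_measure_theta[OF st(1,2)] marg st density_rt[OF st(1,2)]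
          by (intro finite_density_marg2[OF Q st(2,4), where r = ?r2]) auto
      qed (use eq in \<open>auto simp: marg2_def borel_prod\<close>)
    qed simp
    also have "\<dots> \<longleftrightarrow> (\<forall>\<phi>. Cb \<phi> \<longrightarrow> (\<integral>\<omega>. \<phi> (\<omega> s, \<omega> (s + \<tau>)) * rs s t (\<omega> s) \<partial>Q) = (\<integral>\<omega>. \<phi> (\<omega> t, \<omega> (t + \<tau>)) * rt s t (\<omega> t) \<partial>Q))"
      using integral_density_marg2[OF Q st(1,3) _ r(1) rs_nonneg[OF st(1,2), folded marg[OF st(1)]]]
        integral_density_marg2[OF Q st(2,4) _ r(2) rt_nonneg[OF st(1,2), folded marg[OF st(2)]]]
      by (intro all_cong) simp
    also have "\<dots> \<longleftrightarrow> ?R"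
    proof safe
      fix g assume "Cb_R2 g" and eq: "\<forall>\<phi>. Cb \<phi> \<longrightarrow> (\<integral>\<omega>. \<phi> (\<omega> s, \<omega> (s + \<tau>)) * rs s t (\<omega> s) \<partial>Q) = (\<integral>\<omega>. \<phi> (\<omega> t, \<omega> (t + \<tau>)) * rt s t (\<omega> t) \<partial>Q)"
      then show "(\<integral>\<omega>. g (\<omega> s) (\<omega> (s + \<tau>)) * rs s t (\<omega> s) \<partial>Q) = (\<integral>\<omega>. g (\<omega> t) (\<omega> (t + \<tau>)) * rt s t (\<omega> t) \<partial>Q)"
        using spec[OF eq, of "\<lambda>(x, y). g x y"] by (simp add: Cb_R2_iff)
    next
      fix \<phi> :: "real \<times> real \<Rightarrow> real" assume "Cb \<phi>" and R: ?R
      then show "(\<integral>\<omega>. \<phi> (\<omega> s, \<omega> (s + \<tau>)) * rs s t (\<omega> s) \<partial>Q) = (\<integral>\<omega>. \<phi> (\<omega> t, \<omega> (t + \<tau>)) * rt s t (\<omega> t) \<partial>Q)"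
        using spec[OF R, of "\<lambda>x y. \<phi> (x, y)"] by (simp add: Cb_R2_iff)
    qed
    finally show ?thesis .
  qed
  then show ?thesis
    unfolding homogeneous_def by fast
qed

end

section \<open>Weak duality\<close>

lemma Clin_R_add: "Clin_R h \<Longrightarrow> Clin_R k \<Longrightarrow> Clin_R (\<lambda>x. h x + k x)"
proof -
  assume "Clin_R h" "Clin_R k"
  then obtain C D where c: "continuous_on UNIV h" "continuous_on UNIV k"
    and C: "\<And>x. \<bar>h x\<bar> \<le> C * (1 + \<bar>x\<bar>)" and D: "\<And>x. \<bar>k x\<bar> \<le> D * (1 + \<bar>x\<bar>)"
    by (auto simp: Clin_R_def)
  have "\<bar>h x + k x\<bar> \<le> (C + D) * (1 + \<bar>x\<bar>)" for x
    using C[of x] D[of x] by (simp add: distrib_right)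
  then show ?thesis
    using c by (auto simp: Clin_R_def intro!: continuous_intros)
qed

lemma Clin_R_scale: "Clin_R h \<Longrightarrow> Clin_R (\<lambda>x. c * h x)"
proof -
  assume "Clin_R h"
  then obtain C where h: "continuous_on UNIV h" and C: "\<And>x. \<bar>h x\<bar> \<le> C * (1 + \<bar>x\<bar>)"
    by (auto simp: Clin_R_def)
  have "\<bar>c * h x\<bar> \<le> (\<bar>c\<bar> * C) * (1 + \<bar>x\<bar>)" for x
    using mult_left_mono[OF C[of x], of "\<bar>c\<bar>"] by (simp add: abs_mult mult.assoc)
  then show ?thesis
    using h by (auto simp: Clin_R_def intro!: continuous_intros exI[of _ "\<bar>c\<bar> * C"])
qed

lemma Cb_imp_Clin_R: "Cb h \<Longrightarrow> Clin_R h"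
proof -
  assume "Cb h"
  then obtain B where h: "continuous_on UNIV h" and B: "\<And>x. \<bar>h x\<bar> \<le> B"
    by (auto simp: Cb_def)
  have "\<bar>h x\<bar> \<le> \<bar>B\<bar> * (1 + \<bar>x\<bar>)" for x
  proof -
    have "0 \<le> \<bar>B\<bar> * \<bar>x\<bar>" by simp
    then have "\<bar>h x\<bar> \<le> \<bar>B\<bar> + \<bar>B\<bar> * \<bar>x\<bar>"
      using B[of x] by linarith
    then show ?thesis by (simp add: distrib_left)
  qed
  then show ?thesis
    using h by (auto simp: Clin_R_def)
qed

lemma Cb_Rt_add: "Cb_Rt t v \<Longrightarrow> Cb_Rt t w \<Longrightarrow> Cb_Rt t (\<lambda>x. v x + w x)"
  by (auto simp: Cb_Rt_def intro!: continuous_intros bounded_plus_comp)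

lemma Cb_Rt_scale: "Cb_Rt t v \<Longrightarrow> Cb_Rt t (\<lambda>x. c * v x)"
  using bounded_scaling[of "v ` RT_space t" c]
  by (auto simp: Cb_Rt_def image_image intro!: continuous_intros)

lemma Cb_R2_add: "Cb_R2 g \<Longrightarrow> Cb_R2 k \<Longrightarrow> Cb_R2 (\<lambda>x y. g x y + k x y)"
  unfolding Cb_R2_iff using Cb_add[of "\<lambda>(x, y). g x y" "\<lambda>(x, y). k x y"] by (simp add: split_beta')

lemma Cb_R2_scale: "Cb_R2 g \<Longrightarrow> Cb_R2 (\<lambda>x y. c * g x y)"
  unfolding Cb_R2_iff using Cb_mult[OF Cb_const[of c], of "\<lambda>(x, y). g x y"] by (simp add: split_beta')

lemma Cb_R2_compose:
  fixes a b :: "'a::topological_space \<Rightarrow> real"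
  assumes "Cb_R2 g" "continuous_on S a" "continuous_on S b"
  shows "continuous_on S (\<lambda>x. g (a x) (b x))"
proof -
  have "continuous_on UNIV (\<lambda>z. g (fst z) (snd z))"
    using assms(1) by (simp add: Cb_R2_def split_beta')
  from continuous_on_compose2[OF this continuous_on_Pair[OF assms(2,3)]] show ?thesis by simp
qed

lemma finite_Delta: "finite (Delta T)"
  by (rule finite_subset[of _ "{1..T} \<times> {1..T} \<times> {1..T}"]) (auto simp: Delta_def)

lemma continuous_on_coordinate: "continuous_on S (\<lambda>x::nat \<Rightarrow> real. x i)"
  by (rule continuous_on_subset[OF continuous_on_product_coordinates]) simp

text \<open>Points of \<open>RT_space T\<close> have the value \<open>undefined\<close> outside
  \<open>{1..T}\<close>, so the box is a product of compact intervals and singletons over all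
  indices, and Tychonoff's theorem applies.\<close>

lemma compact_box: "compact {x \<in> RT_space T. \<forall>t\<in>{1..T}. \<bar>x t\<bar> \<le> r}"
proof -
  let ?K = "\<lambda>i. if i \<in> {1..T} then {- r..r} else {undefined}"
  have "{x \<in> RT_space T. \<forall>t\<in>{1..T}. \<bar>x t\<bar> \<le> r} = PiE UNIV ?K"
  proof (rule set_eqI)
    fix x :: "nat \<Rightarrow> real"
    have "\<bar>y\<bar> \<le> r \<longleftrightarrow> y \<in> {- r..r}" for y
      by auto
    then have "x \<in> {x \<in> RT_space T. \<forall>t\<in>{1..T}. \<bar>x t\<bar> \<le> r} \<longleftrightarrow> (\<forall>i. x i \<in> ?K i)"
      unfolding mem_Collect_eq PiE_iff extensional_def by (simp only: ball_simps split: if_splits) blast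
    then show "x \<in> {x \<in> RT_space T. \<forall>t\<in>{1..T}. \<bar>x t\<bar> \<le> r} \<longleftrightarrow> x \<in> PiE UNIV ?K"
      by (simp only: PiE_iff) simp
  qed
  moreover have "compactin (product_topology (\<lambda>i. euclidean) UNIV) (PiE UNIV ?K)"
    unfolding compactin_PiE by auto
  ultimately show ?thesis
    by (simp add: euclidean_product_topology)
qed

section \<open>Hedges, their costs and their expectations\<close>

context homogeneous_transport
begin

text \<open>The summand 1 makes division possible. A sum of moduli, rather than a norm, is separable
  in the coordinates and so can be dominated by static hedges.\<close>

definition weight :: "(nat \<Rightarrow> real) \<Rightarrow> real" where
  "weight x = 1 + (\<Sum>t=1..T. \<bar>x t\<bar>)"

definition admissible where
  "admissible h v g \<longleftrightarrow> (\<forall>t\<in>{1..T}. Clin_R (h t)) \<and> (\<forall>t\<in>{1..<T}. Cb_Rt t (v t)) \<and>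
     (\<forall>(s, t, \<tau>)\<in>Delta T. Cb_R2 (g s t \<tau>))"

text \<open>The right side of the dual constraint is isolated because it is linear in
  \<open>(h, v, g)\<close>: sums and real multiples of hedges, negative ones included, are
  hedges.\<close>

definition hedge :: "(nat \<Rightarrow> real \<Rightarrow> real) \<Rightarrow> (nat \<Rightarrow> (nat \<Rightarrow> real) \<Rightarrow> real) \<Rightarrow>
    (nat \<Rightarrow> nat \<Rightarrow> nat \<Rightarrow> real \<Rightarrow> real \<Rightarrow> real) \<Rightarrow> (nat \<Rightarrow> real) \<Rightarrow> real" where
  "hedge h v g x = (\<Sum>t=1..T. h t (x t))
     + (\<Sum>t=1..<T. v t (restrict x {1..t}) * (x (Suc t) - x t))
     + (\<Sum>(s, t, \<tau>)\<in>Delta T. g s t \<tau> (x s) (x (s + \<tau>)) * rs s t (x s)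
                           - g s t \<tau> (x t) (x (t + \<tau>)) * rt s t (x t))"

definition cost :: "(nat \<Rightarrow> real \<Rightarrow> real) \<Rightarrow> real" where
  "cost h = (\<Sum>t=1..T. \<integral>x. h t x \<partial>\<mu> t)"

lemma dual_feasible_iff:
  "(h, v, g) \<in> dual_feasible T F rs rt \<longleftrightarrow> admissible h v g \<and> (\<forall>x\<in>RT_space T. F x \<le> hedge h v g x)"
  by (auto simp: dual_feasible_def admissible_def hedge_def)

lemma weight_ge_1: "1 \<le> weight x"
  by (simp add: weight_def sum_nonneg)

lemma weight_pos: "0 < weight x" and weight_nonzero: "weight x \<noteq> 0"
  using weight_ge_1[of x] by auto

lemma weight_restrict: "weight (restrict x {1..T}) = weight x"
  by (simp add: weight_def)

lemma continuous_on_weight: "continuous_on S weight"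
  unfolding weight_def[abs_def] by (intro continuous_intros continuous_on_coordinate)

lemma abs_le_weight: "t \<in> {1..T} \<Longrightarrow> \<bar>x t\<bar> \<le> weight x"
  using member_le_sum[of t "{1..T}" "\<lambda>t. \<bar>x t\<bar>"] by (auto simp: weight_def)

lemma weight_le_sum: "weight x \<le> (\<Sum>t=1..T. 1 + \<bar>x t\<bar>)"
  using T2 by (simp add: weight_def sum.distrib)

lemma hedge_add:
  "hedge (\<lambda>t x. h t x + h' t x) (\<lambda>t x. v t x + v' t x) (\<lambda>s t \<tau> x y. g s t \<tau> x y + g' s t \<tau> x y) x
     = hedge h v g x + hedge h' v' g' x"
  by (simp add: hedge_def sum.distrib sum_subtractf split_beta distrib_right)

lemma hedge_scale:
  "hedge (\<lambda>t x. c * h t x) (\<lambda>t x. c * v t x) (\<lambda>s t \<tau> x y. c * g s t \<tau> x y) x = c * hedge h v g x"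
  by (simp add: hedge_def sum_distrib_left split_beta distrib_left right_diff_distrib mult.assoc)

lemma hedge_static: "hedge h (\<lambda>_ _. 0) (\<lambda>_ _ _ _ _. 0) x = (\<Sum>t=1..T. h t (x t))"
  by (simp add: hedge_def)

lemma admissible_add:
  assumes a: "admissible h v g" "admissible h' v' g'"
  shows "admissible (\<lambda>t x. h t x + h' t x) (\<lambda>t x. v t x + v' t x) (\<lambda>s t \<tau> x y. g s t \<tau> x y + g' s t \<tau> x y)"
  unfolding admissible_def
proof (intro conjI ballI)
  show "Clin_R (\<lambda>x. h t x + h' t x)" if "t \<in> {1..T}" for t
    using a that by (intro Clin_R_add) (auto simp: admissible_def)
  show "Cb_Rt t (\<lambda>x. v t x + v' t x)" if "t \<in> {1..<T}" for t
    using a that by (intro Cb_Rt_add) (auto simp: admissible_def)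
  show "case d of (s, t, \<tau>) \<Rightarrow> Cb_R2 (\<lambda>x y. g s t \<tau> x y + g' s t \<tau> x y)" if "d \<in> Delta T" for d
    using a that by (cases d) (auto simp: admissible_def intro!: Cb_R2_add)
qed

lemma admissible_scale:
  assumes a: "admissible h v g"
  shows "admissible (\<lambda>t x. c * h t x) (\<lambda>t x. c * v t x) (\<lambda>s t \<tau> x y. c * g s t \<tau> x y)"
  unfolding admissible_def
proof (intro conjI ballI)
  show "Clin_R (\<lambda>x. c * h t x)" if "t \<in> {1..T}" for t
    using a that by (intro Clin_R_scale) (auto simp: admissible_def)
  show "Cb_Rt t (\<lambda>x. c * v t x)" if "t \<in> {1..<T}" for t
    using a that by (intro Cb_Rt_scale) (auto simp: admissible_def)
  show "case d of (s, t, \<tau>) \<Rightarrow> Cb_R2 (\<lambda>x y. c * g s t \<tau> x y)" if "d \<in> Delta T" for d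
    using a that by (cases d) (auto simp: admissible_def intro!: Cb_R2_scale)
qed

lemma admissible_static:
  "(\<And>t. t \<in> {1..T} \<Longrightarrow> Clin_R (h t)) \<Longrightarrow> admissible h (\<lambda>_ _. 0) (\<lambda>_ _ _ _ _. 0)"
  using Cb_const[of 0]
  by (auto simp: admissible_def Cb_R2_iff split_beta' intro!: Cb_imp_Cb_Rt)

lemma integrable_Clin_R:
  assumes "Clin_R h" "t \<in> {1..T}"
  shows "integrable (\<mu> t) h"
proof -
  interpret prob_space "\<mu> t" by (rule prob_space_marginal[OF assms(2)])
  obtain C where h: "continuous_on UNIV h" and C: "\<And>x. \<bar>h x\<bar> \<le> C * (1 + \<bar>x\<bar>)"
    using assms(1) by (auto simp: Clin_R_def)
  show ?thesis
  proof (rule Bochner_Integration.integrable_bound[where f = "\<lambda>x. C * (1 + \<bar>x\<bar>)"])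
    show "integrable (\<mu> t) (\<lambda>x. C * (1 + \<bar>x\<bar>))"
      using integrable_marginal[OF assms(2)] by auto
    show "h \<in> borel_measurable (\<mu> t)"
      using borel_measurable_continuous_onI[OF h] by (simp add: measurable_cong_sets[OF sets_marginal[OF assms(2)] refl])
    show "AE x in \<mu> t. norm (h x) \<le> norm (C * (1 + \<bar>x\<bar>))"
      using C by (intro AE_I2) (simp, meson abs_ge_self order_trans)
  qed
qed

lemma cost_add:
  "admissible h v g \<Longrightarrow> admissible h' v' g' \<Longrightarrow> cost (\<lambda>t x. h t x + h' t x) = cost h + cost h'"
  unfolding cost_def sum.distrib[symmetric]
  by (intro sum.cong refl Bochner_Integration.integral_add integrable_Clin_R) (auto simp: admissible_def)

lemma cost_scale: "cost (\<lambda>t x. c * h t x) = c * cost h"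
  by (simp add: cost_def sum_distrib_left)

lemma Mhom_props:
  assumes "Q \<in> Mhom T \<mu>"
  shows Mhom_sets: "sets Q = sets (RT T)" and Mhom_prob_space: "prob_space Q"
    and Mhom_marg: "\<And>t. t \<in> {1..T} \<Longrightarrow> marg Q t = \<mu> t"
    and Mhom_martingale: "is_martingale_measure T Q" and Mhom_homogeneous: "homogeneous T Q"
  using assms by (auto simp: Mhom_def)

context
  fixes Q assumes Q: "sets Q = sets (RT T)" "prob_space Q" and marg: "\<And>t. t \<in> {1..T} \<Longrightarrow> marg Q t = \<mu> t"
begin

lemma integral_marginal:
  assumes "Clin_R h" "t \<in> {1..T}"
  shows "integrable Q (\<lambda>\<omega>. h (\<omega> t))" "(\<integral>\<omega>. h (\<omega> t) \<partial>Q) = (\<integral>x. h x \<partial>\<mu> t)"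
proof -
  have h: "h \<in> borel_measurable borel"
    using assms(1) by (auto simp: Clin_R_def intro: borel_measurable_continuous_onI)
  note m = measurable_coordinate[OF Q assms(2)]
  show "integrable Q (\<lambda>\<omega>. h (\<omega> t))"
    using integrable_Clin_R[OF assms] integrable_distr_eq[OF m h]
    by (simp add: marg[OF assms(2), symmetric] marg_def)
  show "(\<integral>\<omega>. h (\<omega> t) \<partial>Q) = (\<integral>x. h x \<partial>\<mu> t)"
    using integral_distr[OF m h] by (simp add: marg[OF assms(2), symmetric] marg_def)
qed

lemma integrable_coordinate: "t \<in> {1..T} \<Longrightarrow> integrable Q (\<lambda>\<omega>. \<omega> t)"
  by (rule integral_marginal(1)[where h = "\<lambda>x. x"]) (auto simp: Clin_R_def intro!: exI[of _ 1])

lemma integrable_linear_growth: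
  assumes F: "continuous_on (RT_space T) F" "\<And>x. x \<in> RT_space T \<Longrightarrow> \<bar>F x\<bar> \<le> C * weight x"
  shows "integrable Q F"
proof (rule Bochner_Integration.integrable_bound[where f = "\<lambda>x. C * weight x"])
  interpret prob_space Q by (rule Q)
  show "integrable Q (\<lambda>x. C * weight x)"
    unfolding weight_def using integrable_coordinate
    by (intro integrable_mult_right Bochner_Integration.integrable_add integrable_const
        Bochner_Integration.integrable_sum integrable_abs)
  show "F \<in> borel_measurable Q"
    by (rule measurable_Q[OF Q borel_measurable_RT_continuous[OF F(1)]])
  show "AE x in Q. norm (F x) \<le> norm (C * weight x)"
    using F(2) by (intro AE_I2) (simp add: space_Q[OF Q], meson abs_ge_self order_trans)
qed

lemma integrable_homogeneity_term:
  assumes "Cb_R2 g" "Cb r" "s \<in> {1..T}" "u \<in> {1..T}"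
  shows "integrable Q (\<lambda>\<omega>. g (\<omega> s) (\<omega> u) * r (\<omega> s))"
proof -
  interpret prob_space Q by (rule Q)
  have "Cb (\<lambda>z. g (fst z) (snd z))"
    using assms(1) by (simp add: Cb_R2_iff split_beta')
  then obtain A B where A: "\<And>x y. \<bar>g x y\<bar> \<le> A" and B: "\<And>x. \<bar>r x\<bar> \<le> B"
    using assms(2) by (fastforce simp: Cb_def)
  have r: "continuous_on (RT_space T) (\<lambda>\<omega>. r (\<omega> s))"
    using assms(2) by (intro continuous_on_compose2[OF _ continuous_on_coordinate]) (auto simp: Cb_def)
  show ?thesis
  proof (rule integrable_const_bound[where B = "A * B"])
    show "(\<lambda>\<omega>. g (\<omega> s) (\<omega> u) * r (\<omega> s)) \<in> borel_measurable Q"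
      by (intro measurable_Q[OF Q] borel_measurable_RT_continuous continuous_on_mult r
          Cb_R2_compose[OF assms(1)] continuous_on_coordinate)
    show "AE \<omega> in Q. norm (g (\<omega> s) (\<omega> u) * r (\<omega> s)) \<le> A * B"
      using A B by (intro AE_I2) (auto simp: abs_mult intro!: mult_mono order_trans[OF abs_ge_zero A])
  qed
qed

end

text \<open>The trading terms have expectation zero by the martingale property and the
  \<open>g\<close>-terms by homogeneity in its integral form; what remains depends on the marginals
  alone.\<close>

lemma integral_hedge:
  assumes Q: "Q \<in> Mhom T \<mu>" and adm: "admissible h v g"
  shows "integrable Q (hedge h v g)" "(\<integral>\<omega>. hedge h v g \<omega> \<partial>Q) = cost h"
proof -
  note q = Mhom_sets[OF Q] Mhom_prob_space[OF Q]
  note m = Mhom_marg[OF Q]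
  have h: "integrable Q (\<lambda>\<omega>. h t (\<omega> t))" "(\<integral>\<omega>. h t (\<omega> t) \<partial>Q) = (\<integral>x. h t x \<partial>\<mu> t)" if "t \<in> {1..T}" for t
    using integral_marginal[OF q m _ that] adm that by (auto simp: admissible_def)
  have v: "integrable Q (\<lambda>\<omega>. v t (restrict \<omega> {1..t}) * (\<omega> (Suc t) - \<omega> t))"
    "(\<integral>\<omega>. v t (restrict \<omega> {1..t}) * (\<omega> (Suc t) - \<omega> t) \<partial>Q) = 0" if t: "t \<in> {1..<T}" for t
  proof -
    have vt: "Cb_Rt t (v t)" using adm t by (auto simp: admissible_def)
    show "integrable Q (\<lambda>\<omega>. v t (restrict \<omega> {1..t}) * (\<omega> (Suc t) - \<omega> t))"
      using t integrable_coordinate[OF q m]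
      by (intro integrable_bounded_mult[OF q _ vt]) auto
    show "(\<integral>\<omega>. v t (restrict \<omega> {1..t}) * (\<omega> (Suc t) - \<omega> t) \<partial>Q) = 0"
      using martingale_iff[OF q integrable_coordinate[OF q m]] Mhom_martingale[OF Q] t vt by auto
  qed
  let ?g = "\<lambda>(s, t, \<tau>) \<omega>. g s t \<tau> (\<omega> s) (\<omega> (s + \<tau>)) * rs s t (\<omega> s) - g s t \<tau> (\<omega> t) (\<omega> (t + \<tau>)) * rt s t (\<omega> t)"
  have g: "integrable Q (?g d) \<and> (\<integral>\<omega>. ?g d \<omega> \<partial>Q) = 0" if d: "d \<in> Delta T" for d
  proof -
    obtain s t \<tau> where d': "d = (s, t, \<tau>)" by (cases d)
    have st: "s \<in> {1..T}" "t \<in> {1..T}" "s + \<tau> \<in> {1..T}" "t + \<tau> \<in> {1..T}"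
      using d d' by (auto simp: Delta_def)
    have gc: "Cb_R2 (g s t \<tau>)" using adm d d' by (auto simp: admissible_def)
    note i = integrable_homogeneity_term[OF q m gc Cb_rs[OF st(1,2)] st(1,3)]
      integrable_homogeneity_term[OF q m gc Cb_rt[OF st(1,2)] st(2,4)]
    have "(\<integral>\<omega>. g s t \<tau> (\<omega> s) (\<omega> (s + \<tau>)) * rs s t (\<omega> s) \<partial>Q) = (\<integral>\<omega>. g s t \<tau> (\<omega> t) (\<omega> (t + \<tau>)) * rt s t (\<omega> t) \<partial>Q)"
      using homogeneous_iff[OF q m] Mhom_homogeneous[OF Q] d d' gc by fast
    with i show ?thesis by (simp add: d')
  qed
  have eq: "hedge h v g = (\<lambda>\<omega>. (\<Sum>t=1..T. h t (\<omega> t)) + (\<Sum>t=1..<T. v t (restrict \<omega> {1..t}) * (\<omega> (Suc t) - \<omega> t))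
      + (\<Sum>d\<in>Delta T. ?g d \<omega>))"
    by (auto simp: hedge_def split_beta)
  have I: "integrable Q (\<lambda>\<omega>. \<Sum>t=1..T. h t (\<omega> t))"
    "integrable Q (\<lambda>\<omega>. \<Sum>t=1..<T. v t (restrict \<omega> {1..t}) * (\<omega> (Suc t) - \<omega> t))"
    "integrable Q (\<lambda>\<omega>. \<Sum>d\<in>Delta T. ?g d \<omega>)"
    by (rule Bochner_Integration.integrable_sum, erule h(1))
      (rule Bochner_Integration.integrable_sum, erule v(1),
       rule Bochner_Integration.integrable_sum, erule conjunct1[OF g])
  show "integrable Q (hedge h v g)"
    unfolding eq using I by (intro Bochner_Integration.integrable_add)
  have "(\<integral>\<omega>. (\<Sum>t=1..T. h t (\<omega> t)) \<partial>Q) = cost h"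
    using h by (subst Bochner_Integration.integral_sum) (auto simp: cost_def)
  moreover have "(\<integral>\<omega>. (\<Sum>t=1..<T. v t (restrict \<omega> {1..t}) * (\<omega> (Suc t) - \<omega> t)) \<partial>Q) = 0"
    using v by (subst Bochner_Integration.integral_sum) auto
  moreover have "(\<integral>\<omega>. (\<Sum>d\<in>Delta T. ?g d \<omega>) \<partial>Q) = 0"
    using g by (subst Bochner_Integration.integral_sum) auto
  ultimately show "(\<integral>\<omega>. hedge h v g \<omega> \<partial>Q) = cost h"
    unfolding eq using I by simp
qed

lemma weak_duality:
  assumes "Q \<in> Mhom T \<mu>" "admissible h v g" "integrable Q F" "\<And>x. x \<in> RT_space T \<Longrightarrow> F x \<le> hedge h v g x"
  shows "(\<integral>\<omega>. F \<omega> \<partial>Q) \<le> cost h"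
  unfolding integral_hedge(2)[OF assms(1,2), symmetric]
  using assms integral_hedge(1)[OF assms(1,2)]
  by (intro integral_mono) (auto simp: space_Q[OF Mhom_sets Mhom_prob_space])

end

section \<open>The dual value as a sublinear functional\<close>

lemma Cb_iff_bcontfun: "Cb f \<longleftrightarrow> f \<in> bcontfun"
  by (simp add: Cb_def bcontfun_def bounded_iff)

lemma apply_Bcontfun: "Cb f \<Longrightarrow> apply_bcontfun (Bcontfun f) = f"
  by (simp add: Cb_iff_bcontfun Bcontfun_inverse)

lemma Cb_apply_bcontfun: "Cb (apply_bcontfun \<phi>)"
  using apply_bcontfun by (simp add: Cb_iff_bcontfun)

lemma Bcontfun_add: "Cb f \<Longrightarrow> Cb g \<Longrightarrow> Bcontfun (\<lambda>x. f x + g x) = Bcontfun f + Bcontfun g"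
  by (rule bcontfun_eqI) (simp add: apply_Bcontfun Cb_add plus_bcontfun.rep_eq)

lemma Bcontfun_scale: "Cb f \<Longrightarrow> Bcontfun (\<lambda>x. c * f x) = c *\<^sub>R Bcontfun f"
  by (rule bcontfun_eqI) (simp add: apply_Bcontfun Cb_mult Cb_const scaleR_bcontfun.rep_eq)

context homogeneous_transport
begin

text \<open>The ramp between \<open>m\<close> and \<open>m + 1\<close> replaces an indicator and
  keeps the function continuous, hence a legitimate \<open>h\<close>. The factor \<open>T\<close>
  lets the largest coordinate alone pay for the whole weight.\<close>

definition tail :: "nat \<Rightarrow> real \<Rightarrow> real" where
  "tail m x = (1 + real T * \<bar>x\<bar>) * min 1 (max 0 (\<bar>x\<bar> - real m))"

lemma tail_nonneg: "0 \<le> tail m x"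
  by (simp add: tail_def)

lemma tail_le: "tail m x \<le> 1 + real T * \<bar>x\<bar>"
  unfolding tail_def by (intro mult_left_le) auto

lemma Clin_R_tail: "Clin_R (tail m)"
proof -
  have "\<bar>tail m x\<bar> \<le> (1 + real T) * (1 + \<bar>x\<bar>)" for x
    using tail_nonneg[of m x] tail_le[of m x] by (simp add: algebra_simps)
  then show ?thesis
    unfolding Clin_R_def tail_def[abs_def] by (auto intro!: continuous_intros)
qed

text \<open>Dominated convergence under each marginal, with a majorant integrable by the first
  moment; at every fixed \<open>x\<close> the tail is zero from some \<open>m\<close> on.\<close>

lemma cost_tail: "(\<lambda>m. cost (\<lambda>_. tail m)) \<longlonglongrightarrow> 0"
proof -
  have "(\<lambda>m. \<integral>x. tail m x \<partial>\<mu> t) \<longlonglongrightarrow> (\<integral>x. 0 \<partial>\<mu> t)" if t: "t \<in> {1..T}" for t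
  proof (rule integral_dominated_convergence[where w = "\<lambda>x. 1 + real T * \<bar>x\<bar>"])
    interpret prob_space "\<mu> t" by (rule prob_space_marginal[OF t])
    show "integrable (\<mu> t) (\<lambda>x. 1 + real T * \<bar>x\<bar>)"
      using integrable_marginal[OF t] by auto
    show "tail m \<in> borel_measurable (\<mu> t)" for m
      using integrable_Clin_R[OF Clin_R_tail t] by auto
    show "AE x in \<mu> t. norm (tail m x) \<le> 1 + real T * \<bar>x\<bar>" for m
      using tail_nonneg tail_le by (intro AE_I2) simp
    have "(\<lambda>m. tail m x) \<longlonglongrightarrow> 0" for x
    proof (rule tendsto_eventually)
      obtain n where "\<bar>x\<bar> \<le> real n" using real_arch_simple by blast
      then show "eventually (\<lambda>m. tail m x = 0) sequentially"
        by (intro eventually_sequentiallyI[of n]) (auto simp: tail_def max_def)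
    qed
    then show "AE x in \<mu> t. (\<lambda>m. tail m x) \<longlonglongrightarrow> 0" by simp
  qed simp
  then have "(\<lambda>m. cost (\<lambda>_. tail m)) \<longlonglongrightarrow> (\<Sum>t=1..T. \<integral>x. 0 \<partial>\<mu> t)"
    unfolding cost_def by (intro tendsto_sum)
  then show ?thesis by simp
qed

text \<open>At the coordinate of largest modulus one has \<open>weight x \<le> 1 + T * \<bar>x t\<bar>\<close>.\<close>

lemma weight_le_tail:
  assumes t: "t \<in> {1..T}" "real m + 1 < \<bar>x t\<bar>"
  shows "weight x \<le> (\<Sum>t=1..T. tail m (x t))"
proof -
  have "Max ((\<lambda>t. \<bar>x t\<bar>) ` {1..T}) \<in> (\<lambda>t. \<bar>x t\<bar>) ` {1..T}"
    using t by (intro Max_in) auto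
  then obtain j where j: "j \<in> {1..T}" "\<bar>x j\<bar> = Max ((\<lambda>t. \<bar>x t\<bar>) ` {1..T})"
    by auto
  have max: "\<bar>x i\<bar> \<le> \<bar>x j\<bar>" if "i \<in> {1..T}" for i
    unfolding j(2) using that by (intro Max_ge) auto
  have "(\<Sum>t=1..T. \<bar>x t\<bar>) \<le> (\<Sum>t=1..T. \<bar>x j\<bar>)"
    using max by (intro sum_mono) auto
  then have "weight x \<le> 1 + real T * \<bar>x j\<bar>"
    by (simp add: weight_def)
  also have "\<dots> = tail m (x j)"
    using max[OF t(1)] t(2) by (simp add: tail_def)
  also have "\<dots> \<le> (\<Sum>t=1..T. tail m (x t))"
    using j(1) tail_nonneg by (intro member_le_sum) auto
  finally show ?thesis .
qed

text \<open>The argument has the type of bounded continuous functions because Hahn-Banach needs a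
  real vector space. Domination is required on \<open>RT_space T\<close> only, so the behaviour of
  \<open>\<phi>\<close> elsewhere does not influence the value.\<close>

definition price :: "((nat \<Rightarrow> real) \<Rightarrow>\<^sub>C real) \<Rightarrow> real" where
  "price \<phi> = (INF (h, v, g)\<in>dual_feasible T (\<lambda>x. \<phi> x * weight x) rs rt. cost h)"

text \<open>A static hedge with multiples of \<open>1 + \<bar>x\<bar>\<close> dominates every payoff
  of linear growth.\<close>

lemma ex_dual_feasible:
  assumes "\<And>x. x \<in> RT_space T \<Longrightarrow> \<bar>F x\<bar> \<le> C * weight x"
  shows "\<exists>h v g. (h, v, g) \<in> dual_feasible T F rs rt"
proof -
  have "F x \<le> (\<Sum>t=1..T. \<bar>C\<bar> * (1 + \<bar>x t\<bar>))" if "x \<in> RT_space T" for x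
  proof -
    have "F x \<le> C * weight x" using assms[OF that] by simp
    also have "\<dots> \<le> \<bar>C\<bar> * weight x"
      using weight_pos[of x] by (intro mult_right_mono) auto
    also have "\<dots> \<le> \<bar>C\<bar> * (\<Sum>t=1..T. 1 + \<bar>x t\<bar>)"
      by (intro mult_left_mono weight_le_sum) auto
    finally show ?thesis by (simp add: sum_distrib_left)
  qed
  moreover have "admissible (\<lambda>_ x. \<bar>C\<bar> * (1 + \<bar>x\<bar>)) (\<lambda>_ _. 0) (\<lambda>_ _ _ _ _. 0)"
    by (intro admissible_static) (auto simp: Clin_R_def abs_mult intro!: continuous_intros exI[of _ "\<bar>C\<bar>"])
  ultimately have "(\<lambda>_ x. \<bar>C\<bar> * (1 + \<bar>x\<bar>), \<lambda>_ _. 0, \<lambda>_ _ _ _ _. 0) \<in> dual_feasible T F rs rt"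
    by (simp add: dual_feasible_iff hedge_static)
  then show ?thesis by blast
qed

text \<open>Restriction extends \<open>F\<close> continuously from \<open>RT_space T\<close> to all
  of \<open>nat \<Rightarrow> real\<close>, the metric space on which the Daniell functional
  lives.\<close>

lemma Cb_quotient:
  assumes F: "continuous_on (RT_space T) F" "\<And>x. x \<in> RT_space T \<Longrightarrow> \<bar>F x\<bar> \<le> C * weight x"
  shows "Cb (\<lambda>x. F (restrict x {1..T}) / weight x)"
proof -
  have "\<bar>F (restrict x {1..T}) / weight x\<bar> \<le> C" for x
    using F(2)[OF restrict_in_RT_space, of x] weight_pos[of x]
    unfolding weight_restrict by (simp add: abs_divide pos_divide_le_eq)
  moreover have "continuous_on UNIV (\<lambda>x. F (restrict x {1..T}) / weight x)"
    using weight_nonzero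
    by (intro continuous_on_divide continuous_on_compose_restrict F(1) continuous_on_weight) auto
  ultimately show ?thesis by (auto simp: Cb_def)
qed

context
  assumes nonempty: "Mhom T \<mu> \<noteq> {}"
begin

text \<open>The expectation of \<open>F\<close> under any element of \<open>Mhom\<close> is a lower
  bound; here the nonemptiness of \<open>Mhom\<close> enters.\<close>

lemma bdd_below_cost:
  assumes F: "continuous_on (RT_space T) F" "\<And>x. x \<in> RT_space T \<Longrightarrow> \<bar>F x\<bar> \<le> C * weight x"
  shows "bdd_below ((\<lambda>(h, v, g). cost h) ` dual_feasible T F rs rt)"
proof -
  obtain Q where Q: "Q \<in> Mhom T \<mu>" using nonempty by auto
  have i: "integrable Q F"
    by (rule integrable_linear_growth[OF Mhom_sets[OF Q] Mhom_prob_space[OF Q] Mhom_marg[OF Q] F])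
  show ?thesis
    by (rule bdd_belowI2[where m = "\<integral>\<omega>. F \<omega> \<partial>Q"])
      (auto simp: dual_feasible_iff intro!: weak_duality[OF Q _ i])
qed

lemma bcontfun_weight:
  "continuous_on (RT_space T) (\<lambda>x. apply_bcontfun \<phi> x * weight x)"
  "\<exists>C. \<forall>x. \<bar>apply_bcontfun \<phi> x * weight x\<bar> \<le> C * weight x"
proof -
  show "continuous_on (RT_space T) (\<lambda>x. apply_bcontfun \<phi> x * weight x)"
    using Cb_apply_bcontfun[of \<phi>]
    by (intro continuous_on_mult continuous_on_weight) (auto simp: Cb_def intro: continuous_on_subset)
  obtain C where C: "\<And>x. \<bar>apply_bcontfun \<phi> x\<bar> \<le> C"
    using Cb_apply_bcontfun[of \<phi>] by (auto simp: Cb_def)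
  have "\<bar>apply_bcontfun \<phi> x * weight x\<bar> \<le> C * weight x" for x
    using C[of x] weight_pos[of x] by (simp add: abs_mult mult_right_mono)
  then show "\<exists>C. \<forall>x. \<bar>apply_bcontfun \<phi> x * weight x\<bar> \<le> C * weight x" by blast
qed

lemma price_le:
  fixes \<phi> :: "(nat \<Rightarrow> real) \<Rightarrow>\<^sub>C real"
  assumes "admissible h v g" "\<And>x. x \<in> RT_space T \<Longrightarrow> \<phi> x * weight x \<le> hedge h v g x"
  shows "price \<phi> \<le> cost h"
proof -
  obtain C where "\<And>x. \<bar>apply_bcontfun \<phi> x * weight x\<bar> \<le> C * weight x"
    using bcontfun_weight(2) by blast
  then have "bdd_below ((\<lambda>(h, v, g). cost h) ` dual_feasible T (\<lambda>x. \<phi> x * weight x) rs rt)"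
    by (intro bdd_below_cost[OF bcontfun_weight(1)])
  from cINF_lower[OF this, of "(h, v, g)"] show ?thesis
    using assms by (simp add: price_def dual_feasible_iff)
qed

lemma price_ge:
  fixes \<phi> :: "(nat \<Rightarrow> real) \<Rightarrow>\<^sub>C real"
  assumes "\<And>h v g. \<lbrakk>admissible h v g; \<And>x. x \<in> RT_space T \<Longrightarrow> \<phi> x * weight x \<le> hedge h v g x\<rbrakk> \<Longrightarrow> c \<le> cost h"
  shows "c \<le> price \<phi>"
  unfolding price_def
proof (rule cINF_greatest)
  obtain C where "\<And>x. \<bar>apply_bcontfun \<phi> x * weight x\<bar> \<le> C * weight x"
    using bcontfun_weight(2) by blast
  then show "dual_feasible T (\<lambda>x. \<phi> x * weight x) rs rt \<noteq> {}"
    using ex_dual_feasible[of "\<lambda>x. \<phi> x * weight x" C] by auto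
qed (use assms in \<open>auto simp: dual_feasible_iff\<close>)

text \<open>Sums and positive multiples of dominating hedges dominate the corresponding payoffs, and
  costs follow along. For subadditivity the two infima are taken one after the other; for
  homogeneity one inequality is used with both \<open>c\<close> and \<open>1 / c\<close>.\<close>

lemma sublinear_price: "sublinear price"
  unfolding sublinear_def
proof (intro conjI allI impI)
  fix \<phi> \<psi> :: "(nat \<Rightarrow> real) \<Rightarrow>\<^sub>C real"
  have *: "price (\<phi> + \<psi>) \<le> cost h + cost h'"
    if h: "admissible h v g" "\<And>x. x \<in> RT_space T \<Longrightarrow> \<phi> x * weight x \<le> hedge h v g x"
      and h': "admissible h' v' g'" "\<And>x. x \<in> RT_space T \<Longrightarrow> \<psi> x * weight x \<le> hedge h' v' g' x"
    for h v g h' v' g'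
    unfolding cost_add[OF h(1) h'(1), symmetric]
  proof (rule price_le[OF admissible_add[OF h(1) h'(1)]])
    show "(\<phi> + \<psi>) x * weight x \<le> hedge (\<lambda>t x. h t x + h' t x) (\<lambda>t x. v t x + v' t x) (\<lambda>s t \<tau> x y. g s t \<tau> x y + g' s t \<tau> x y) x"
      if "x \<in> RT_space T" for x
      unfolding hedge_add using h(2)[OF that] h'(2)[OF that] by (simp add: plus_bcontfun.rep_eq distrib_right)
  qed
  have "price (\<phi> + \<psi>) - cost h \<le> price \<psi>"
    if h: "admissible h v g" "\<And>x. x \<in> RT_space T \<Longrightarrow> \<phi> x * weight x \<le> hedge h v g x" for h v g
  proof (rule price_ge)
    show "price (\<phi> + \<psi>) - cost h \<le> cost h'"
      if "admissible h' v' g'" "\<And>x. x \<in> RT_space T \<Longrightarrow> \<psi> x * weight x \<le> hedge h' v' g' x" for h' v' g'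
      using *[OF h that] by simp
  qed
  then have "price (\<phi> + \<psi>) - price \<psi> \<le> price \<phi>"
    by (intro price_ge) (simp add: algebra_simps)
  then show "price (\<phi> + \<psi>) \<le> price \<phi> + price \<psi>" by simp
next
  have le: "price (c *\<^sub>R \<phi>) \<le> c * price \<phi>" if c: "0 < c" for c and \<phi> :: "(nat \<Rightarrow> real) \<Rightarrow>\<^sub>C real"
  proof -
    have "price (c *\<^sub>R \<phi>) / c \<le> price \<phi>"
    proof (rule price_ge)
      fix h v g assume h: "admissible h v g" "\<And>x. x \<in> RT_space T \<Longrightarrow> \<phi> x * weight x \<le> hedge h v g x"
      have "price (c *\<^sub>R \<phi>) \<le> cost (\<lambda>t x. c * h t x)"
      proof (rule price_le[OF admissible_scale[OF h(1)]])
        show "(c *\<^sub>R \<phi>) x * weight x \<le> hedge (\<lambda>t x. c * h t x) (\<lambda>t x. c * v t x) (\<lambda>s t \<tau> x y. c * g s t \<tau> x y) x"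
          if "x \<in> RT_space T" for x
          unfolding hedge_scale using h(2)[OF that] c by (simp add: scaleR_bcontfun.rep_eq mult.assoc)
      qed
      then show "price (c *\<^sub>R \<phi>) / c \<le> cost h"
        using c by (simp add: cost_scale field_simps)
    qed
    then show ?thesis using c by (simp add: field_simps)
  qed
  fix c :: real and \<phi> :: "(nat \<Rightarrow> real) \<Rightarrow>\<^sub>C real" assume c: "0 < c"
  have "price ((1 / c) *\<^sub>R (c *\<^sub>R \<phi>)) \<le> (1 / c) * price (c *\<^sub>R \<phi>)"
    using c by (intro le) auto
  then have "c * price \<phi> \<le> price (c *\<^sub>R \<phi>)"
    using c by (simp add: field_simps)
  with le[OF c, of \<phi>] show "price (c *\<^sub>R \<phi>) = c * price \<phi>" by simp
qed

section \<open>Linear functionals below the dual value\<close>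

context
  fixes L :: "((nat \<Rightarrow> real) \<Rightarrow>\<^sub>C real) \<Rightarrow> real"
  assumes lin: "linear L" and L_le_price: "\<And>\<phi>. L \<phi> \<le> price \<phi>"
begin

lemma L_le_cost:
  assumes "Cb \<phi>" "admissible h v g" "\<And>x. x \<in> RT_space T \<Longrightarrow> \<phi> x * weight x \<le> hedge h v g x"
  shows "L (Bcontfun \<phi>) \<le> cost h"
  using order_trans[OF L_le_price price_le[OF assms(2), of "Bcontfun \<phi>"]] assms(1,3) by (simp add: apply_Bcontfun)

lemma L_add: "Cb \<phi> \<Longrightarrow> Cb \<psi> \<Longrightarrow> L (Bcontfun (\<lambda>x. \<phi> x + \<psi> x)) = L (Bcontfun \<phi>) + L (Bcontfun \<psi>)"
  by (simp add: Bcontfun_add linear_add[OF lin])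

lemma L_scale: "Cb \<phi> \<Longrightarrow> L (Bcontfun (\<lambda>x. c * \<phi> x)) = c * L (Bcontfun \<phi>)"
  by (simp add: Bcontfun_scale linear_scale[OF lin])

text \<open>The hedge times \<open>- 1\<close> is again a hedge, so an exactly replicated payoff is
  bounded by its cost from both sides.\<close>

lemma L_eq_cost:
  assumes \<phi>: "Cb \<phi>" and adm: "admissible h v g" and eq: "\<And>x. x \<in> RT_space T \<Longrightarrow> \<phi> x * weight x = hedge h v g x"
  shows "L (Bcontfun \<phi>) = cost h"
proof (rule antisym)
  show "L (Bcontfun \<phi>) \<le> cost h"
    using eq by (intro L_le_cost[OF \<phi> adm]) simp
  have "L (Bcontfun (\<lambda>x. - 1 * \<phi> x)) \<le> cost (\<lambda>t x. - 1 * h t x)"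
  proof (rule L_le_cost[OF _ admissible_scale[OF adm]])
    show "- 1 * \<phi> x * weight x \<le> hedge (\<lambda>t x. - 1 * h t x) (\<lambda>t x. - 1 * v t x) (\<lambda>s t \<tau> x y. - 1 * g s t \<tau> x y) x"
      if "x \<in> RT_space T" for x
      unfolding hedge_scale using eq[OF that] by simp
  qed (intro Cb_mult Cb_const \<phi>)
  then show "cost h \<le> L (Bcontfun \<phi>)"
    unfolding cost_scale L_scale[OF \<phi>] by simp
qed

text \<open>The zero hedge dominates \<open>- \<phi> x * weight x\<close> and costs nothing.\<close>

lemma L_nonneg:
  assumes \<phi>: "Cb \<phi>" "\<And>x. 0 \<le> \<phi> x"
  shows "0 \<le> L (Bcontfun \<phi>)"
proof -
  have "L (Bcontfun (\<lambda>x. - 1 * \<phi> x)) \<le> cost (\<lambda>_ _. 0)"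
  proof (rule L_le_cost[OF _ admissible_static])
    show "- 1 * \<phi> x * weight x \<le> hedge (\<lambda>_ _. 0) (\<lambda>_ _. 0) (\<lambda>_ _ _ _ _. 0) x" for x
      using \<phi>(2)[of x] weight_pos[of x] by (simp add: hedge_static)
    show "Cb (\<lambda>x. - 1 * \<phi> x)" by (intro Cb_mult Cb_const \<phi>)
  qed (intro Cb_imp_Clin_R Cb_const)
  then show ?thesis
    unfolding L_scale[OF \<phi>(1)] by (simp add: cost_def)
qed

text \<open>Tightness of the marginals controls \<open>L\<close> outside a compact box, and Dini's argument inside.\<close>

lemma L_tendsto_zero:
  assumes F: "\<And>n. Cb (F n)" "\<And>n x. 0 \<le> F n x" "\<And>n x. F (Suc n) x \<le> F n x" "\<And>x. (\<lambda>n. F n x) \<longlonglongrightarrow> 0"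
  shows "(\<lambda>n. L (Bcontfun (F n))) \<longlonglongrightarrow> 0"
proof (rule LIMSEQ_I)
  fix e :: real assume e: "0 < e"
  obtain M where M: "0 < M" "\<And>x. F 0 x \<le> M"
  proof -
    obtain B where B: "\<And>x. \<bar>F 0 x\<bar> \<le> B" using F(1)[of 0] by (auto simp: Cb_def)
    have "F 0 x \<le> \<bar>B\<bar> + 1" for x using B[of x] by linarith
    then show ?thesis using that[of "\<bar>B\<bar> + 1"] by simp
  qed
  have anti: "F n x \<le> F m x" if "m \<le> n" for m n x
    using lift_Suc_antimono_le[of "\<lambda>n. F n x", OF F(3) that] .
  define W where "W = cost (\<lambda>_ x. 1 + \<bar>x\<bar>)"
  have W: "0 \<le> W"
    unfolding W_def cost_def by (intro sum_nonneg integral_nonneg_AE) auto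
  \<comment> \<open>The hedge \<open>d * (1 + \<bar>x\<bar>)\<close>, used inside the box, costs
    \<open>d * W\<close>. The added 1 keeps the denominator positive and makes this cost strictly
    less than \<open>e / 2\<close>.\<close>
  define d where "d = e / (2 * (W + 1))"
  have "d * (W + 1) = e / 2" using W by (simp add: d_def field_simps)
  moreover have "d * (W + 1) = d * W + d" by (simp add: algebra_simps)
  moreover have d: "0 < d" using e W by (simp add: d_def)
  ultimately have dW: "d * W < e / 2" by linarith
  obtain m where m: "cost (\<lambda>_. tail m) < e / (2 * M)"
  proof -
    have "eventually (\<lambda>m. cost (\<lambda>_. tail m) < e / (2 * M)) sequentially"
      using order_tendstoD(2)[OF cost_tail, of "e / (2 * M)"] e M(1) by simp
    then show ?thesis using that by (auto simp: eventually_sequentially)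
  qed
  \<comment> \<open>The box ends at \<open>m + 1\<close>, where \<open>tail m\<close> has reached
    its full size.\<close>
  define K where "K = {x \<in> RT_space T. \<forall>t\<in>{1..T}. \<bar>x t\<bar> \<le> real m + 1}"
  have "compact K" unfolding K_def by (rule compact_box)
  moreover have "open {x. F n x < d}" for n
    using F(1)[of n] by (intro open_Collect_less) (auto simp: Cb_def)
  moreover have "K \<subseteq> (\<Union>n\<in>UNIV. {x. F n x < d})"
  proof
    fix x
    have "eventually (\<lambda>n. F n x < d) sequentially"
      by (rule order_tendstoD(2)[OF F(4) d])
    then show "x \<in> (\<Union>n\<in>UNIV. {x. F n x < d})" by (auto simp: eventually_sequentially)
  qed
  ultimately obtain J where J: "finite J" "K \<subseteq> (\<Union>n\<in>J. {x. F n x < d})"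
    by (rule compactE_image[of K UNIV "\<lambda>n. {x. F n x < d}"]) auto
  obtain n0 where n0: "\<And>j. j \<in> J \<Longrightarrow> j \<le> n0"
    using J(1) finite_nat_set_iff_bounded_le by auto
  have inK: "F n x \<le> d" if n: "n \<ge> n0" and x: "x \<in> K" for n x
  proof -
    obtain j where "j \<in> J" "F j x < d" using J(2) x by auto
    then show ?thesis
      using anti[of j n x] n0[of j] n by simp
  qed
  \<comment> \<open>One static hedge serves both regions: its first summand suffices on the box,
    where \<open>F n\<close> is at most \<open>d\<close>, its second outside, where
    \<open>F n\<close> is at most \<open>M\<close> and \<open>weight_le_tail\<close>
    applies.\<close>
  have "L (Bcontfun (F n)) \<le> cost (\<lambda>_ x. d * (1 + \<bar>x\<bar>) + M * tail m x)" if n: "n \<ge> n0" for n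
  proof (rule L_le_cost[OF F(1) admissible_static])
    show "Clin_R (\<lambda>x. d * (1 + \<bar>x\<bar>) + M * tail m x)"
      by (intro Clin_R_add Clin_R_scale Clin_R_tail)
        (auto simp: Clin_R_def intro!: continuous_intros exI[of _ 1])
    fix x assume x: "x \<in> RT_space T"
    have split: "(\<Sum>t=1..T. d * (1 + \<bar>x t\<bar>) + M * tail m (x t)) = d * (\<Sum>t=1..T. 1 + \<bar>x t\<bar>) + M * (\<Sum>t=1..T. tail m (x t))"
      unfolding sum_distrib_left by (rule sum.distrib)
    have nn: "0 \<le> M * (\<Sum>t=1..T. tail m (x t))" "0 \<le> d * (\<Sum>t=1..T. 1 + \<bar>x t\<bar>)"
      using M(1) d by (auto intro!: mult_nonneg_nonneg sum_nonneg tail_nonneg)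
    have "F n x * weight x \<le> d * (\<Sum>t=1..T. 1 + \<bar>x t\<bar>) + M * (\<Sum>t=1..T. tail m (x t))"
    proof (cases "x \<in> K")
      case True
      have "F n x * weight x \<le> d * (\<Sum>t=1..T. 1 + \<bar>x t\<bar>)"
        using inK[OF n True] d weight_le_sum[of x] weight_pos[of x] by (intro mult_mono) auto
      then show ?thesis using nn by simp
    next
      case False
      then obtain t where "t \<in> {1..T}" "real m + 1 < \<bar>x t\<bar>"
        using x by (auto simp: K_def not_le)
      from weight_le_tail[of t m x, OF this] have "F n x * weight x \<le> M * (\<Sum>t=1..T. tail m (x t))"
        using order_trans[OF anti[of 0 n x] M(2)] M(1) weight_pos[of x] by (intro mult_mono) auto
      then show ?thesis using nn by simp
    qed
    then show "F n x * weight x \<le> hedge (\<lambda>_ x. d * (1 + \<bar>x\<bar>) + M * tail m x) (\<lambda>_ _. 0) (\<lambda>_ _ _ _ _. 0) x"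
      unfolding hedge_static split .
  qed
  moreover have "cost (\<lambda>_ x. d * (1 + \<bar>x\<bar>) + M * tail m x) = d * W + M * cost (\<lambda>_. tail m)"
  proof -
    have a: "admissible (\<lambda>_ x. d * (1 + \<bar>x\<bar>)) (\<lambda>_ _. 0) (\<lambda>_ _ _ _ _. 0)"
      by (intro admissible_static Clin_R_scale) (auto simp: Clin_R_def intro!: continuous_intros exI[of _ 1])
    have b: "admissible (\<lambda>_ x. M * tail m x) (\<lambda>_ _. 0) (\<lambda>_ _ _ _ _. 0)"
      by (intro admissible_static Clin_R_scale Clin_R_tail)
    show ?thesis
      using cost_add[OF a b] by (simp only: W_def cost_scale)
  qed
  moreover have "M * cost (\<lambda>_. tail m) < e / 2"
    using m M(1) by (simp add: field_simps)
  ultimately have "L (Bcontfun (F n)) < e" if "n \<ge> n0" for n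
    using that dW by force
  moreover have "0 \<le> L (Bcontfun (F n))" for n
    by (rule L_nonneg[OF F(1,2)])
  ultimately show "\<exists>no. \<forall>n\<ge>no. norm (L (Bcontfun (F n)) - 0) < e"
    by (intro exI[of _ n0]) auto
qed

text \<open>The Daniell measure integrates payoffs divided by the weight; the density
  \<open>1 / weight\<close> restores the payoffs themselves and, being at most 1, keeps the mass
  finite. Restriction then carries the measure to \<open>RT T\<close>.\<close>

lemma ex_representing_measure:
  "\<exists>Q. sets Q = sets (RT T) \<and> finite_measure Q \<and>
    (\<forall>F C. continuous_on (RT_space T) F \<longrightarrow> (\<forall>x\<in>RT_space T. \<bar>F x\<bar> \<le> C * weight x) \<longrightarrow>
       (\<integral>\<omega>. F \<omega> \<partial>Q) = L (Bcontfun (\<lambda>x. F (restrict x {1..T}) / weight x)))"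
proof -
  interpret D: daniell_functional "\<lambda>\<phi>. L (Bcontfun \<phi>)"
    by unfold_locales (rule L_add L_scale L_nonneg L_tendsto_zero; assumption)+
  let ?N = D.representing_measure
  interpret N: finite_measure ?N by (rule D.finite_measure_representing_measure)
  let ?D = "density ?N (\<lambda>x. ennreal (1 / weight x))"
  define Q where "Q = distr ?D (RT T) (\<lambda>x. restrict x {1..T})"
  have w[measurable]: "weight \<in> borel_measurable borel"
    by (rule borel_measurable_continuous_onI[OF continuous_on_weight])
  have res: "(\<lambda>x. restrict x {1..T}) \<in> ?D \<rightarrow>\<^sub>M RT T"
    using measurable_borel_restrict[of T] by (simp add: measurable_cong_sets[of ?D borel])
  show ?thesis
  proof (intro exI[of _ Q] conjI allI impI)
    show "sets Q = sets (RT T)" by (simp add: Q_def)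
    have "emeasure Q (space Q) = emeasure ?D (space ?D)"
      unfolding Q_def using measurable_space[OF res]
      by (subst emeasure_distr[OF res]) (auto intro!: arg_cong[where f = "emeasure ?D"])
    also have "\<dots> = (\<integral>\<^sup>+x. ennreal (1 / weight x) * indicator (space ?N) x \<partial>?N)"
      by (simp only: space_density) (rule emeasure_density, measurable)
    also have "\<dots> \<le> (\<integral>\<^sup>+x. 1 \<partial>?N)"
    proof (rule nn_integral_mono)
      show "ennreal (1 / weight x) * indicator (space ?N) x \<le> 1" for x
        using weight_ge_1[of x] weight_pos[of x] by (simp add: ennreal_le_1 pos_divide_le_eq)
    qed
    also have "\<dots> < \<infinity>"
      by (simp add: N.emeasure_eq_measure)
    finally show "finite_measure Q"
      by (intro finite_measureI) simp
    fix F :: "(nat \<Rightarrow> real) \<Rightarrow> real" and C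
    assume F: "continuous_on (RT_space T) F" "\<forall>x\<in>RT_space T. \<bar>F x\<bar> \<le> C * weight x"
    have FR: "(\<lambda>x. F (restrict x {1..T})) \<in> borel_measurable ?N"
      using borel_measurable_continuous_onI[OF continuous_on_compose_restrict[OF F(1)]] by simp
    have "(\<integral>\<omega>. F \<omega> \<partial>Q) = (\<integral>x. F (restrict x {1..T}) \<partial>?D)"
      unfolding Q_def by (rule integral_distr[OF res borel_measurable_RT_continuous[OF F(1)]])
    also have "\<dots> = (\<integral>x. F (restrict x {1..T}) / weight x \<partial>?N)"
      using weight_pos by (subst integral_density[OF FR]) (auto simp: less_imp_le)
    also have "\<dots> = L (Bcontfun (\<lambda>x. F (restrict x {1..T}) / weight x))"
      using F by (intro D.integral_representing_measure Cb_quotient) auto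
    finally show "(\<integral>\<omega>. F \<omega> \<partial>Q) = L (Bcontfun (\<lambda>x. F (restrict x {1..T}) / weight x))" .
  qed
qed

end

end

end

section \<open>Strong duality\<close>

context homogeneous_transport
begin

text \<open>Each constraint in \<open>Mhom\<close> is tested by a payoff that is itself a hedge with
  a single nonzero component, so that its integral is known to be the cost of that hedge.\<close>

lemma ex_dual_optimal_measure:
  assumes nonempty: "Mhom T \<mu> \<noteq> {}"
    and lin: "linear L" and L_le_price: "\<And>\<phi>. L \<phi> \<le> price \<phi>"
  shows "\<exists>Q\<in>Mhom T \<mu>. \<forall>F C. continuous_on (RT_space T) F \<longrightarrow> (\<forall>x\<in>RT_space T. \<bar>F x\<bar> \<le> C * weight x) \<longrightarrow>
       (\<integral>\<omega>. F \<omega> \<partial>Q) = L (Bcontfun (\<lambda>x. F (restrict x {1..T}) / weight x))"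
proof -
  obtain Q where sQ: "sets Q = sets (RT T)" and fQ: "finite_measure Q"
    and rep: "\<forall>F C. continuous_on (RT_space T) F \<longrightarrow> (\<forall>x\<in>RT_space T. \<bar>F x\<bar> \<le> C * weight x) \<longrightarrow>
       (\<integral>\<omega>. F \<omega> \<partial>Q) = L (Bcontfun (\<lambda>x. F (restrict x {1..T}) / weight x))"
    using ex_representing_measure[OF nonempty lin L_le_price] by blast
  have eq_cost: "(\<integral>\<omega>. F \<omega> \<partial>Q) = cost h"
    if F: "continuous_on (RT_space T) F" "\<And>x. x \<in> RT_space T \<Longrightarrow> \<bar>F x\<bar> \<le> C * weight x"
      and adm: "admissible h v g" and eq: "\<And>x. x \<in> RT_space T \<Longrightarrow> F x = hedge h v g x" for F C h v g
  proof -
    have "(\<integral>\<omega>. F \<omega> \<partial>Q) = L (Bcontfun (\<lambda>x. F (restrict x {1..T}) / weight x))"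
      using rep F by blast
    also have "\<dots> = cost h"
    proof (rule L_eq_cost[OF nonempty lin L_le_price Cb_quotient[OF F] adm])
      show "F (restrict x {1..T}) / weight x * weight x = hedge h v g x" if "x \<in> RT_space T" for x
        using eq[OF that] weight_nonzero[of x] unfolding restrict_RT_space[OF that] by simp
    qed
    finally show ?thesis .
  qed
  have marg_int: "(\<integral>\<omega>. \<phi> (\<omega> t) \<partial>Q) = (\<integral>x. \<phi> x \<partial>\<mu> t)" if \<phi>: "Cb \<phi>" and t: "t \<in> {1..T}" for \<phi> t
  proof -
    obtain B where B: "\<And>x. \<bar>\<phi> x\<bar> \<le> B" using \<phi> by (auto simp: Cb_def)
    let ?h = "\<lambda>u. if u = t then \<phi> else (\<lambda>_. 0)"
    have "(\<integral>\<omega>. \<phi> (\<omega> t) \<partial>Q) = cost ?h"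
    proof (rule eq_cost[where v = "\<lambda>_ _. 0" and g = "\<lambda>_ _ _ _ _. 0"])
      show "continuous_on (RT_space T) (\<lambda>\<omega>. \<phi> (\<omega> t))"
        using \<phi> by (intro continuous_on_compose2[OF _ continuous_on_coordinate]) (auto simp: Cb_def)
      show "\<bar>\<phi> (x t)\<bar> \<le> \<bar>B\<bar> * weight x" for x
        using B[of "x t"] weight_ge_1[of x] mult_left_mono[of 1 "weight x" "\<bar>B\<bar>"] by linarith
      show "admissible ?h (\<lambda>_ _. 0) (\<lambda>_ _ _ _ _. 0)"
        using \<phi> by (intro admissible_static) (auto intro: Cb_imp_Clin_R)
      show "\<phi> (x t) = hedge ?h (\<lambda>_ _. 0) (\<lambda>_ _ _ _ _. 0) x" for x
      proof -
        have "(\<Sum>u=1..T. ?h u (x u)) = (\<Sum>u=1..T. if u = t then \<phi> (x u) else 0)"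
          by (intro sum.cong) auto
        then show ?thesis using t by (simp add: hedge_static)
      qed
    qed
    also have "cost ?h = (\<Sum>u=1..T. if u = t then (\<integral>x. \<phi> x \<partial>\<mu> u) else 0)"
      unfolding cost_def by (intro sum.cong) auto
    also have "\<dots> = (\<integral>x. \<phi> x \<partial>\<mu> t)" using t by simp
    finally show ?thesis .
  qed
  \<comment> \<open>So far \<open>Q\<close> is only known to be finite. The constant 1, hedged by a
    position in the first marginal alone, costs 1 because \<open>\<mu> 1\<close> is a probability
    measure.\<close>
  have "measure Q (space Q) = 1"
  proof -
    have t: "1 \<in> {1..T}" using T2 by auto
    interpret prob_space "\<mu> 1" by (rule prob_space_marginal[OF t])
    show ?thesis
      using marg_int[OF Cb_const[of 1] t] prob_space by simp
  qed
  then have pQ: "prob_space Q"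
    using finite_measure.emeasure_eq_measure[OF fQ] by (intro prob_spaceI) simp
  have m: "marg Q t = \<mu> t" if t: "t \<in> {1..T}" for t
  proof (rule finite_measure_eqI_Cb)
    note c = measurable_coordinate[OF sQ pQ t]
    show "finite_measure (marg Q t)"
      unfolding marg_def by (rule prob_space.finite_measure[OF prob_space.prob_space_distr[OF pQ c]])
    show "sets (marg Q t) = sets borel" by (simp add: marg_def)
    show "(\<integral>x. \<phi> x \<partial>marg Q t) = (\<integral>x. \<phi> x \<partial>\<mu> t)" if \<phi>: "Cb \<phi>" for \<phi>
      unfolding marg_def integral_distr[OF c Cb_borel_measurable[OF \<phi>]] by (rule marg_int[OF \<phi> t])
  qed (use finite_measure_marginal sets_marginal t in auto)
  note q = sQ pQ
  have "\<forall>t\<in>{1..<T}. \<forall>v. Cb_Rt t v \<longrightarrow> (\<integral>\<omega>. v (restrict \<omega> {1..t}) * (\<omega> (Suc t) - \<omega> t) \<partial>Q) = 0"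
  proof (intro ballI allI impI)
    fix t v assume t: "t \<in> {1..<T}" and v: "Cb_Rt t v"
    obtain B where B: "0 \<le> B" "\<And>x. \<bar>v (restrict x {1..t})\<bar> \<le> B"
      using Cb_Rt_bound[OF v] by blast
    let ?v = "\<lambda>u. if u = t then v else (\<lambda>_. 0)"
    have "(\<integral>\<omega>. v (restrict \<omega> {1..t}) * (\<omega> (Suc t) - \<omega> t) \<partial>Q) = cost (\<lambda>_ _. 0)"
    proof (rule eq_cost[where v = ?v and g = "\<lambda>_ _ _ _ _. 0"])
      have "continuous_on UNIV (\<lambda>\<omega>. v (restrict \<omega> {1..t}))"
        using v by (intro continuous_on_compose_restrict) (auto simp: Cb_Rt_def)
      then show "continuous_on (RT_space T) (\<lambda>\<omega>. v (restrict \<omega> {1..t}) * (\<omega> (Suc t) - \<omega> t))"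
        by (intro continuous_on_mult continuous_on_diff continuous_on_coordinate) (auto intro: continuous_on_subset)
      show "\<bar>v (restrict x {1..t}) * (x (Suc t) - x t)\<bar> \<le> (2 * B) * weight x" for x
      proof -
        have "\<bar>x (Suc t) - x t\<bar> \<le> 2 * weight x"
          using abs_le_weight[of t x] abs_le_weight[of "Suc t" x] t by auto
        then have "\<bar>v (restrict x {1..t})\<bar> * \<bar>x (Suc t) - x t\<bar> \<le> B * (2 * weight x)"
          using B by (intro mult_mono) auto
        then show ?thesis by (simp add: abs_mult mult.assoc)
      qed
      show "admissible (\<lambda>_ _. 0) ?v (\<lambda>_ _ _ _ _. 0)"
        using admissible_static[of "\<lambda>_ _. 0"] v by (auto simp: admissible_def intro: Cb_imp_Clin_R)
      show "v (restrict x {1..t}) * (x (Suc t) - x t) = hedge (\<lambda>_ _. 0) ?v (\<lambda>_ _ _ _ _. 0) x" for x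
      proof -
        have "(\<Sum>u=1..<T. ?v u (restrict x {1..u}) * (x (Suc u) - x u))
            = (\<Sum>u=1..<T. if u = t then v (restrict x {1..u}) * (x (Suc u) - x u) else 0)"
          by (intro sum.cong) auto
        also have "\<dots> = v (restrict x {1..t}) * (x (Suc t) - x t)"
          using t by (subst sum.delta) auto
        finally show ?thesis by (simp add: hedge_def)
      qed
    qed
    then show "(\<integral>\<omega>. v (restrict \<omega> {1..t}) * (\<omega> (Suc t) - \<omega> t) \<partial>Q) = 0"
      by (simp add: cost_def)
  qed
  \<comment> \<open>The marginals, identified before, provide the integrability of the coordinates
    that \<open>martingale_iff\<close> presupposes.\<close>
  then have "is_martingale_measure T Q"
    using martingale_iff[OF q integrable_coordinate[OF q m]] by blast
  moreover have "\<forall>(s, t, \<tau>)\<in>Delta T. \<forall>g. Cb_R2 g \<longrightarrow>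
    (\<integral>\<omega>. g (\<omega> s) (\<omega> (s + \<tau>)) * rs s t (\<omega> s) \<partial>Q) = (\<integral>\<omega>. g (\<omega> t) (\<omega> (t + \<tau>)) * rt s t (\<omega> t) \<partial>Q)"
  proof safe
    fix s t \<tau> g assume d: "(s, t, \<tau>) \<in> Delta T" and g: "Cb_R2 g"
    have st: "s \<in> {1..T}" "t \<in> {1..T}" "s + \<tau> \<in> {1..T}" "t + \<tau> \<in> {1..T}"
      using d by (auto simp: Delta_def)
    let ?F = "\<lambda>\<omega>. g (\<omega> s) (\<omega> (s + \<tau>)) * rs s t (\<omega> s) - g (\<omega> t) (\<omega> (t + \<tau>)) * rt s t (\<omega> t)"
    let ?g = "\<lambda>a b c. if (a, b, c) = (s, t, \<tau>) then g else (\<lambda>_ _. 0)"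
    have "Cb (\<lambda>z. g (fst z) (snd z))"
      using g by (simp add: Cb_R2_iff split_beta')
    then obtain A where A: "\<And>x y. \<bar>g x y\<bar> \<le> A"
      by (fastforce simp: Cb_def)
    obtain B where B: "\<And>x. \<bar>rs s t x\<bar> \<le> B" using Cb_rs[OF st(1,2)] by (auto simp: Cb_def)
    obtain C where C: "\<And>x. \<bar>rt s t x\<bar> \<le> C" using Cb_rt[OF st(1,2)] by (auto simp: Cb_def)
    have A0: "0 \<le> A" by (rule order_trans[OF abs_ge_zero A])
    have "(\<integral>\<omega>. ?F \<omega> \<partial>Q) = cost (\<lambda>_ _. 0)"
    proof (rule eq_cost[where v = "\<lambda>_ _. 0" and g = ?g])
      have "continuous_on (RT_space T) (\<lambda>\<omega>. r (\<omega> u))" if "Cb r" for r :: "real \<Rightarrow> real" and u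
        using that by (intro continuous_on_compose2[OF _ continuous_on_coordinate]) (auto simp: Cb_def)
      then show "continuous_on (RT_space T) ?F"
        using Cb_rs[OF st(1,2)] Cb_rt[OF st(1,2)]
        by (intro continuous_on_diff continuous_on_mult Cb_R2_compose[OF g] continuous_on_coordinate)
      show "\<bar>?F x\<bar> \<le> (A * B + A * C) * weight x" for x
      proof -
        have "\<bar>g (x s) (x (s + \<tau>)) * rs s t (x s)\<bar> \<le> A * B" "\<bar>g (x t) (x (t + \<tau>)) * rt s t (x t)\<bar> \<le> A * C"
          unfolding abs_mult using A B C A0 by (intro mult_mono; simp)+
        then have le: "\<bar>?F x\<bar> \<le> A * B + A * C" and "0 \<le> A * B + A * C" by linarith+
        then have "(A * B + A * C) * 1 \<le> (A * B + A * C) * weight x"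
          using weight_ge_1 by (intro mult_left_mono)
        with le show ?thesis by (simp only: mult_1_right)
      qed
      have "Cb_R2 (\<lambda>_ _. 0)" using Cb_const[of 0] by (simp add: Cb_R2_iff split_beta')
      then show "admissible (\<lambda>_ _. 0) (\<lambda>_ _. 0) ?g"
        using admissible_static[of "\<lambda>_ _. 0"] g by (auto simp: admissible_def intro: Cb_imp_Clin_R)
      show "?F x = hedge (\<lambda>_ _. 0) (\<lambda>_ _. 0) ?g x" for x
      proof -
        have "(\<Sum>(a, b, c)\<in>Delta T. ?g a b c (x a) (x (a + c)) * rs a b (x a) - ?g a b c (x b) (x (b + c)) * rt a b (x b))
            = (\<Sum>d\<in>Delta T. if d = (s, t, \<tau>) then ?F x else 0)"
          by (intro sum.cong) (auto split: if_splits)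
        also have "\<dots> = ?F x"
          using d finite_Delta by (subst sum.delta) auto
        finally show ?thesis by (simp add: hedge_def)
      qed
    qed
    then show "(\<integral>\<omega>. g (\<omega> s) (\<omega> (s + \<tau>)) * rs s t (\<omega> s) \<partial>Q) = (\<integral>\<omega>. g (\<omega> t) (\<omega> (t + \<tau>)) * rt s t (\<omega> t) \<partial>Q)"
      using integrable_homogeneity_term[OF q m g Cb_rs[OF st(1,2)] st(1,3)]
        integrable_homogeneity_term[OF q m g Cb_rt[OF st(1,2)] st(2,4)]
      by (simp add: cost_def)
  qed
  then have "homogeneous T Q"
    using homogeneous_iff[OF q m] by blast
  ultimately have "Q \<in> Mhom T \<mu>"
    using q m by (simp add: Mhom_def)
  with rep show ?thesis by blast
qed

text \<open>Tightness at the payoff itself gives the representing measure the dual value as its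
  expectation; that no competitor exceeds it is weak duality.\<close>

theorem duality:
  assumes f: "Clin_RT T f" and nonempty: "Mhom T \<mu> \<noteq> {}"
  shows "\<exists>Q\<in>Mhom T \<mu>. (\<forall>Q'\<in>Mhom T \<mu>. (\<integral>\<omega>. f \<omega> \<partial>Q') \<le> (\<integral>\<omega>. f \<omega> \<partial>Q)) \<and>
           ereal (\<integral>\<omega>. f \<omega> \<partial>Q) = (INF (h, v, g)\<in>dual_feasible T f rs rt. ereal (cost h))"
proof -
  obtain C where fc: "continuous_on (RT_space T) f" and C: "\<And>x. x \<in> RT_space T \<Longrightarrow> \<bar>f x\<bar> \<le> C * weight x"
    using f by (auto simp: Clin_RT_def weight_def)
  define \<phi> where "\<phi> = Bcontfun (\<lambda>x. f (restrict x {1..T}) / weight x)"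
  obtain L where L: "linear L" "\<And>\<psi>. L \<psi> \<le> price \<psi>" "L \<phi> = price \<phi>"
    using hahn_banach_tight[OF sublinear_price[OF nonempty], of \<phi>] by metis
  obtain Q where Q: "Q \<in> Mhom T \<mu>" and rep: "(\<integral>\<omega>. f \<omega> \<partial>Q) = L \<phi>"
    using ex_dual_optimal_measure[OF nonempty L(1,2)] fc C unfolding \<phi>_def by blast
  let ?D = "dual_feasible T f rs rt" and ?c = "\<lambda>(h, v, g). cost h"
  have "Cb (\<lambda>x. f (restrict x {1..T}) / weight x)"
    by (rule Cb_quotient[OF fc C])
  then have "\<phi> x * weight x = f x" if "x \<in> RT_space T" for x
    using weight_nonzero[of x] unfolding \<phi>_def by (simp add: apply_Bcontfun restrict_RT_space[OF that, simplified])
  \<comment> \<open>On \<open>RT_space T\<close>, where domination is tested, restriction is the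
    identity and the weight cancels.\<close>
  then have "dual_feasible T (\<lambda>x. \<phi> x * weight x) rs rt = ?D"
    by (auto simp: dual_feasible_iff)
  then have val: "(\<integral>\<omega>. f \<omega> \<partial>Q) = (INF d\<in>?D. ?c d)"
    using rep L(3) by (simp add: price_def)
  have ne: "?D \<noteq> {}" using ex_dual_feasible[OF C] by auto
  \<comment> \<open>The infimum passes from the reals to \<open>ereal\<close> unchanged because the
    costs form a nonempty set that is bounded below.\<close>
  have "ereal (\<integral>\<omega>. f \<omega> \<partial>Q) = (INF a\<in>?c ` ?D. ereal a)"
    unfolding val using ne bdd_below_cost[OF nonempty fc C] by (intro ereal_Inf') auto
  then have "ereal (\<integral>\<omega>. f \<omega> \<partial>Q) = (INF (h, v, g)\<in>?D. ereal (cost h))"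
    by (simp add: image_comp comp_def split_beta')
  moreover have "(\<integral>\<omega>. f \<omega> \<partial>Q') \<le> (\<integral>\<omega>. f \<omega> \<partial>Q)" if Q': "Q' \<in> Mhom T \<mu>" for Q'
  proof -
    have "integrable Q' f"
      by (rule integrable_linear_growth[OF Mhom_sets[OF Q'] Mhom_prob_space[OF Q'] Mhom_marg[OF Q'] fc C])
    then show ?thesis
      unfolding val using ne by (intro cINF_greatest) (auto simp: dual_feasible_iff intro: weak_duality[OF Q'])
  qed
  ultimately show ?thesis using Q by blast
qed

end

theorem theorem3p3:
  fixes T :: nat and \<mu> :: "nat \<Rightarrow> real measure" and f :: "(nat \<Rightarrow> real) \<Rightarrow> real"
    and \<theta> :: "nat \<Rightarrow> nat \<Rightarrow> real measure"
    and rs rt :: "nat \<Rightarrow> nat \<Rightarrow> real \<Rightarrow> real"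
  assumes T2: "T \<ge> 2"
    and marginals: "\<forall>t\<in>{1..T}. prob_space (\<mu> t) \<and> sets (\<mu> t) = sets borel \<and> integrable (\<mu> t) (\<lambda>x. x)"
    and f_lin: "Clin_RT T f"
    and nonempty: "Mhom T \<mu> \<noteq> {}"
    and assmA: "\<forall>s\<in>{1..T}. \<forall>t\<in>{1..T}.
       finite_measure (\<theta> s t) \<and> sets (\<theta> s t) = sets borel \<and>
       absolutely_continuous (abs_part (\<mu> t) (\<mu> s)) (\<theta> s t) \<and>
       absolutely_continuous (\<theta> s t) (abs_part (\<mu> t) (\<mu> s)) \<and>
       continuous_on UNIV (rt s t) \<and> bounded (range (rt s t)) \<and>
       (AE x in \<mu> t. RN_deriv (\<mu> t) (\<theta> s t) x = ennreal (rt s t x) \<and> 0 \<le> rt s t x) \<and>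
       continuous_on UNIV (rs s t) \<and> bounded (range (rs s t)) \<and>
       (AE x in \<mu> s. RN_deriv (\<mu> s) (\<theta> s t) x = ennreal (rs s t x) \<and> 0 \<le> rs s t x)"
  shows "\<exists>Q\<in>Mhom T \<mu>.
           (\<forall>Q'\<in>Mhom T \<mu>. (\<integral>\<omega>. f \<omega> \<partial>Q') \<le> (\<integral>\<omega>. f \<omega> \<partial>Q)) \<and>
           ereal (\<integral>\<omega>. f \<omega> \<partial>Q) =
             (INF (h, v, g)\<in>dual_feasible T f rs rt. ereal (\<Sum>t=1..T. \<integral>x. h t x \<partial>\<mu> t))"
proof -
  interpret homogeneous_transport T \<mu> \<theta> rs rt
    by unfold_locales (fact T2 marginals assmA)+
  show ?thesis
    using duality[OF f_lin nonempty] by (simp only: cost_def)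
qed

end
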